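(* Let $\lambda\in(0,1)$. If $H_1,\ldots,H_n$ are linear hyperplanes of $\mathbb{R}^n$ with $H_1\cap\ldots\cap H_n=\{o\}$, and the convex bodies $K$ and $L$ in $\mathbb{R}^n$ are invariant under the orthogonal reflections through $H_1,\ldots,H_n$, then $$\gamma((1-\lambda) K + \lambda L)^{\frac1n}\geq (1-\lambda)\,\gamma(K)^{\frac1n}+\lambda\,\gamma(L)^{\frac1n},$$ where $\gamma$ is the standard Gaussian measure on $\mathbb{R}^n$ and $(1-\lambda)K+\lambda L$ is the usual Minkowski combination.
   Context: A convex body in $\mathbb{R}^n$ is a compact convex set with non-empty interior; $o$ is the origin. The Gaussian measure is $d\gamma(x)=\frac1{(2\pi)^{n/2}}\exp(-\|x\|^2/2)\,dx$ with $\|\cdot\|$ the Euclidean norm. A set $X$ is invariant under a linear map $A$ if $AX=X$. *)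

theory Defs
  imports "HOL-Analysis.Analysis"
begin

definition convex_body :: "'a::euclidean_space set \<Rightarrow> bool" where
  "convex_body K \<longleftrightarrow> compact K \<and> convex K \<and> interior K \<noteq> {}"

definition linear_hyperplane :: "'a::euclidean_space set \<Rightarrow> bool" where
  "linear_hyperplane H \<longleftrightarrow> subspace H \<and> dim H + 1 = DIM('a)"

definition orth_projection :: "'a::euclidean_space set \<Rightarrow> 'a \<Rightarrow> 'a" where
  "orth_projection H x = (THE p. p \<in> H \<and> (\<forall>y\<in>H. orthogonal (x - p) y))"

text \<open>If \<open>x = p + q\<close> with \<open>p\<close> in \<open>H\<close> and \<open>q\<close> orthogonal to \<open>H\<close>, then the reflection
  sends \<open>x\<close> to \<open>p - q = 2 p - x\<close>.\<close>

definition orth_reflection :: "'a::euclidean_space set \<Rightarrow> 'a \<Rightarrow> 'a" where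
  "orth_reflection H x = 2 *\<^sub>R orth_projection H x - x"

definition invariant_under :: "('a \<Rightarrow> 'a) \<Rightarrow> 'a set \<Rightarrow> bool" where
  "invariant_under A X \<longleftrightarrow> A ` X = X"

definition gaussian_measure :: "'a::euclidean_space measure" where
  "gaussian_measure =
     density lborel (\<lambda>x. ennreal (1 / (2 * pi) powr (real DIM('a) / 2) * exp (- ((norm x)\<^sup>2 / 2))))"

definition minkowski_combination :: "real \<Rightarrow> 'a::real_vector set \<Rightarrow> 'a set \<Rightarrow> 'a set" where
  "minkowski_combination l K L = {(1 - l) *\<^sub>R x + l *\<^sub>R y | x y. x \<in> K \<and> y \<in> L}"

lemma orth_projection_eqI:
  fixes H :: "'a::euclidean_space set"
  assumes "subspace H" "p \<in> H" "\<And>y. y \<in> H \<Longrightarrow> orthogonal (x - p) y"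
  shows "orth_projection H x = p"
  unfolding orth_projection_def
proof (rule the_equality)
  show "p \<in> H \<and> (\<forall>y\<in>H. orthogonal (x - p) y)"
    using assms by blast
next
  fix q
  assume q: "q \<in> H \<and> (\<forall>y\<in>H. orthogonal (x - q) y)"
  have "p - q \<in> H"
    using assms(1,2) q by (simp add: subspace_diff)
  then have "(x - q) \<bullet> (p - q) = 0" "(x - p) \<bullet> (p - q) = 0"
    using assms(3) q by (auto simp: orthogonal_def)
  then have "(p - q) \<bullet> (p - q) = 0"
    by (simp add: inner_diff_left)
  then show "q = p"
    by simp
qed

lemma orth_reflection_hyperplane:
  fixes a :: "'a::euclidean_space"
  assumes "a \<noteq> 0"
  shows "orth_reflection {y. a \<bullet> y = 0} x = x - (2 * (a \<bullet> x) / (a \<bullet> a)) *\<^sub>R a"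
proof -
  have "orth_projection {y. a \<bullet> y = 0} x = x - ((a \<bullet> x) / (a \<bullet> a)) *\<^sub>R a"
    using assms
    by (intro orth_projection_eqI)
       (auto simp: subspace_hyperplane orthogonal_def inner_diff_right)
  then show ?thesis
    by (simp add: orth_reflection_def scaleR_diff_right scaleR_2 mult.commute)
qed

end

theory Submission
  imports Defs
begin

text \<open>
  Let \<open>R\<close> be the set of unit normals of hyperplanes whose reflections preserve both bodies.
  It is closed, closed under its own reflections, and spans. If \<open>R\<close> is infinite, it contains a
  circle, and a maximal subspace \<open>W\<close> whose unit sphere lies in \<open>R\<close> splits \<open>R\<close> orthogonally; replacing
  the sphere of \<open>W\<close> by an orthonormal basis and recursing on \<open>W\<^sup>\<bottom>\<close> gives a finite spanning root
  system inside \<open>R\<close>. Its chambers are congruent simplicial cones, so all measures may be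
  compared inside one chamber \<open>C\<close>.

  The simple roots are pairwise obtuse, hence the extreme rays \<open>\<omega>\<^sub>i\<close> of \<open>C\<close> are pairwise acute.
  In the coordinates \<open>x = \<Sum> c\<^sub>i \<omega>\<^sub>i\<close> an invariant convex set is therefore a down-set of the
  orthant, and the Gaussian density is decreasing and satisfies a geometric-mean inequality in
  \<open>c\<close>. For \<open>\<theta>\<close> in \<open>(0, 1)\<close> and \<open>\<kappa> = ((1 - \<lambda>) / (1 - \<theta>))\<^bsup>1 - \<theta>\<^esup> (\<lambda> / \<theta>)\<^bsup>\<theta>\<^esup> \<le> 1\<close>, weighted AM-GM
  places \<open>\<kappa>\<close> times the coordinatewise geometric mean of a point of \<open>K\<close> and a point of \<open>L\<close> in
  \<open>(1 - \<lambda>) K + \<lambda> L\<close>, so the multiplicative form of the Prekopa-Leindler inequality yields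
  \<open>\<kappa>\<^sup>n \<gamma>(K)\<^bsup>1 - \<theta>\<^esup> \<gamma>(L)\<^bsup>\<theta>\<^esup> \<le> \<gamma>((1 - \<lambda>) K + \<lambda> L)\<close>. The optimal \<open>\<theta>\<close> gives the theorem.
\<close>

section \<open>Finite root systems inside closed reflection-invariant sets\<close>

text \<open>The obstacle is that the Gaussian weight is log-concave but not homogeneous. Symmetry
  supplies a substitute: in down-set coordinates the exponent \<theta> of the geometric mean may
  differ from \<lambda>, and shrinking by \<kappa> costs only the Jacobian
  \<open>\<kappa>^n\<close>, because moving towards the origin raises the density. With
  \<open>a = \<gamma>(K)^(1/n)\<close> and \<open>b = \<gamma>(L)^(1/n)\<close>, the quantity
  \<open>\<kappa> a^(1-\<theta>) b^\<theta>\<close> is largest at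
  \<open>\<theta> = \<lambda> b / ((1-\<lambda>) a + \<lambda> b)\<close>, where weighted AM-GM is
  an equality and the value is \<open>(1-\<lambda>) a + \<lambda> b\<close>. Finiteness is a genuine
  issue: reflections in two lines of the plane whose angle is an irrational multiple of pi generate
  an infinite group without open chambers. Only the finite subsystem cuts the space, while the
  bodies may keep more symmetry.\<close>

definition reflect :: "'a::real_inner \<Rightarrow> 'a \<Rightarrow> 'a" where
  "reflect u x = x - (2 * (x \<bullet> u)) *\<^sub>R u"

text \<open>Finiteness, spanning and integrality are left out on purpose: one notion has to cover
  the possibly infinite set of all symmetry normals of two bodies as well as its finite subsystems,
  including non-crystallographic dihedral ones.\<close>

definition root_set :: "'a::real_inner set \<Rightarrow> bool" where
  "root_set R \<longleftrightarrow> (\<forall>u\<in>R. norm u = 1) \<and> (\<forall>u\<in>R. \<forall>v\<in>R. reflect u v \<in> R)"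

lemma linear_reflect: "linear (reflect u)"
  by (rule linearI) (simp_all add: reflect_def inner_add_left algebra_simps)

lemma reflect_involution: "norm u = 1 \<Longrightarrow> reflect u (reflect u x) = x"
  by (simp add: reflect_def inner_diff_left norm_eq_1)

lemma reflect_inner_swap: "reflect u x \<bullet> y = x \<bullet> reflect u y"
  by (simp add: reflect_def inner_diff_left inner_diff_right inner_commute)

lemma reflect_self: "norm u = 1 \<Longrightarrow> reflect u u = - u"
  by (simp add: reflect_def norm_eq_1 scaleR_2 algebra_simps)

lemma reflect_orthogonal: "x \<bullet> u = 0 \<Longrightarrow> reflect u x = x"
  by (simp add: reflect_def)

lemma orthogonal_transformation_reflect:
  "norm u = 1 \<Longrightarrow> orthogonal_transformation (reflect u)"
  by (simp add: orthogonal_transformation_def linear_reflect reflect_inner_swap reflect_involution)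

text \<open>Conjugating a reflection by an orthogonal map reflects in the image of the normal. Hence
  the normals of the reflections that preserve a set form a root set.\<close>

lemma reflect_reflect:
  assumes "norm u = 1"
  shows "reflect (reflect u v) x = reflect u (reflect v (reflect u x))"
proof -
  have "reflect u (reflect v (reflect u x))
      = reflect u (reflect u x) - (2 * (reflect u x \<bullet> v)) *\<^sub>R reflect u v"
    by (simp only: reflect_def[of v] linear_diff[OF linear_reflect] linear_scale[OF linear_reflect])
  then show ?thesis
    using assms by (simp add: reflect_def[of "reflect u v"] reflect_involution reflect_inner_swap)
qed

lemma root_set_uminus: "root_set R \<Longrightarrow> u \<in> R \<Longrightarrow> - u \<in> R"
  using reflect_self[of u] by (metis root_set_def)

text \<open>Two roots at angle \<phi> generate all multiples of \<phi> on their circle: reflecting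
  the \<open>j\<close>-th vector in its successor gives the negative of the next one. Two
  consecutive members are carried because each step uses both.\<close>

lemma root_set_dihedral:
  assumes R: "root_set R" and u: "u \<in> R" "cos \<phi> *\<^sub>R u + sin \<phi> *\<^sub>R e \<in> R" and e: "norm e = 1" "u \<bullet> e = 0"
  shows "cos (real j * \<phi>) *\<^sub>R u + sin (real j * \<phi>) *\<^sub>R e \<in> R
       \<and> cos (real (Suc j) * \<phi>) *\<^sub>R u + sin (real (Suc j) * \<phi>) *\<^sub>R e \<in> R"
proof (induction j)
  case 0
  then show ?case using u by simp
next
  case (Suc j)
  define v where "v k = cos (real k * \<phi>) *\<^sub>R u + sin (real k * \<phi>) *\<^sub>R e" for k
  have uu: "u \<bullet> u = 1" "e \<bullet> e = 1" using R u e by (auto simp: root_set_def norm_eq_1)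
  have "v j \<bullet> v (Suc j) = cos (real (Suc j) * \<phi> - real j * \<phi>)"
    unfolding cos_diff v_def using uu e
    by (simp add: inner_add_left inner_add_right inner_commute mult_ac)
  then have 1: "v j \<bullet> v (Suc j) = cos \<phi>" by (simp add: algebra_simps)
  \<comment> \<open>The Chebyshev recurrence, from expanding around the middle angle
    \<open>real (Suc j) * \<phi>\<close>.\<close>
  have c: "cos (real (Suc (Suc j)) * \<phi>) = 2 * cos \<phi> * cos (real (Suc j) * \<phi>) - cos (real j * \<phi>)"
    and s: "sin (real (Suc (Suc j)) * \<phi>) = 2 * cos \<phi> * sin (real (Suc j) * \<phi>) - sin (real j * \<phi>)"
  proof -
    have eq: "real (Suc (Suc j)) * \<phi> = real (Suc j) * \<phi> + \<phi>" "real j * \<phi> = real (Suc j) * \<phi> - \<phi>"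
      by (simp_all add: algebra_simps)
    show "cos (real (Suc (Suc j)) * \<phi>) = 2 * cos \<phi> * cos (real (Suc j) * \<phi>) - cos (real j * \<phi>)"
      unfolding eq cos_add cos_diff by simp
    show "sin (real (Suc (Suc j)) * \<phi>) = 2 * cos \<phi> * sin (real (Suc j) * \<phi>) - sin (real j * \<phi>)"
      unfolding eq sin_add sin_diff by simp
  qed
  have "reflect (v (Suc j)) (v j) = - v (Suc (Suc j))"
    unfolding reflect_def 1 unfolding v_def c s by (simp add: algebra_simps)
  moreover have "reflect (v (Suc j)) (v j) \<in> R"
    using Suc R by (auto simp: root_set_def v_def)
  ultimately have "v (Suc (Suc j)) \<in> R"
    using root_set_uminus[OF R] by (metis minus_minus)
  then show ?case using Suc by (auto simp: v_def)
qed

text \<open>Near an accumulation point \<open>u\<close> there are roots at arbitrarily small angles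
  \<phi> from \<open>u\<close>. By the dihedral lemma each yields a net of mesh \<phi> on a great
  circle through \<open>u\<close>; along a subsequence the tangent directions of these circles
  converge, and closedness fills the limiting circle.\<close>

lemma infinite_root_set_circle:
  fixes R :: "'a::euclidean_space set"
  assumes R: "root_set R" and "closed R" "infinite R"
  obtains u e where "norm u = 1" "norm e = 1" "u \<bullet> e = 0"
    "\<And>a b. a\<^sup>2 + b\<^sup>2 = 1 \<Longrightarrow> a *\<^sub>R u + b *\<^sub>R e \<in> R"
proof -
  have norm1: "norm x = 1" if "x \<in> R" for x using R that by (auto simp: root_set_def)
  have "bounded R" using norm1 by (auto simp: bounded_iff)
  then obtain u where lim: "u islimpt R"
    using bounded_infinite_imp_islimpt[of R R] assms by auto
  have uR: "u \<in> R" using lim \<open>closed R\<close> closed_limpt by blast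
  obtain f where f: "\<And>n. f n \<in> R - {u}" "f \<longlonglongrightarrow> u"
    using lim unfolding islimpt_sequential by blast
  have uu: "u \<bullet> u = 1" using norm1[OF uR] by (simp add: norm_eq_1)
  have "(\<lambda>n. u \<bullet> f n) \<longlonglongrightarrow> u \<bullet> u" by (intro tendsto_intros f)
  then have "\<forall>\<^sub>F n in sequentially. 0 < u \<bullet> f n"
    using uu by (auto dest: order_tendstoD(1)[of _ _ _ 0])
  then obtain N where N: "\<And>n. n \<ge> N \<Longrightarrow> 0 < u \<bullet> f n"
    by (auto simp: eventually_sequentially)
  \<comment> \<open>Passing to a tail with positive inner product keeps the sequence away from
    \<open>- u\<close>, where the tangent direction \<open>e n\<close> would be undefined.\<close>
  define g where "g n = f (n + N)" for n
  have g: "g n \<in> R" "g n \<noteq> u" "0 < u \<bullet> g n" for n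
    using f(1)[of "n + N"] N[of "n + N"] by (auto simp: g_def)
  have glim: "g \<longlonglongrightarrow> u" unfolding g_def using f(2) by (rule LIMSEQ_ignore_initial_segment)
  have gg: "g n \<bullet> g n = 1" for n using norm1[OF g(1)] by (simp add: norm_eq_1)
  have lt1: "u \<bullet> g n < 1" for n
  proof -
    have "0 < (u - g n) \<bullet> (u - g n)" using g(2)[of n] by simp
    also have "\<dots> = 2 - 2 * (u \<bullet> g n)"
      using uu gg[of n] by (simp add: inner_diff_left inner_diff_right inner_commute)
    finally show ?thesis by simp
  qed
  define \<phi> where "\<phi> n = arccos (u \<bullet> g n)" for n
  have cos\<phi>: "cos (\<phi> n) = u \<bullet> g n" for n
    unfolding \<phi>_def using g(3)[of n] lt1[of n] by (intro cos_arccos) auto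
  have \<phi>: "0 < \<phi> n" "\<phi> n < pi" for n
    using arccos_lt_bounded[of "u \<bullet> g n"] g(3)[of n] lt1[of n] by (auto simp: \<phi>_def)
  have sin\<phi>: "0 < sin (\<phi> n)" for n using \<phi>[of n] by (rule sin_gt_zero)
  define e where "e n = (1 / sin (\<phi> n)) *\<^sub>R (g n - cos (\<phi> n) *\<^sub>R u)" for n
  have geq: "cos (\<phi> n) *\<^sub>R u + sin (\<phi> n) *\<^sub>R e n = g n" for n
    using sin\<phi>[of n] by (simp add: e_def)
  have ue: "u \<bullet> e n = 0" for n
    by (simp add: e_def inner_diff_right uu cos\<phi>)
  have ne: "norm (e n) = 1" for n
  proof -
    have "g n \<bullet> g n = (cos (\<phi> n))\<^sup>2 + (sin (\<phi> n))\<^sup>2 * (e n \<bullet> e n)"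
      unfolding geq[of n, symmetric] using uu ue[of n]
      by (simp add: inner_add_left inner_add_right inner_commute power2_eq_square)
    then have "(sin (\<phi> n))\<^sup>2 * (e n \<bullet> e n) = (sin (\<phi> n))\<^sup>2"
      using gg[of n] sin_cos_squared_add[of "\<phi> n"] by linarith
    then show ?thesis using sin\<phi>[of n] by (simp add: norm_eq_1)
  qed
  have \<phi>lim: "\<phi> \<longlonglongrightarrow> 0"
  proof -
    have "(\<lambda>n. u \<bullet> g n) \<longlonglongrightarrow> u \<bullet> u" by (intro tendsto_intros glim)
    then have "(\<lambda>n. arccos (u \<bullet> g n)) \<longlonglongrightarrow> arccos 1"
      using g(3) lt1 uu
      by (intro continuous_on_tendsto_compose[OF continuous_on_arccos'])
         (auto intro!: always_eventually simp: less_imp_le order_trans[OF _ less_imp_le[OF g(3)]])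
    then show ?thesis by (simp add: \<phi>_def[abs_def])
  qed
  have "compact (sphere (0::'a) 1)" by simp
  then obtain l r where l: "l \<in> sphere 0 1" "strict_mono r" "(e \<circ> r) \<longlonglongrightarrow> l"
    using ne unfolding compact_def by (metis (no_types, lifting) mem_sphere_0)
  have circle: "cos t *\<^sub>R u + sin t *\<^sub>R l \<in> R" if "0 \<le> t" for t
  proof -
    \<comment> \<open>The number of steps of size \<open>\<phi> (r n)\<close> that fit below
      \<open>t\<close>; the error is at most one step and so tends to 0.\<close>
    define j where "j n = nat \<lfloor>t / \<phi> (r n)\<rfloor>" for n
    have jb: "\<bar>real (j n) * \<phi> (r n) - t\<bar> \<le> \<phi> (r n)" for n
    proof -
      have "real (j n) = of_int \<lfloor>t / \<phi> (r n)\<rfloor>"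
        unfolding j_def using that \<phi>[of "r n"] by (simp add: less_imp_le)
      then have "real (j n) \<le> t / \<phi> (r n)" "t / \<phi> (r n) < real (j n) + 1" by linarith+
      then show ?thesis using \<phi>[of "r n"] by (simp add: field_simps abs_le_iff)
    qed
    have \<phi>r: "(\<lambda>n. \<phi> (r n)) \<longlonglongrightarrow> 0"
      using LIMSEQ_subseq_LIMSEQ[OF \<phi>lim l(2)] by (simp add: o_def)
    have "(\<lambda>n. real (j n) * \<phi> (r n) - t) \<longlonglongrightarrow> 0"
      by (rule Lim_null_comparison[OF _ \<phi>r]) (use jb in auto)
    then have jt: "(\<lambda>n. real (j n) * \<phi> (r n)) \<longlonglongrightarrow> t"
      by (simp add: LIM_zero_iff)
    have "(\<lambda>n. cos (real (j n) * \<phi> (r n)) *\<^sub>R u + sin (real (j n) * \<phi> (r n)) *\<^sub>R e (r n)) \<longlonglongrightarrow> cos t *\<^sub>R u + sin t *\<^sub>R l"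
      using l(3) by (intro tendsto_intros jt) (simp add: o_def)
    moreover have "cos (real (j n) * \<phi> (r n)) *\<^sub>R u + sin (real (j n) * \<phi> (r n)) *\<^sub>R e (r n) \<in> R" for n
      using root_set_dihedral[OF R uR, of "\<phi> (r n)" "e (r n)" "j n"] geq[of "r n"] g(1)[of "r n"] ne ue by auto
    ultimately show ?thesis
      by (rule closed_sequentially[OF \<open>closed R\<close>, rotated])
  qed
  have "(\<lambda>n. u \<bullet> e (r n)) \<longlonglongrightarrow> u \<bullet> l"
    using l(3) by (intro tendsto_intros) (simp add: o_def)
  then have ul: "u \<bullet> l = 0" using ue by (simp add: LIMSEQ_const_iff)
  show ?thesis
  proof
    show "norm u = 1" "norm l = 1" "u \<bullet> l = 0" using norm1[OF uR] l(1) ul by auto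
    fix a b :: real assume "a\<^sup>2 + b\<^sup>2 = 1"
    then obtain t where "0 \<le> t" "a = cos t" "b = sin t" using sincos_total_2pi by metis
    then show "a *\<^sub>R u + b *\<^sub>R l \<in> R" using circle by auto
  qed
qed

text \<open>
  If \<open>v = p + q\<close> with \<open>p\<close> in \<open>W\<close> and \<open>q\<close> orthogonal to \<open>W\<close>, then \<open>W\<close> together with \<open>q\<close> spans the new
  subspace. The set \<open>B\<close> of heights over \<open>W\<close> that occur in \<open>R\<close> contains with \<open>b = sin \<phi>\<close> the
  whole interval up to \<open>2 b sqrt (1 - b\<^sup>2) = sin (2 \<phi>)\<close>, so it grows to \<open>[0, 1]\<close>.
\<close>

lemma root_sphere_extend:
  fixes R :: "'a::euclidean_space set"
  assumes R: "root_set R" and W: "subspace W" "2 \<le> dim W"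
    and WR: "\<And>w. w \<in> W \<Longrightarrow> norm w = 1 \<Longrightarrow> w \<in> R"
    and v: "v \<in> R" "v \<notin> W" and nv: "w1 \<in> W" "v \<bullet> w1 \<noteq> 0"
  obtains W' where "subspace W'" "dim W < dim W'" "\<And>w. w \<in> W' \<Longrightarrow> norm w = 1 \<Longrightarrow> w \<in> R"
proof -
  have norm1: "norm x = 1" if "x \<in> R" for x using R that by (auto simp: root_set_def)
  obtain p q where pq: "p \<in> span W" "\<And>w. w \<in> span W \<Longrightarrow> orthogonal q w" "v = p + q"
    using orthogonal_subspace_decomp_exists[of W v] by metis
  have spW: "span W = W" using W by simp
  have "q \<noteq> 0" using pq v spW by auto
  have "p \<noteq> 0"
  proof
    assume "p = 0"
    then show False using pq(2,3) nv spW by (auto simp: orthogonal_def)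
  qed
  define e where "e = q /\<^sub>R norm q"
  define b0 where "b0 = norm q"
  have e0: "norm e = 1" "\<And>w. w \<in> W \<Longrightarrow> w \<bullet> e = 0"
    using \<open>q \<noteq> 0\<close> pq(2) spW
    by (auto simp: e_def orthogonal_def inner_commute)
  then have e: "norm e = 1" "e \<bullet> e = 1" "\<And>w. w \<in> W \<Longrightarrow> w \<bullet> e = 0"
    by (auto simp: norm_eq_1)
  have b0: "0 < b0" using \<open>q \<noteq> 0\<close> by (simp add: b0_def)
  have unit: "(norm (w + b *\<^sub>R e))\<^sup>2 = (norm w)\<^sup>2 + b\<^sup>2" if "w \<in> W" for w b
  proof -
    have "w \<bullet> e = 0" "e \<bullet> w = 0" using e(3)[OF that] by (simp_all add: inner_commute)
    then show ?thesis unfolding power2_norm_eq_inner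
      using e(2) by (simp add: inner_add_left inner_add_right power2_eq_square)
  qed
  have vq: "v = p + b0 *\<^sub>R e" using pq(3) \<open>q \<noteq> 0\<close> by (simp add: e_def b0_def)
  have np: "(norm p)\<^sup>2 = 1 - b0\<^sup>2"
    using unit[of p b0] norm1[OF v(1)] pq(1) spW vq by simp
  define B where "B = {b. \<forall>w\<in>W. norm w = 1 \<longrightarrow> sqrt (1 - b\<^sup>2) *\<^sub>R w + b *\<^sub>R e \<in> R}"
  \<comment> \<open>The reflection in the normalised difference \<open>w0 - w\<close> lies in the
    system, exchanges \<open>w0\<close> with \<open>w\<close> and fixes \<open>e\<close>. Membership
    of a vector in \<open>R\<close> therefore depends only on its height over
    \<open>W\<close>.\<close>
  have rot: "a *\<^sub>R w + b *\<^sub>R e \<in> R"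
    if "a *\<^sub>R w0 + b *\<^sub>R e \<in> R" "w0 \<in> W" "w \<in> W" "norm w0 = 1" "norm w = 1" for a b w0 w
  proof (cases "w = w0")
    case False
    define u where "u = (w0 - w) /\<^sub>R norm (w0 - w)"
    have u: "norm u = 1" "u \<in> W" using False that W by (auto simp: u_def subspace_diff subspace_scale)
    have ww: "w0 \<bullet> w0 = 1" "w \<bullet> w = 1" using that by (auto simp: norm_eq_1)
    have n2: "(norm (w0 - w))\<^sup>2 = 2 - 2 * (w0 \<bullet> w)"
      unfolding power2_norm_eq_inner using ww by (simp add: inner_diff_left inner_diff_right inner_commute)
    have "reflect u w0 = w0 - (2 * (w0 \<bullet> (w0 - w)) / (norm (w0 - w))\<^sup>2) *\<^sub>R (w0 - w)"
      by (simp add: reflect_def u_def power2_eq_square divide_inverse)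
    also have "2 * (w0 \<bullet> (w0 - w)) / (norm (w0 - w))\<^sup>2 = 1"
    proof -
      have "(norm (w0 - w))\<^sup>2 \<noteq> 0" using False by simp
      then show ?thesis unfolding n2 using ww by (simp add: inner_diff_right)
    qed
    finally have "reflect u w0 = w" by simp
    moreover have "reflect u e = e" using e(3)[OF u(2)] by (simp add: reflect_orthogonal inner_commute)
    ultimately have "reflect u (a *\<^sub>R w0 + b *\<^sub>R e) = a *\<^sub>R w + b *\<^sub>R e"
      by (simp add: linear_add[OF linear_reflect] linear_scale[OF linear_reflect])
    then show ?thesis using R WR[OF u(2,1)] that(1) by (metis root_set_def)
  qed (use that in auto)
  have norm_form: "b \<in> B" if "x + b *\<^sub>R e \<in> R" "x \<in> W" for x b
  proof -
    have nx: "(norm x)\<^sup>2 = 1 - b\<^sup>2" using unit[of x b] norm1[OF that(1)] that(2) by simp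
    then have nx': "norm x = sqrt (1 - b\<^sup>2)" by (metis norm_ge_zero real_sqrt_unique)
    show ?thesis
    proof (cases "x = 0")
      case True
      then show ?thesis using that nx' by (simp add: B_def)
    next
      case False
      define y where "y = x /\<^sub>R norm x"
      have y: "norm y = 1" "y \<in> W" "norm x *\<^sub>R y = x"
        using False that W by (auto simp: y_def subspace_scale)
      then have "norm x *\<^sub>R w + b *\<^sub>R e \<in> R" if "w \<in> W" "norm w = 1" for w
        using rot[of "norm x" y b w] \<open>x + b *\<^sub>R e \<in> R\<close> that by simp
      then show ?thesis by (simp add: B_def flip: nx')
    qed
  qed
  have "b0 \<in> B" using norm_form[of p b0] v(1) vq pq(1) spW by simp
  have "0 < (norm p)\<^sup>2" using \<open>p \<noteq> 0\<close> by simp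
  then have b01: "b0\<^sup>2 < 1" using np by simp
  obtain S where S: "S \<subseteq> W" "pairwise orthogonal S" "\<And>x. x \<in> S \<Longrightarrow> norm x = 1" "card S = dim W"
    using orthonormal_basis_subspace[OF W(1)] by metis
  obtain w0 w2 where w02: "w0 \<in> S" "w2 \<in> S" "w0 \<noteq> w2"
  proof -
    have "2 \<le> card S" using S(4) W(2) by simp
    then obtain T where "T \<subseteq> S" "card T = 2" by (metis obtain_subset_with_card_n)
    then show ?thesis using that by (auto simp: card_2_iff)
  qed
  have w0: "w0 \<in> W" "w2 \<in> W" "w0 \<bullet> w0 = 1" "w2 \<bullet> w2 = 1" "w0 \<bullet> w2 = 0" "norm w0 = 1" "norm w2 = 1"
    using w02 S by (auto simp: pairwise_def orthogonal_def simp flip: norm_eq_1)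
  have step: "c \<in> B" if b: "b \<in> B" "0 \<le> b" "b \<le> 1" and c: "0 \<le> c" "c \<le> 2 * b * sqrt (1 - b\<^sup>2)" for b c
  proof (cases "c = 0")
    case True
    then show ?thesis using WR by (simp add: B_def)
  next
    case False
    define a where "a = sqrt (1 - b\<^sup>2)"
    have ab: "0 < 2 * a * b" using False c by (simp add: a_def mult_ac)
    \<comment> \<open>If \<open>w0 \<bullet> w = - \<tau>\<close>, reflecting \<open>w0\<close> in
      \<open>r = a w + b e\<close> produces height \<open>2 a \<tau> b\<close>, so \<tau> is solved
      for \<open>c\<close>. The second orthonormal vector \<open>w2\<close> makes room in
      \<open>W\<close> for a unit vector \<open>w\<close> with this inner product.\<close>
    define \<tau> where "\<tau> = c / (2 * a * b)"
    have \<tau>: "0 \<le> \<tau>" "\<tau> \<le> 1" using ab c by (auto simp: \<tau>_def a_def mult_ac)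
    define w where "w = (- \<tau>) *\<^sub>R w0 + sqrt (1 - \<tau>\<^sup>2) *\<^sub>R w2"
    have t2: "\<tau>\<^sup>2 \<le> 1" using \<tau> by (simp add: power_le_one)
    have wW: "w \<in> W" unfolding w_def using w0 W by (intro subspace_add subspace_scale) auto
    have "w \<bullet> w = 1"
      using w0 t2 by (simp add: w_def inner_add_left inner_add_right inner_commute power2_eq_square[symmetric] inner_diff_left inner_diff_right)
    then have nw: "norm w = 1" by (simp add: norm_eq_1)
    have ww0: "w0 \<bullet> w = - \<tau>" using w0 by (simp add: w_def inner_add_right inner_diff_right)
    define r where "r = a *\<^sub>R w + b *\<^sub>R e"
    have "r \<in> R" using b(1) wW nw by (auto simp: B_def r_def a_def)
    then have "reflect r w0 \<in> R" using R WR w0 by (auto simp: root_set_def)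
    moreover have "w0 \<bullet> r = - a * \<tau>" using ww0 e(3)[OF w0(1)] by (simp add: r_def inner_add_right)
    then have "reflect r w0 = (w0 + (2 * a * \<tau> * a) *\<^sub>R w) + (2 * a * \<tau> * b) *\<^sub>R e"
      by (simp add: reflect_def r_def algebra_simps)
    moreover have "2 * a * \<tau> * b = c" using ab by (auto simp: \<tau>_def)
    ultimately show ?thesis
      using norm_form[of "w0 + (2 * a * \<tau> * a) *\<^sub>R w" c] w0 wW W by (simp add: subspace_add subspace_scale)
  qed
  define b1 where "b1 = 2 * b0 * sqrt (1 - b0\<^sup>2)"
  have b1: "0 < b1" using b0 b01 by (simp add: b1_def)
  \<comment> \<open>For \<open>c \<le> 1\<close> the height \<open>b = c / sqrt 2\<close> satisfies
    \<open>b\<^sup>2 \<le> 1/2\<close>, so the factor \<open>2 * sqrt (1 - b\<^sup>2)\<close> is at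
    least \<open>sqrt 2\<close>: every round enlarges the reachable interval by this factor until it
    covers the unit interval.\<close>
  have grow: "\<forall>c. 0 \<le> c \<and> c \<le> 1 \<and> c \<le> b1 * sqrt 2 ^ k \<longrightarrow> c \<in> B" for k
  proof (induction k)
    case 0
    then show ?case
      using step[OF \<open>b0 \<in> B\<close>] b0 b01 by (auto simp: b1_def abs_square_less_1)
  next
    case (Suc k)
    show ?case
    proof (intro allI impI)
      fix c assume c: "0 \<le> c \<and> c \<le> 1 \<and> c \<le> b1 * sqrt 2 ^ Suc k"
      define b where "b = c / sqrt 2"
      have b: "0 \<le> b" "b \<le> 1" "b \<le> b1 * sqrt 2 ^ k"
        using c by (auto simp: b_def field_simps intro: order_trans[of c 1 "sqrt 2"])
      have b2: "b\<^sup>2 = c\<^sup>2 / 2" by (simp add: b_def power_divide)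
      have "c\<^sup>2 \<le> 1" using c by (simp add: power_le_one)
      then have "sqrt (1 / 2) \<le> sqrt (1 - b\<^sup>2)" unfolding b2 by (intro real_sqrt_le_mono) simp
      then have "2 * b * sqrt (1 / 2) \<le> 2 * b * sqrt (1 - b\<^sup>2)"
        using b by (intro mult_left_mono) auto
      moreover have "2 * b * sqrt (1 / 2) = c"
        by (simp add: b_def real_sqrt_divide field_simps)
      ultimately show "c \<in> B" using step[of b c] Suc b c by auto
    qed
  qed
  have allB: "c \<in> B" if "0 \<le> c" "c \<le> 1" for c
  proof -
    obtain k where "1 / b1 < sqrt 2 ^ k" using real_arch_pow[of "sqrt 2" "1 / b1"] by auto
    then have "1 \<le> b1 * sqrt 2 ^ k" using b1 by (simp add: field_simps)
    then show ?thesis using grow[of k] that by auto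
  qed
  show ?thesis
  proof
    show "subspace (span (insert e W))" by (rule subspace_span)
    have "e \<notin> span W"
    proof
      assume "e \<in> span W"
      then have "e \<bullet> e = 0" using e(3) spW by blast
      then show False using e(2) by simp
    qed
    then show "dim W < dim (span (insert e W))" by (simp add: dim_insert)
    fix x assume x: "x \<in> span (insert e W)" "norm x = 1"
    obtain \<beta> where \<beta>: "x - \<beta> *\<^sub>R e \<in> W" using x(1) spW by (auto simp: span_insert)
    have pos: "y + c *\<^sub>R e \<in> R" if y: "y \<in> W" "norm (y + c *\<^sub>R e) = 1" "0 \<le> c" for y c
    proof -
      have ny: "(norm y)\<^sup>2 = 1 - c\<^sup>2" using unit[OF y(1), of c] y(2) by simp
      then have "c\<^sup>2 \<le> 1" by (metis diff_ge_0_iff_ge zero_le_power2)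
      then have "c \<in> B" using y(3) by (intro allB) (auto simp: power2_le_iff_abs_le abs_square_le_1)
      have ny': "norm y = sqrt (1 - c\<^sup>2)" using ny by (metis norm_ge_zero real_sqrt_unique)
      show ?thesis
      proof (cases "y = 0")
        case True
        then show ?thesis using \<open>c \<in> B\<close> w0 ny' by (auto simp: B_def)
      next
        case False
        then have "y /\<^sub>R norm y \<in> W" "norm (y /\<^sub>R norm y) = 1"
          using y(1) W(1) by (simp_all add: subspace_scale)
        then have "sqrt (1 - c\<^sup>2) *\<^sub>R (y /\<^sub>R norm y) + c *\<^sub>R e \<in> R"
          using \<open>c \<in> B\<close> unfolding B_def by blast
        then show ?thesis using False unfolding ny'[symmetric] by simp
      qed
    qed
    show "x \<in> R"
    proof (cases "0 \<le> \<beta>")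
      case True
      then show ?thesis using pos[OF \<beta>, of \<beta>] x by simp
    next
      case False
      have "- (x - \<beta> *\<^sub>R e) \<in> W" by (rule subspace_neg[OF W(1) \<beta>])
      moreover have "- (x - \<beta> *\<^sub>R e) + (- \<beta>) *\<^sub>R e = - x" by simp
      ultimately have "- x \<in> R" using pos[of "- (x - \<beta> *\<^sub>R e)" "- \<beta>"] x False by simp
      then show ?thesis using root_set_uminus[OF R] by (metis minus_minus)
    qed
  qed
qed

text \<open>Roots in orthogonal subspaces fix one another, so finite systems chosen separately in
  \<open>W\<close> and in its complement unite to a root set. The recursion terminates because
  \<open>W\<close> is nonzero, which makes the span of the remaining roots strictly smaller.\<close>

lemma finite_root_subset:
  fixes R :: "'a::euclidean_space set"
  assumes "root_set R" "closed R"
  shows "\<exists>\<Phi>\<subseteq>R. finite \<Phi> \<and> root_set \<Phi> \<and> span \<Phi> = span R"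
  using assms
proof (induction "dim R" arbitrary: R rule: less_induct)
  case less
  note R = less.prems(1)
  show ?case
  proof (cases "finite R")
    case True
    then show ?thesis using R by blast
  next
    case False
    obtain u e where ue: "norm u = 1" "norm e = 1" "u \<bullet> e = 0"
      and circ: "\<And>a b. a\<^sup>2 + b\<^sup>2 = 1 \<Longrightarrow> a *\<^sub>R u + b *\<^sub>R e \<in> R"
      using infinite_root_set_circle[OF R less.prems(2) False] by metis
    define P where "P W \<longleftrightarrow> subspace W \<and> (\<forall>w\<in>W. norm w = 1 \<longrightarrow> w \<in> R)" for W
    have "u \<noteq> e" using ue by (auto simp: norm_eq_1)
    have "independent {u, e}"
      using ue by (intro pairwise_orthogonal_independent)
        (auto simp: pairwise_def orthogonal_def inner_commute)
    then have dim2: "dim (span {u, e}) = 2"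
      using \<open>u \<noteq> e\<close> by (simp add: dim_eq_card_independent)
    have "P (span {u, e})"
      unfolding P_def
    proof (intro conjI ballI impI)
      fix w assume w: "w \<in> span {u, e}" "norm w = 1"
      then obtain a b where ab: "w = a *\<^sub>R u + b *\<^sub>R e"
        by (auto simp: span_insert algebra_simps)
      have "w \<bullet> w = a\<^sup>2 + b\<^sup>2" unfolding ab using ue
        by (simp add: inner_add_left inner_add_right inner_commute norm_eq_1 power2_eq_square)
      then show "w \<in> R" using w circ unfolding ab by (simp add: norm_eq_1)
    qed simp
    obtain W where W: "P W" and max: "\<And>W'. P W' \<Longrightarrow> dim W' \<le> dim W"
    proof -
      have "\<exists>W. P W \<and> (\<forall>W'. P W' \<longrightarrow> dim W' \<le> dim W)"
        using \<open>P (span {u, e})\<close> by (rule ex_has_greatest_nat[of P _ dim "Suc DIM('a)"]) (simp add: less_Suc_eq_le dim_subset_UNIV)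
      then show ?thesis using that by blast
    qed
    have W2: "subspace W" "2 \<le> dim W" and WR: "\<And>w. w \<in> W \<Longrightarrow> norm w = 1 \<Longrightarrow> w \<in> R"
      using W max[OF \<open>P (span {u, e})\<close>] dim2 by (auto simp: P_def)
    \<comment> \<open>A root neither in \<open>W\<close> nor orthogonal to it would enlarge the
      sphere contained in \<open>R\<close>, against the maximality of \<open>dim W\<close>.\<close>
    have split: "v \<in> W \<or> (\<forall>w\<in>W. v \<bullet> w = 0)" if v: "v \<in> R" for v
    proof (rule ccontr)
      assume "\<not> ?thesis"
      then obtain w where w: "v \<notin> W" "w \<in> W" "v \<bullet> w \<noteq> 0" by blast
      obtain W' where "subspace W'" "dim W < dim W'" "\<And>w. w \<in> W' \<Longrightarrow> norm w = 1 \<Longrightarrow> w \<in> R"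
        using root_sphere_extend[OF R W2 WR v w] by blast
      then show False using max[of W'] by (auto simp: P_def)
    qed
    define R' where "R' = R \<inter> {x. \<forall>w\<in>W. x \<bullet> w = 0}"
    have sub: "subspace {x. \<forall>w\<in>W. x \<bullet> w = 0}"
      by (auto simp: subspace_def inner_add_left)
    have R': "root_set R'"
      using R unfolding root_set_def R'_def reflect_def by (auto simp: inner_diff_left)
    have "closed {x. \<forall>w\<in>W. x \<bullet> w = 0}"
      using sub by (rule closed_subspace)
    then have cR': "closed R'" using less.prems(2) by (auto simp: R'_def)
    obtain B where B: "B \<subseteq> W" "pairwise orthogonal B" "\<And>x. x \<in> B \<Longrightarrow> norm x = 1" "card B = dim W" "span B = W" "independent B"
      using orthonormal_basis_subspace[OF W2(1)] by metis
    have finB: "finite B" using B(6) by (rule independent_imp_finite)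
    obtain w where w: "w \<in> B" using B(4) W2(2) by (metis card.empty ex_in_conv not_numeral_le_zero)
    have wW: "w \<in> W" "norm w = 1" using w B by auto
    have spR': "span R' \<subseteq> {x. \<forall>w\<in>W. x \<bullet> w = 0}"
      using sub by (intro span_minimal) (auto simp: R'_def)
    have "w \<notin> span R'"
      using spR' wW by (auto simp: norm_eq_1)
    moreover have "w \<in> span R" using WR[OF wW] by (rule span_base)
    ultimately have "dim R' < dim R"
      by (intro dim_psubset) (metis Int_lower1 R'_def psubsetI span_mono)
    then obtain \<Phi>' where \<Phi>': "\<Phi>' \<subseteq> R'" "finite \<Phi>'" "root_set \<Phi>'" "span \<Phi>' = span R'"
      using less.hyps[OF _ R' cR'] by blast
    \<comment> \<open>The negatives are included because a basis vector is sent to its negative by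
      its own reflection; otherwise the basis vectors fix each other.\<close>
    define C where "C = B \<union> uminus ` B"
    define \<Phi> where "\<Phi> = \<Phi>' \<union> C"
    have C: "C \<subseteq> W" "\<And>x. x \<in> C \<Longrightarrow> norm x = 1" using B W2(1) by (auto simp: C_def subspace_neg)
    have orth: "x \<bullet> y = 0" "y \<bullet> x = 0" if "x \<in> \<Phi>'" "y \<in> C" for x y
    proof -
      have "y \<in> W" "x \<in> R'" using that \<Phi>'(1) C by auto
      then show "x \<bullet> y = 0" by (auto simp: R'_def)
      then show "y \<bullet> x = 0" by (simp add: inner_commute)
    qed
    have BB: "x \<bullet> y = 0" if "x \<in> B" "y \<in> B" "x \<noteq> y" for x y
      using B(2) that by (auto simp: pairwise_def orthogonal_def)
    have CC: "reflect x y \<in> C" if "x \<in> C" "y \<in> C" for x y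
    proof (cases "x = y \<or> x = - y")
      case True
      then have "reflect x y = - y"
        using C(2)[OF that(2)] reflect_self[of y] by (auto simp: reflect_def)
      then show ?thesis using that by (auto simp: C_def)
    next
      case False
      then have "y \<bullet> x = 0" using that BB by (auto simp: C_def)
      then show ?thesis using that by (simp add: reflect_orthogonal)
    qed
    have "root_set \<Phi>"
      unfolding root_set_def
    proof (intro conjI ballI)
      fix x y assume "x \<in> \<Phi>" "y \<in> \<Phi>"
      then show "reflect x y \<in> \<Phi>"
        using CC \<Phi>'(3) orth by (auto simp: \<Phi>_def root_set_def reflect_orthogonal)
    qed (use C \<Phi>'(3) in \<open>auto simp: \<Phi>_def root_set_def\<close>)
    moreover have "\<Phi> \<subseteq> R" using \<Phi>'(1) C WR by (auto simp: \<Phi>_def R'_def)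
    moreover have "finite \<Phi>" using \<Phi>'(2) finB by (simp add: \<Phi>_def C_def)
    moreover have "span \<Phi> = span R"
    proof (rule span_unique)
      show "\<Phi> \<subseteq> span R" using \<open>\<Phi> \<subseteq> R\<close> span_superset by blast
    next
      show "subspace (span R)" by simp
    next
      fix T assume T: "\<Phi> \<subseteq> T" "subspace T"
      have "v \<in> T" if v: "v \<in> R" for v
        using split[OF v]
      proof
        assume "v \<in> W"
        then have "v \<in> span B" using B by simp
        then show ?thesis using T span_minimal[of B T] by (auto simp: \<Phi>_def C_def)
      next
        assume "\<forall>w\<in>W. v \<bullet> w = 0"
        then have "v \<in> span \<Phi>'" using v \<Phi>'(4) by (auto simp: R'_def intro: span_base)
        then show ?thesis using T span_minimal[of \<Phi>' T] by (auto simp: \<Phi>_def)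
      qed
      then show "span R \<subseteq> T" using T(2) by (intro span_minimal) auto
    qed
    ultimately show ?thesis by blast
  qed
qed

section \<open>Simple roots and dominated points\<close>

definition nonneg_comb :: "'a::real_vector set \<Rightarrow> 'a \<Rightarrow> bool" where
  "nonneg_comb D v \<longleftrightarrow> (\<exists>c. (\<forall>d\<in>D. 0 \<le> c d) \<and> v = (\<Sum>d\<in>D. c d *\<^sub>R d))"

lemma nonneg_comb_0: "nonneg_comb D 0"
  unfolding nonneg_comb_def by (rule exI[of _ "\<lambda>_. 0"]) simp

lemma nonneg_comb_add: "nonneg_comb D v \<Longrightarrow> nonneg_comb D w \<Longrightarrow> nonneg_comb D (v + w)"
  unfolding nonneg_comb_def
proof (elim exE conjE)
  fix c c' assume "\<forall>d\<in>D. 0 \<le> c d" "v = (\<Sum>d\<in>D. c d *\<^sub>R d)" "\<forall>d\<in>D. 0 \<le> c' d" "w = (\<Sum>d\<in>D. c' d *\<^sub>R d)"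
  then show "\<exists>c. (\<forall>d\<in>D. 0 \<le> c d) \<and> v + w = (\<Sum>d\<in>D. c d *\<^sub>R d)"
    by (intro exI[of _ "\<lambda>d. c d + c' d"]) (simp add: scaleR_add_left sum.distrib)
qed

lemma nonneg_comb_scale: "nonneg_comb D v \<Longrightarrow> 0 \<le> r \<Longrightarrow> nonneg_comb D (r *\<^sub>R v)"
  unfolding nonneg_comb_def
proof (elim exE conjE)
  fix c assume "\<forall>d\<in>D. 0 \<le> c d" "v = (\<Sum>d\<in>D. c d *\<^sub>R d)" "0 \<le> r"
  then show "\<exists>c. (\<forall>d\<in>D. 0 \<le> c d) \<and> r *\<^sub>R v = (\<Sum>d\<in>D. c d *\<^sub>R d)"
    by (intro exI[of _ "\<lambda>d. r * c d"]) (simp add: scaleR_sum_right)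
qed

lemma nonneg_comb_base: "finite D \<Longrightarrow> d \<in> D \<Longrightarrow> nonneg_comb D d"
  unfolding nonneg_comb_def
proof (intro exI conjI)
  assume "finite D" "d \<in> D"
  then have "(\<Sum>x\<in>D. (if x = d then 1 else 0) *\<^sub>R x) = (\<Sum>x\<in>D. if x = d then d else 0)"
    by (intro sum.cong) auto
  then show "d = (\<Sum>x\<in>D. (if x = d then 1 else 0) *\<^sub>R x)"
    using \<open>finite D\<close> \<open>d \<in> D\<close> by simp
qed auto

lemma nonneg_comb_sum:
  assumes "\<And>i. i \<in> I \<Longrightarrow> nonneg_comb D (f i)"
  shows "nonneg_comb D (\<Sum>i\<in>I. f i)"
  using assms by (induction I rule: infinite_finite_induct) (auto intro: nonneg_comb_0 nonneg_comb_add)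

lemma nonneg_comb_trans:
  assumes "nonneg_comb D v" "\<And>d. d \<in> D \<Longrightarrow> nonneg_comb E d"
  shows "nonneg_comb E v"
  using assms unfolding nonneg_comb_def[of D]
  by (auto intro!: nonneg_comb_sum nonneg_comb_scale)

lemma nonneg_comb_inner:
  assumes "nonneg_comb D v" "\<And>d. d \<in> D \<Longrightarrow> 0 \<le> x \<bullet> d"
  shows "0 \<le> x \<bullet> v"
  using assms unfolding nonneg_comb_def by (auto simp: inner_sum_right intro!: sum_nonneg)

text \<open>The positive and negative parts have disjoint supports, so only products of distinct
  members of \<open>D\<close> survive. This one sign drives both independence and the comparison of
  the chamber with the cone of simple roots.\<close>

lemma inner_pos_neg_part_obtuse:
  fixes f :: "'a::real_inner \<Rightarrow> real"
  assumes "\<And>d e. d \<in> D \<Longrightarrow> e \<in> D \<Longrightarrow> d \<noteq> e \<Longrightarrow> d \<bullet> e \<le> 0"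
  shows "(\<Sum>d\<in>D. max (f d) 0 *\<^sub>R d) \<bullet> (\<Sum>d\<in>D. max (- f d) 0 *\<^sub>R d) \<le> 0"
  unfolding inner_sum_left inner_sum_right
proof (intro sum_nonpos)
  fix d e assume de: "d \<in> D" "e \<in> D"
  show "max (f d) 0 *\<^sub>R d \<bullet> max (- f e) 0 *\<^sub>R e \<le> 0"
  proof (cases "d = e")
    case True
    then show ?thesis by (auto simp: max_def)
  next
    case False
    have "max (f d) 0 * (max (- f e) 0 * (d \<bullet> e)) \<le> 0"
      using assms[OF de False] by (intro mult_nonneg_nonpos) auto
    then show ?thesis by (simp add: mult.left_commute)
  qed
qed

lemma pos_minus_neg_part:
  fixes f :: "'a::real_vector \<Rightarrow> real"
  shows "(\<Sum>d\<in>D. f d *\<^sub>R d) = (\<Sum>d\<in>D. max (f d) 0 *\<^sub>R d) - (\<Sum>d\<in>D. max (- f d) 0 *\<^sub>R d)"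
  unfolding sum_subtractf[symmetric] scaleR_left_diff_distrib[symmetric]
  by (intro sum.cong refl arg_cong2[where f = scaleR]) (auto simp: max_def)

text \<open>In a vanishing combination the two parts coincide, so their inner product is a squared
  norm and at most 0. Both parts then vanish, and pairing with \<rho>, which is positive on all of
  \<open>D\<close>, kills every coefficient.\<close>

lemma obtuse_independent:
  fixes D :: "'a::euclidean_space set"
  assumes D: "finite D" "\<And>d. d \<in> D \<Longrightarrow> 0 < \<rho> \<bullet> d"
    and obt: "\<And>d e. d \<in> D \<Longrightarrow> e \<in> D \<Longrightarrow> d \<noteq> e \<Longrightarrow> d \<bullet> e \<le> 0"
  shows "independent D"
proof (rule independent_if_scalars_zero[OF D(1)])
  fix f d assume f: "(\<Sum>d\<in>D. f d *\<^sub>R d) = 0" and d: "d \<in> D"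
  let ?p = "\<Sum>d\<in>D. max (f d) 0 *\<^sub>R d" and ?q = "\<Sum>d\<in>D. max (- f d) 0 *\<^sub>R d"
  have eq: "?p = ?q" using f unfolding pos_minus_neg_part[of f] by simp
  have le: "?p \<bullet> ?q \<le> 0" by (rule inner_pos_neg_part_obtuse[OF obt])
  then have "?p \<bullet> ?p = 0"
    using inner_ge_zero[of ?p] unfolding eq by linarith
  then have p0: "?p = 0" by (simp only: inner_eq_zero_iff)
  then have q0: "?q = 0" by (simp only: eq)
  have zero: "g d = 0" if "\<And>d. 0 \<le> g d" "(\<Sum>d\<in>D. g d *\<^sub>R d) = 0" for g :: "'a \<Rightarrow> real"
  proof -
    have "(\<Sum>d\<in>D. g d * (\<rho> \<bullet> d)) = \<rho> \<bullet> (\<Sum>d\<in>D. g d *\<^sub>R d)" by (simp add: inner_sum_right)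
    then have "(\<Sum>d\<in>D. g d * (\<rho> \<bullet> d)) = 0" using that by simp
    moreover have "0 \<le> g d * (\<rho> \<bullet> d)" if "d \<in> D" for d
      using D(2)[OF that] \<open>\<And>d. 0 \<le> g d\<close> by (simp add: less_imp_le)
    ultimately have "g d * (\<rho> \<bullet> d) = 0" using D(1) d by (simp add: sum_nonneg_eq_0_iff)
    then show ?thesis using D(2)[OF d] by simp
  qed
  have "max (f d) 0 = 0" "max (- f d) 0 = 0"
    using zero[of "\<lambda>d. max (f d) 0"] zero[of "\<lambda>d. max (- f d) 0"] p0 q0 by auto
  then show "f d = 0" by (simp add: max_def split: if_splits)
qed

text \<open>With \<omega> written as positive part \<open>p\<close> minus negative part
  \<open>q\<close>, \<open>0 \<le> \<omega> \<bullet> q = p \<bullet> q - q \<bullet> q\<close> and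
  \<open>p \<bullet> q \<le> 0\<close> force \<open>q = 0\<close>. The closed chamber thus lies in
  the cone spanned by its simple roots, which is why its extreme rays are pairwise acute.\<close>

lemma obtuse_dual_cone:
  fixes D :: "'a::euclidean_space set"
  assumes D: "finite D" "span D = UNIV"
    and obt: "\<And>d e. d \<in> D \<Longrightarrow> e \<in> D \<Longrightarrow> d \<noteq> e \<Longrightarrow> d \<bullet> e \<le> 0"
    and \<omega>: "\<And>d. d \<in> D \<Longrightarrow> 0 \<le> \<omega> \<bullet> d"
  shows "nonneg_comb D \<omega>"
proof -
  have "\<omega> \<in> span D" using D by simp
  then obtain f where f: "\<omega> = (\<Sum>d\<in>D. f d *\<^sub>R d)"
    unfolding span_finite[OF D(1)] by auto
  let ?p = "\<Sum>d\<in>D. max (f d) 0 *\<^sub>R d" and ?q = "\<Sum>d\<in>D. max (- f d) 0 *\<^sub>R d"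
  have eq: "\<omega> = ?p - ?q" using f pos_minus_neg_part[of f] by simp
  have "?p \<bullet> ?q \<le> 0" by (rule inner_pos_neg_part_obtuse[OF obt])
  moreover have "0 \<le> \<omega> \<bullet> ?q"
    using \<omega> by (auto simp: inner_sum_right intro!: sum_nonneg)
  ultimately have "?q \<bullet> ?q \<le> 0" unfolding eq by (simp add: inner_diff_left)
  then have "?q \<bullet> ?q = 0" by (intro antisym inner_ge_zero)
  then have "?q = 0" by (simp only: inner_eq_zero_iff)
  then have "\<omega> = ?p" using eq by simp
  then show ?thesis unfolding nonneg_comb_def
    by (intro exI[of _ "\<lambda>d. max (f d) 0"]) auto
qed

text \<open>The share of \<open>x\<close> hidden in \<open>z\<close> is moved to the left. Pairing
  with \<rho> shows that the remaining coefficient \<open>s - c x\<close> is positive, so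
  \<open>x\<close> can be solved for in terms of the other generators.\<close>

lemma nonneg_comb_drop:
  assumes D: "finite D" "\<And>d. d \<in> D \<Longrightarrow> 0 < \<rho> \<bullet> d" and xy: "x \<in> D" "y \<in> D" "x \<noteq> y"
    and r: "0 < r" and eq: "s *\<^sub>R x = r *\<^sub>R y + z" and z: "nonneg_comb D z"
  shows "nonneg_comb (D - {x}) x"
proof -
  obtain c where c: "\<And>d. d \<in> D \<Longrightarrow> 0 \<le> c d" "z = (\<Sum>d\<in>D. c d *\<^sub>R d)"
    using z by (auto simp: nonneg_comb_def)
  define z' where "z' = (\<Sum>d\<in>D-{x}. c d *\<^sub>R d)"
  have zz: "z = c x *\<^sub>R x + z'"
    using D(1) xy(1) by (simp add: c(2) z'_def sum.remove)
  have z': "nonneg_comb (D - {x}) z'"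
    unfolding nonneg_comb_def z'_def using c by auto
  have w: "nonneg_comb (D - {x}) (r *\<^sub>R y + z')"
    using D(1) xy r by (intro nonneg_comb_add[OF _ z'] nonneg_comb_scale nonneg_comb_base) auto
  have eq': "(s - c x) *\<^sub>R x = r *\<^sub>R y + z'" using eq zz by (simp add: algebra_simps)
  have "0 \<le> \<rho> \<bullet> z'" using nonneg_comb_inner[OF z'] D(2) by (simp add: less_imp_le)
  then have "0 < \<rho> \<bullet> (r *\<^sub>R y + z')" using r D(2)[OF xy(2)] by (simp add: inner_add_right add_pos_nonneg)
  then have "0 < (s - c x) * (\<rho> \<bullet> x)" unfolding eq'[symmetric] by simp
  then have pos: "0 < s - c x" using D(2)[OF xy(1)] by (simp add: zero_less_mult_iff)
  have "(1 / (s - c x)) *\<^sub>R (r *\<^sub>R y + z') = x" unfolding eq'[symmetric] using pos by simp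
  then show ?thesis using nonneg_comb_scale[OF w, of "1 / (s - c x)"] pos by simp
qed

text \<open>\<open>D\<close> is a smallest set of positive roots generating all positive ones. If
  \<open>d \<bullet> e\<close> were positive for distinct members, then \<open>reflect e d\<close>
  or its negative is a positive root; in the first case \<open>d\<close>, in the second
  \<open>e\<close> becomes a combination of the others, against minimality.\<close>

lemma simple_system_exists:
  fixes \<Phi> :: "'a::euclidean_space set"
  assumes "finite \<Phi>" and root: "root_set \<Phi>" and "span \<Phi> = UNIV" and \<rho>: "\<And>\<alpha>. \<alpha> \<in> \<Phi> \<Longrightarrow> \<rho> \<bullet> \<alpha> \<noteq> 0"
  obtains D where "D \<subseteq> \<Phi>" "\<And>d. d \<in> D \<Longrightarrow> 0 < \<rho> \<bullet> d" "span D = UNIV" "independent D"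
    "\<And>d e. d \<in> D \<Longrightarrow> e \<in> D \<Longrightarrow> d \<noteq> e \<Longrightarrow> d \<bullet> e \<le> 0"
    "\<And>\<alpha>. \<alpha> \<in> \<Phi> \<Longrightarrow> 0 < \<rho> \<bullet> \<alpha> \<Longrightarrow> nonneg_comb D \<alpha>"
proof -
  define \<Phi>p where "\<Phi>p = {\<alpha> \<in> \<Phi>. 0 < \<rho> \<bullet> \<alpha>}"
  define P where "P D \<longleftrightarrow> D \<subseteq> \<Phi>p \<and> (\<forall>\<alpha>\<in>\<Phi>p. nonneg_comb D \<alpha>)" for D
  have fin: "finite \<Phi>p" using assms(1) by (simp add: \<Phi>p_def)
  have "P \<Phi>p" using fin by (simp add: P_def nonneg_comb_base)
  then obtain D where D: "P D" and min: "\<And>E. P E \<Longrightarrow> card D \<le> card E"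
    using ex_has_least_nat[of P \<Phi>p card] by blast
  have sub: "D \<subseteq> \<Phi>p" and gen: "\<And>\<alpha>. \<alpha> \<in> \<Phi>p \<Longrightarrow> nonneg_comb D \<alpha>" using D by (auto simp: P_def)
  have finD: "finite D" using sub fin finite_subset by blast
  have posD: "0 < \<rho> \<bullet> d" if "d \<in> D" for d using sub that by (auto simp: \<Phi>p_def)
  have irr: "\<not> nonneg_comb (D - {d}) d" if "d \<in> D" for d
  proof
    assume d: "nonneg_comb (D - {d}) d"
    have "nonneg_comb (D - {d}) e" if "e \<in> D" for e
      using d finD that by (cases "e = d") (auto intro: nonneg_comb_base)
    then have "P (D - {d})"
      using gen sub unfolding P_def by (meson nonneg_comb_trans Diff_subset order_trans)
    then have "card D \<le> card (D - {d})" by (rule min)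
    then show False using finD that by (metis card_Diff1_less not_less)
  qed
  have obt: "d \<bullet> e \<le> 0" if "d \<in> D" "e \<in> D" "d \<noteq> e" for d e
  proof (rule ccontr)
    assume "\<not> ?thesis"
    then have c: "0 < 2 * (d \<bullet> e)" by simp
    have \<gamma>: "reflect e d \<in> \<Phi>" using that sub root by (auto simp: root_set_def \<Phi>p_def)
    show False
    proof (cases "0 < \<rho> \<bullet> reflect e d")
      case True
      then have "nonneg_comb D (reflect e d)" using gen \<gamma> by (simp add: \<Phi>p_def)
      moreover have "1 *\<^sub>R d = (2 * (d \<bullet> e)) *\<^sub>R e + reflect e d" by (simp add: reflect_def)
      ultimately show False
        using nonneg_comb_drop[OF finD posD that(1,2,3) c] irr that by blast
    next
      case False
      then have "0 < \<rho> \<bullet> (- reflect e d)" using \<rho>[OF \<gamma>] by simp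
      then have "nonneg_comb D (- reflect e d)"
        using gen root_set_uminus[OF root \<gamma>] by (simp add: \<Phi>p_def)
      moreover have "(2 * (d \<bullet> e)) *\<^sub>R e = 1 *\<^sub>R d + (- reflect e d)" by (simp add: reflect_def)
      ultimately show False
        using nonneg_comb_drop[OF finD posD that(2,1) that(3)[symmetric], of 1] irr that by fastforce
    qed
  qed
  have "\<Phi> \<subseteq> span D"
  proof
    fix \<alpha> assume \<alpha>: "\<alpha> \<in> \<Phi>"
    have comb: "\<beta> \<in> span D" if "nonneg_comb D \<beta>" for \<beta>
      using that by (auto simp: nonneg_comb_def) (simp add: span_sum span_scale span_base)
    show "\<alpha> \<in> span D"
    proof (cases "0 < \<rho> \<bullet> \<alpha>")
      case True
      then show ?thesis using comb gen \<alpha> by (simp add: \<Phi>p_def)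
    next
      case False
      then have "- \<alpha> \<in> \<Phi>p" using \<rho>[OF \<alpha>] root_set_uminus[OF root \<alpha>] by (simp add: \<Phi>p_def)
      then have "- \<alpha> \<in> span D" using comb gen by blast
      then show ?thesis by (metis minus_minus span_neg)
    qed
  qed
  then have "span D = UNIV" using assms(3) by (metis span_mono span_span top.extremum_uniqueI)
  moreover have "independent D" using obtuse_independent[OF finD posD obt] .
  ultimately show ?thesis
    using that[of D] sub posD obt gen by (auto simp: \<Phi>p_def)
qed

text \<open>
  If a linear functional \<open>p\<close> separated \<open>x\<close> from \<open>K\<close>, then among the functionals of norm at most
  \<open>norm p\<close> with the same bound on \<open>K\<close> (a set preserved by the reflections) one that is largest
  at \<open>x\<close> is nonnegative on \<open>D\<close>, and hence at least as large at \<open>y\<close> as at \<open>x\<close>.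
\<close>

lemma dominated_in_invariant_convex:
  fixes K :: "'a::euclidean_space set"
  assumes K: "convex K" "closed K"
    and D: "\<And>d. d \<in> D \<Longrightarrow> reflect d ` K \<subseteq> K" "\<And>d. d \<in> D \<Longrightarrow> norm d = 1"
    and x: "\<And>d. d \<in> D \<Longrightarrow> 0 < x \<bullet> d" and y: "y \<in> K" "nonneg_comb D (y - x)"
  shows "x \<in> K"
proof (rule ccontr)
  assume "x \<notin> K"
  then obtain a b where ab: "a \<bullet> x < b" "\<And>k. k \<in> K \<Longrightarrow> b < a \<bullet> k"
    using separating_hyperplane_closed_point[OF K] by blast
  define Q where "Q = cball 0 (norm a) \<inter> (\<Inter>k\<in>K. {q. q \<bullet> k \<le> - b})"
  have "closed {q. q \<bullet> k \<le> - b}" for k :: 'a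
    by (intro closed_Collect_le continuous_intros)
  then have "compact Q" unfolding Q_def by (intro compact_Int_closed closed_INT) auto
  moreover have aQ: "- a \<in> Q" using ab by (auto simp: Q_def less_imp_le)
  ultimately obtain q where q: "q \<in> Q" "\<And>q'. q' \<in> Q \<Longrightarrow> q' \<bullet> x \<le> q \<bullet> x"
    using continuous_attains_sup[of Q "\<lambda>q. q \<bullet> x"] by (force intro: continuous_intros)
  have "0 \<le> q \<bullet> d" if d: "d \<in> D" for d
  proof -
    have "norm (reflect d q) = norm q"
      using orthogonal_transformation_reflect[OF D(2)[OF d]] by (rule orthogonal_transformation_norm)
    then have "reflect d q \<in> Q"
      using q(1) D(1)[OF d] by (auto simp: Q_def reflect_inner_swap image_subset_iff)
    then have "reflect d q \<bullet> x \<le> q \<bullet> x" by (rule q(2))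
    moreover have "reflect d q \<bullet> x = q \<bullet> x - 2 * ((q \<bullet> d) * (x \<bullet> d))"
      by (simp add: reflect_def inner_diff_left inner_commute[of d x])
    ultimately have "0 \<le> (q \<bullet> d) * (x \<bullet> d)" by simp
    then show ?thesis using x[OF d] by (simp add: zero_le_mult_iff)
  qed
  then have "0 \<le> q \<bullet> (y - x)" by (rule nonneg_comb_inner[OF y(2)])
  then have "q \<bullet> x \<le> q \<bullet> y" by (simp add: inner_diff_right)
  moreover have "q \<bullet> y \<le> - b" using q(1) y(1) by (auto simp: Q_def)
  moreover have "- a \<bullet> x \<le> q \<bullet> x" using q(2)[OF aQ] .
  ultimately show False using ab(1) by simp
qed

section \<open>The multiplicative Prekopa-Leindler inequality\<close>

text \<open>With \<open>a\<close> the maximum of \<open>A\<close> and \<open>b\<close> the minimum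
  of \<open>B\<close>, the translates \<open>b + A\<close> and \<open>a + B\<close> lie in the
  sumset on opposite sides of \<open>a + b\<close>, so they overlap in at most that point.\<close>

lemma sumset_measure_compact:
  fixes A B S :: "real set"
  assumes "compact A" "compact B" "A \<noteq> {}" "B \<noteq> {}" and S: "S \<in> sets borel"
    and sum: "\<And>x y. x \<in> A \<Longrightarrow> y \<in> B \<Longrightarrow> x + y \<in> S"
  shows "emeasure lborel A + emeasure lborel B \<le> emeasure lborel S"
proof -
  obtain a where a: "a \<in> A" "\<And>x. x \<in> A \<Longrightarrow> x \<le> a"
    using compact_attains_sup[of A] assms by blast
  obtain b where b: "b \<in> B" "\<And>x. x \<in> B \<Longrightarrow> b \<le> x"
    using compact_attains_inf[of B] assms by blast
  let ?A = "(+) b ` A" and ?B = "(+) a ` B"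
  have cA: "compact ?A" "compact ?B"
    using assms by (auto intro: compact_translation)
  have [measurable]: "A \<in> sets borel" "B \<in> sets borel" "?A \<in> sets borel" "?B \<in> sets borel"
    using assms(1,2) cA by (auto intro: borel_compact)
  have tr: "emeasure lborel ((+) c ` X) = emeasure lborel X" if "compact X" for c and X :: "real set"
  proof -
    have [measurable]: "X \<in> sets borel" "(+) c ` X \<in> sets borel"
      using that by (auto intro!: borel_compact compact_translation)
    have "emeasure lborel ((+) c ` X) = emeasure (distr lborel borel ((+) c)) ((+) c ` X)"
      by (simp add: lborel_distr_plus)
    also have "\<dots> = emeasure lborel X"
      by (subst emeasure_distr) (auto simp: inj_vimage_image_eq)
    finally show ?thesis .
  qed
  have "?A \<inter> ?B \<subseteq> {a + b}"
  proof
    fix z assume "z \<in> ?A \<inter> ?B"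
    then obtain x y where "x \<in> A" "z = b + x" "y \<in> B" "z = a + y" by blast
    then show "z \<in> {a + b}" using a(2)[of x] b(2)[of y] by auto
  qed
  then have z: "emeasure lborel (?A \<inter> ?B) = 0"
    by (intro emeasure_lborel_countable) (meson countable_empty countable_insert countable_subset)
  have "emeasure lborel ?A + emeasure lborel ?B = emeasure lborel (?A \<union> ?B) + emeasure lborel (?A \<inter> ?B)"
    by (rule emeasure_Un_Int) auto
  then have "emeasure lborel A + emeasure lborel B = emeasure lborel (?A \<union> ?B)"
    using tr assms z by simp
  also have "\<dots> \<le> emeasure lborel S"
    using sum[OF _ b(1)] sum[OF a(1)] S by (intro emeasure_mono) (auto simp: add.commute[of b])
  finally show ?thesis .
qed

text \<open>Inner regularity, with the compact sets kept nonempty: an empty summand would make the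
  sumset empty and the sumset bound false.\<close>

lemma emeasure_eq_SUP_nonempty_compact:
  fixes A :: "real set"
  assumes "A \<in> sets borel" "A \<noteq> {}"
  shows "emeasure lborel A = (SUP C \<in> {C. compact C \<and> C \<noteq> {} \<and> C \<subseteq> A}. emeasure lborel C)" (is "_ = ?R")
proof (rule antisym)
  obtain a0 where "a0 \<in> A" using assms by auto
  show "emeasure lborel A \<le> ?R"
  proof (rule dense_le)
    fix a assume a: "a < emeasure lborel A"
    \<comment> \<open>Truncation makes the measure finite, so that the gap \<open>r - q\<close>
      between real numbers can be handed to the approximation by closed sets.\<close>
    define F where "F n = A \<inter> {- real n..real n}" for n
    have F [measurable]: "F n \<in> sets borel" for n unfolding F_def using assms by (intro sets.Int) auto
    have "(SUP n. emeasure lborel (F n)) = emeasure lborel (\<Union>n. F n)"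
      proof (rule SUP_emeasure_incseq)
      show "range F \<subseteq> sets lborel" using F by auto
      show "incseq F" by (auto simp: incseq_def F_def)
    qed
    moreover have "(\<Union>n. F n) = A"
    proof -
      have "\<exists>n. x \<in> {- real n..real n}" for x
        using real_arch_simple[of "\<bar>x\<bar>"] by (auto simp: abs_le_iff intro: minus_le_iff[THEN iffD1])
      then show ?thesis unfolding F_def by blast
    qed
    ultimately obtain n where n: "a < emeasure lborel (F n)"
      using a by (metis less_SUP_iff)
    have finF: "emeasure lborel (F n) < \<infinity>"
      using emeasure_mono[of "F n" "{- real n..real n}" lborel] by (auto simp: F_def le_less_trans)
    obtain r where r: "emeasure lborel (F n) = ennreal r" "0 \<le> r"
      using finF by (cases "emeasure lborel (F n)") auto
    obtain q where q: "a = ennreal q" "0 \<le> q"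
      using n r by (cases a) (auto simp: top_unique)
    have qr: "q < r" using n q r by (simp add: ennreal_less_iff)
    obtain T where T: "closed T" "T \<subseteq> F n" "emeasure lebesgue (F n - T) < ennreal (r - q)"
      using sets_lebesgue_inner_closed[of "F n" "r - q"] qr F[of n]
      by (metis diff_gt_0_iff_gt sets_completionI_sets sets_lborel)
    have cT: "compact T"
      using T by (metis F_def Int_lower2 bounded_closed_interval bounded_subset compact_eq_bounded_closed order_trans)
    have [measurable]: "T \<in> sets borel" using cT by (rule borel_compact)
    have "emeasure lborel (F n) = emeasure lborel T + emeasure lborel (F n - T)"
      using T by (subst plus_emeasure) (auto intro!: arg_cong[where f="emeasure lborel"])
    moreover have "emeasure lborel (F n - T) < ennreal (r - q)"
      using T by simp
    ultimately have le: "a < emeasure lborel T"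
    proof -
      assume 1: "emeasure lborel (F n) = emeasure lborel T + emeasure lborel (F n - T)"
        and 2: "emeasure lborel (F n - T) < ennreal (r - q)"
      obtain d where d: "emeasure lborel (F n - T) = ennreal d" "0 \<le> d"
        using 2 by (cases "emeasure lborel (F n - T)") auto
      obtain t where t: "emeasure lborel T = ennreal t" "0 \<le> t"
        using 1 finF by (cases "emeasure lborel T") auto
      show ?thesis using 1 2 d t q r by (simp add: ennreal_less_iff flip: ennreal_plus)
    qed
    then have "T \<noteq> {}" by auto
    then have "emeasure lborel T \<le> ?R"
      using cT T(2) by (intro SUP_upper) (auto simp: F_def)
    then show "a \<le> ?R" using le by auto
  qed
  show "?R \<le> emeasure lborel A"
    using assms by (intro SUP_least emeasure_mono) auto
qed

text \<open>\<open>S\<close> is any Borel set containing the sumset, since a sumset of Borel sets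
  need not itself be Borel.\<close>

lemma sumset_measure:
  fixes A B S :: "real set"
  assumes "A \<in> sets borel" "B \<in> sets borel" "A \<noteq> {}" "B \<noteq> {}" and S: "S \<in> sets borel"
    and sum: "\<And>x y. x \<in> A \<Longrightarrow> y \<in> B \<Longrightarrow> x + y \<in> S"
  shows "emeasure lborel A + emeasure lborel B \<le> emeasure lborel S"
proof -
  let ?C = "\<lambda>A :: real set. {C. compact C \<and> C \<noteq> {} \<and> C \<subseteq> A}"
  obtain a b where "a \<in> A" "b \<in> B" using assms by blast
  then have "{a} \<in> ?C A" "{b} \<in> ?C B" by auto
  then have ne: "?C A \<noteq> {}" "?C B \<noteq> {}" by blast+
  have "emeasure lborel A + emeasure lborel B
      = (SUP C \<in> ?C A. SUP D \<in> ?C B. emeasure lborel C + emeasure lborel D)"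
    unfolding emeasure_eq_SUP_nonempty_compact[OF assms(1,3)] emeasure_eq_SUP_nonempty_compact[OF assms(2,4)]
    by (subst ennreal_SUP_add_left[OF ne(1), symmetric], subst ennreal_SUP_add_right[OF ne(2), symmetric]) (rule refl)
  also have "\<dots> \<le> emeasure lborel S"
    using sum by (intro SUP_least sumset_measure_compact S) blast+
  finally show ?thesis .
qed

text \<open>Tonelli for the region under the graph. The restriction to positive \<open>t\<close>
  matters because \<open>ennreal\<close> sends negative reals to 0, so negative levels could
  contribute infinite mass.\<close>

lemma layer_cake:
  assumes [measurable]: "u \<in> borel_measurable borel"
  shows "(\<integral>\<^sup>+x. u x \<partial>(lborel :: real measure))
    = (\<integral>\<^sup>+t. indicator {0<..} t * emeasure lborel {x. ennreal t < u x} \<partial>lborel)"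
proof -
  have "(\<integral>\<^sup>+x. u x \<partial>(lborel :: real measure))
      = (\<integral>\<^sup>+x. \<integral>\<^sup>+t. indicator {0<..} t * indicator {t. ennreal t < u x} t \<partial>lborel \<partial>lborel)"
  proof (intro nn_integral_cong)
    fix x :: real
    have "u x = emeasure lborel ({0<..} \<inter> {t. ennreal t < u x})"
    proof (cases "u x")
      case (real r)
      have "{0<..} \<inter> {t. ennreal t < u x} = {0<..<r}"
        using real by (auto simp: ennreal_less_iff)
      then show ?thesis using real by simp
    next
      case top
      then have "{0<..} \<inter> {t. ennreal t < u x} = {0<..}" by auto
      moreover have "emeasure lborel {0::real<..} = top"
      proof (rule ccontr)
        assume "emeasure lborel {0::real<..} \<noteq> top"
        then obtain r where r: "emeasure lborel {0::real<..} = ennreal r" "0 \<le> r"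
          by (cases "emeasure lborel {0::real<..}") auto
        have "emeasure lborel {0<..<r + 1} \<le> emeasure lborel {0::real<..}"
          by (intro emeasure_mono) auto
        then show False using r by simp
      qed
      ultimately show ?thesis using top by simp
    qed
    then show "u x = (\<integral>\<^sup>+t. indicator {0<..} t * indicator {t. ennreal t < u x} t \<partial>lborel)"
      by (simp add: indicator_inter_arith[symmetric])
  qed
  also have "\<dots> = (\<integral>\<^sup>+t. \<integral>\<^sup>+x. indicator {0<..} t * indicator {t. ennreal t < u x} t \<partial>lborel \<partial>lborel)"
    by (rule lborel_pair.Fubini'[symmetric]) measurable
  also have "\<dots> = (\<integral>\<^sup>+t. indicator {0<..} t * emeasure lborel {x. ennreal t < u x} \<partial>lborel)"
  proof (intro nn_integral_cong)
    fix t :: real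
    have "(\<integral>\<^sup>+x. indicator {0<..} t * indicator {t. ennreal t < u x} t \<partial>lborel)
       = (\<integral>\<^sup>+x. indicator {0<..} t * indicator {x. ennreal t < u x} x \<partial>lborel)"
      by (intro nn_integral_cong) (auto split: split_indicator)
    then show "(\<integral>\<^sup>+x. indicator {0<..} t * indicator {t. ennreal t < u x} t \<partial>lborel)
       = indicator {0<..} t * emeasure lborel {x. ennreal t < u x}"
      by (simp add: nn_integral_cmult)
  qed
  finally show ?thesis .
qed

text \<open>Equal suprema ensure that the level sets of \<open>u\<close> and \<open>v\<close> are
  nonempty for the same levels \<open>t < 1\<close>, where the sumset bound applies, and empty
  together from 1 on. Integrating over the levels gives the additive inequality.\<close>

lemma prekopa_leindler_normalized:
  fixes u v w :: "real \<Rightarrow> ennreal"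
  assumes [measurable]: "u \<in> borel_measurable borel" "v \<in> borel_measurable borel" "w \<in> borel_measurable borel"
    and sup: "(SUP x. u x) = 1" "(SUP x. v x) = 1"
    and dom: "\<And>t x y. 0 < t \<Longrightarrow> ennreal t < u x \<Longrightarrow> ennreal t < v y \<Longrightarrow> ennreal t \<le> w (x + y)"
  shows "(\<integral>\<^sup>+x. u x \<partial>lborel) + (\<integral>\<^sup>+x. v x \<partial>lborel) \<le> (\<integral>\<^sup>+x. w x \<partial>lborel)"
proof -
  have le1: "u x \<le> 1" "v x \<le> 1" for x
    using SUP_upper[of x UNIV u] SUP_upper[of x UNIV v] sup by auto
  \<comment> \<open>An intermediate level between \<open>t\<close> and the two values turns the weak
    conclusion of the hypothesis into the strict one that the level sets require.\<close>
  have strict: "ennreal t < w (x + y)" if t: "0 < t" "ennreal t < u x" "ennreal t < v y" for t x y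
  proof -
    obtain c where c: "ennreal t < c" "c < min (u x) (v y)"
      using t dense[of "ennreal t" "min (u x) (v y)"] by (metis min_less_iff_conj)
    obtain t' where t': "c = ennreal t'" "0 \<le> t'"
      using c by (cases c) auto
    have "t < t'" using c t' that by (simp add: ennreal_less_iff)
    then have "c \<le> w (x + y)"
      using dom[of t' x y] that c t' by auto
    then show ?thesis using c by auto
  qed
  have level: "emeasure lborel {x. ennreal t < u x} + emeasure lborel {x. ennreal t < v x}
      \<le> emeasure lborel {x. ennreal t < w x}" if "0 < t" for t
  proof (cases "t < 1")
    case True
    then have "\<exists>x. ennreal t < u x" "\<exists>x. ennreal t < v x"
      using sup by (metis UNIV_I less_SUP_iff ennreal_less_one_iff)+
    then show ?thesis
      using strict[OF that] by (intro sumset_measure) auto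
  next
    case False
    then have "{x. ennreal t < u x} = {}" "{x. ennreal t < v x} = {}"
      using le1 that by (auto simp: not_less) (metis ennreal_1 ennreal_leI order_trans)+
    then show ?thesis by simp
  qed
  have "(\<integral>\<^sup>+x. u x \<partial>lborel) + (\<integral>\<^sup>+x. v x \<partial>lborel) =
    (\<integral>\<^sup>+t. indicator {0<..} t * emeasure lborel {x. ennreal t < u x}
       + indicator {0<..} t * emeasure lborel {x. ennreal t < v x} \<partial>lborel)"
    by (subst (1 2) layer_cake) (auto intro!: nn_integral_add[symmetric])
  also have "\<dots> \<le> (\<integral>\<^sup>+x. w x \<partial>lborel)"
    unfolding layer_cake[OF assms(3)] by (intro nn_integral_mono) (auto split: split_indicator intro: level)
  finally show ?thesis .
qed

text \<open>
  Expresses \<open>F\<^bsup>1 - \<theta>\<^esup> G\<^bsup>\<theta>\<^esup> \<le> H\<close> without powers of extended reals. The strict inequalities make it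
  stable under truncation and integration when \<open>F\<close> or \<open>G\<close> is infinite.
\<close>

definition gm_dom :: "real \<Rightarrow> ennreal \<Rightarrow> ennreal \<Rightarrow> ennreal \<Rightarrow> bool" where
  "gm_dom \<theta> F G H \<longleftrightarrow> (\<forall>a>0. \<forall>b>0. ennreal a < F \<longrightarrow> ennreal b < G \<longrightarrow>
     ennreal (a powr (1 - \<theta>) * b powr \<theta>) \<le> H)"

text \<open>Geometric means are multiplicative, so factors on the left reappear on the right as
  their own geometric mean. This absorbs the Jacobian of the exponential substitution.\<close>

lemma gm_dom_scale:
  assumes "gm_dom \<theta> F G H" "0 < r" "0 < q"
  shows "gm_dom \<theta> (F * ennreal r) (G * ennreal q) (H * ennreal (r powr (1 - \<theta>) * q powr \<theta>))"
  unfolding gm_dom_def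
proof (intro allI impI)
  fix a b :: real
  assume ab: "0 < a" "0 < b" "ennreal a < F * ennreal r" "ennreal b < G * ennreal q"
  have less: "ennreal (x / s) < X" if "0 < s" "0 < x" "ennreal x < X * ennreal s" for x s X
    using that by (cases X) (auto simp: ennreal_less_iff field_simps simp flip: ennreal_mult)
  have "ennreal ((a / r) powr (1 - \<theta>) * (b / q) powr \<theta>) \<le> H"
    using assms ab less by (auto simp: gm_dom_def)
  then have "ennreal ((a / r) powr (1 - \<theta>) * (b / q) powr \<theta>) * ennreal (r powr (1 - \<theta>) * q powr \<theta>)
     \<le> H * ennreal (r powr (1 - \<theta>) * q powr \<theta>)"
    by (rule mult_right_mono) simp
  then show "ennreal (a powr (1 - \<theta>) * b powr \<theta>) \<le> H * ennreal (r powr (1 - \<theta>) * q powr \<theta>)"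
    using ab assms by (simp add: powr_divide flip: ennreal_mult)
qed

lemma nn_integral_less_min:
  fixes u :: "'a \<Rightarrow> ennreal"
  assumes [measurable]: "u \<in> borel_measurable M" and a: "a < (\<integral>\<^sup>+x. u x \<partial>M)"
  obtains n :: nat where "a < (\<integral>\<^sup>+x. min (u x) (of_nat n) \<partial>M)"
proof -
  have *: "(SUP n. min (u x) (of_nat n)) = u x" for x
  proof (rule antisym)
    show "(SUP n. min (u x) (of_nat n)) \<le> u x" by (intro SUP_least) auto
    show "u x \<le> (SUP n. min (u x) (of_nat n))"
    proof (rule dense_le)
      fix y assume y: "y < u x"
      then obtain c where c: "y = ennreal c" "0 \<le> c" by (cases y) auto
      obtain n where "c < real n" using reals_Archimedean2 by blast
      then have "y < of_nat n"
        using c by (simp add: ennreal_of_nat_eq_real_of_nat ennreal_less_iff)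
      then have "y \<le> min (u x) (of_nat n)" using y by auto
      then show "y \<le> (SUP n. min (u x) (of_nat n))" by (rule SUP_upper2[OF UNIV_I])
    qed
  qed
  have "(\<integral>\<^sup>+x. u x \<partial>M) = (\<integral>\<^sup>+x. (SUP n. min (u x) (of_nat n)) \<partial>M)"
    by (simp add: *)
  also have "\<dots> = (SUP n. \<integral>\<^sup>+x. min (u x) (of_nat n) \<partial>M)"
    by (rule nn_integral_monotone_convergence_SUP)
       (auto simp: incseq_def le_fun_def simp del: min.bounded_iff intro!: min.mono)
  finally show ?thesis using a that by (auto simp: less_SUP_iff)
qed

text \<open>After truncation to finite suprema \<open>S\<close> and \<open>T\<close>, both functions
  are scaled to supremum 1 and their arguments dilated by \<open>1 - \<theta>\<close> and \<theta>.
  The normalised inequality bounds a weighted arithmetic mean of \<open>a / S\<close> and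
  \<open>b / T\<close>, and Young's inequality replaces it by the geometric mean.\<close>

lemma prekopa_leindler_1:
  fixes u v w :: "real \<Rightarrow> ennreal"
  assumes [measurable]: "u \<in> borel_measurable borel" "v \<in> borel_measurable borel" "w \<in> borel_measurable borel"
    and \<theta>: "0 < \<theta>" "\<theta> < 1"
    and dom: "\<And>x y. gm_dom \<theta> (u x) (v y) (w ((1 - \<theta>) * x + \<theta> * y))"
  shows "gm_dom \<theta> (\<integral>\<^sup>+x. u x \<partial>lborel) (\<integral>\<^sup>+x. v x \<partial>lborel) (\<integral>\<^sup>+x. w x \<partial>lborel)"
  unfolding gm_dom_def
proof (intro allI impI)
  fix a b :: real
  assume ab: "0 < a" "0 < b" "ennreal a < (\<integral>\<^sup>+x. u x \<partial>lborel)" "ennreal b < (\<integral>\<^sup>+x. v x \<partial>lborel)"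
  \<comment> \<open>Truncation from below keeps the integral above \<open>c\<close> while making the
    supremum finite; it is nonzero because the truncated integral still exceeds
    \<open>c > 0\<close>.\<close>
  have norm: "\<exists>S f. 0 < S \<and> f \<in> borel_measurable borel \<and> (\<forall>x. f x \<le> X x) \<and> ennreal c < (\<integral>\<^sup>+x. f x \<partial>lborel)
      \<and> (SUP x. f x) = ennreal S"
    if [measurable]: "X \<in> borel_measurable borel" and "0 < c" and c: "ennreal c < (\<integral>\<^sup>+x. X x \<partial>lborel)"
    for X :: "real \<Rightarrow> ennreal" and c :: real
  proof -
    obtain n where n: "ennreal c < (\<integral>\<^sup>+x. min (X x) (of_nat n) \<partial>lborel)"
      using nn_integral_less_min[OF _ c] by auto
    have "(SUP x. min (X x) (of_nat n)) \<le> of_nat n" by (intro SUP_least) auto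
    then obtain S where S: "(SUP x. min (X x) (of_nat n)) = ennreal S" "0 \<le> S"
      by (cases "(SUP x. min (X x) (of_nat n))") (auto simp: top_unique)
    have "S \<noteq> 0"
    proof
      assume "S = 0"
      then have "min (X x) (of_nat n) = 0" for x
        using S SUP_upper[of x UNIV "\<lambda>x. min (X x) (of_nat n)"] by auto
      then show False using n by simp
    qed
    then show ?thesis
      using S n by (intro exI[of _ S] exI[of _ "\<lambda>x. min (X x) (of_nat n)"]) auto
  qed
  obtain S f where S: "0 < S" and [measurable]: "f \<in> borel_measurable borel"
    and f: "\<And>x. f x \<le> u x" "ennreal a < (\<integral>\<^sup>+x. f x \<partial>lborel)" "(SUP x. f x) = ennreal S"
    using norm[OF assms(1) ab(1,3)] by blast
  obtain T g where T: "0 < T" and [measurable]: "g \<in> borel_measurable borel"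
    and g: "\<And>x. g x \<le> v x" "ennreal b < (\<integral>\<^sup>+x. g x \<partial>lborel)" "(SUP x. g x) = ennreal T"
    using norm[OF assms(2) ab(2,4)] by blast
  \<comment> \<open>The geometric mean of the two suprema is the scale for \<open>w\<close>: levels
    \<open>t S\<close> and \<open>t T\<close> combine to level \<open>t Q\<close>, so after division
    all three functions are compared at the same \<open>t\<close>.\<close>
  define Q where "Q = S powr (1 - \<theta>) * T powr \<theta>"
  have Q: "0 < Q" using S T by (simp add: Q_def)
  have sup1: "(SUP x. F (x / r) * ennreal (1 / s)) = 1"
    if "(SUP x. F x) = ennreal s" "0 < r" "0 < s" for F :: "real \<Rightarrow> ennreal" and r s :: real
  proof -
    have "F x = F (x * r / r)" for x using \<open>0 < r\<close> by simp
    then have "range (\<lambda>x. F (x / r)) = range F"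
      by (intro equalityI image_subsetI) (blast intro: range_eqI)+
    then have "(SUP x. F (x / r)) = ennreal s" using that by simp
    then have "(SUP x. F (x / r) * ennreal (1 / s)) = ennreal s * ennreal (1 / s)"
      by (metis (no_types, lifting) SUP_mult_right_ennreal SUP_cong)
    then show ?thesis using that by (simp flip: ennreal_mult)
  qed
  have int: "(\<integral>\<^sup>+x. F (x / r) * ennreal (1 / s) \<partial>lborel) = ennreal (r / s) * (\<integral>\<^sup>+x. F x \<partial>lborel)"
    if [measurable]: "F \<in> borel_measurable borel" and "0 < r" "0 < s" for F :: "real \<Rightarrow> ennreal" and r s :: real
  proof -
    have "(\<integral>\<^sup>+x. F (x / r) \<partial>lborel) = ennreal r * (\<integral>\<^sup>+x. F x \<partial>lborel)"
      using that by (subst nn_integral_real_affine[where c = r and t = 0]) auto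
    moreover have "ennreal (r / s) = ennreal r * ennreal (1 / s)"
      using that by (simp flip: ennreal_mult)
    moreover have "(\<integral>\<^sup>+x. F (x / r) * ennreal (1 / s) \<partial>lborel) = (\<integral>\<^sup>+x. F (x / r) \<partial>lborel) * ennreal (1 / s)"
      by (rule nn_integral_multc) measurable
    ultimately show ?thesis by (simp only: mult_ac)
  qed
  have "(\<integral>\<^sup>+x. f (x / (1 - \<theta>)) * ennreal (1 / S) \<partial>lborel) + (\<integral>\<^sup>+x. g (x / \<theta>) * ennreal (1 / T) \<partial>lborel)
     \<le> (\<integral>\<^sup>+x. w x * ennreal (1 / Q) \<partial>lborel)"
  proof (rule prekopa_leindler_normalized)
    show "(SUP x. f (x / (1 - \<theta>)) * ennreal (1 / S)) = 1" "(SUP x. g (x / \<theta>) * ennreal (1 / T)) = 1"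
      using S T \<theta> f g by (auto intro!: sup1)
    fix t x y :: real
    assume t: "0 < t" "ennreal t < f (x / (1 - \<theta>)) * ennreal (1 / S)" "ennreal t < g (y / \<theta>) * ennreal (1 / T)"
    have less: "ennreal (r * s) < X" if "0 < s" "0 < r" "ennreal r < X * ennreal (1 / s)" for r s X
      using that by (cases X) (auto simp: ennreal_less_iff field_simps simp flip: ennreal_mult)
    have "ennreal (t * S) < u (x / (1 - \<theta>))" "ennreal (t * T) < v (y / \<theta>)"
      using t S T less f(1) g(1) by (meson order_less_le_trans)+
    then have "ennreal ((t * S) powr (1 - \<theta>) * (t * T) powr \<theta>) \<le> w ((1 - \<theta>) * (x / (1 - \<theta>)) + \<theta> * (y / \<theta>))"
      using dom[of "x / (1 - \<theta>)" "y / \<theta>"] t(1) S T unfolding gm_dom_def by (metis mult_pos_pos)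
    moreover have "(t * S) powr (1 - \<theta>) * (t * T) powr \<theta> = t * Q"
    proof -
      have "(t * S) powr (1 - \<theta>) * (t * T) powr \<theta> = (t powr (1 - \<theta>) * t powr \<theta>) * Q"
        using t S T by (simp add: powr_mult Q_def)
      also have "t powr (1 - \<theta>) * t powr \<theta> = t"
        using t by (simp flip: powr_add)
      finally show ?thesis .
    qed
    ultimately have "ennreal (t * Q) \<le> w (x + y)" using \<theta> by simp
    then have "ennreal (t * Q) * ennreal (1 / Q) \<le> w (x + y) * ennreal (1 / Q)"
      by (rule mult_right_mono) simp
    then show "ennreal t \<le> w (x + y) * ennreal (1 / Q)"
      using t Q by (simp flip: ennreal_mult)
  qed measurable
  then have le: "ennreal ((1 - \<theta>) / S) * (\<integral>\<^sup>+x. f x \<partial>lborel) + ennreal (\<theta> / T) * (\<integral>\<^sup>+x. g x \<partial>lborel)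
      \<le> (\<integral>\<^sup>+x. w x \<partial>lborel) * ennreal (1 / Q)"
    using int[of f "1 - \<theta>" S] int[of g \<theta> T] nn_integral_multc[of w lborel "ennreal (1 / Q)"] S T \<theta>
    by (simp del: nn_integral_multc)
  have nn: "0 \<le> (1 - \<theta>) / S" "0 \<le> \<theta> / T" "0 \<le> a" "0 \<le> b" using \<theta> ab S T by auto
  have "(a / S) powr (1 - \<theta>) * (b / T) powr \<theta> \<le> (1 - \<theta>) * (a / S) + \<theta> * (b / T)"
    using \<theta> ab S T by (intro Youngs_inequality_0) auto
  then have "ennreal ((a / S) powr (1 - \<theta>) * (b / T) powr \<theta>) \<le> ennreal ((1 - \<theta>) / S * a + \<theta> / T * b)"
    by (intro ennreal_leI) simp
  also have "\<dots> = ennreal ((1 - \<theta>) / S) * ennreal a + ennreal (\<theta> / T) * ennreal b"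
    unfolding ennreal_plus[OF mult_nonneg_nonneg[OF nn(1,3)] mult_nonneg_nonneg[OF nn(2,4)]]
      ennreal_mult[OF nn(1,3)] ennreal_mult[OF nn(2,4)] ..
  also have "\<dots> \<le> ennreal ((1 - \<theta>) / S) * (\<integral>\<^sup>+x. f x \<partial>lborel) + ennreal (\<theta> / T) * (\<integral>\<^sup>+x. g x \<partial>lborel)"
    using f g by (intro add_mono mult_left_mono) auto
  also note le
  finally have "ennreal ((a / S) powr (1 - \<theta>) * (b / T) powr \<theta>) * ennreal Q
     \<le> (\<integral>\<^sup>+x. w x \<partial>lborel) * ennreal (1 / Q) * ennreal Q"
    by (rule mult_right_mono) simp
  moreover have "(\<integral>\<^sup>+x. w x \<partial>lborel) * ennreal (1 / Q) * ennreal Q = (\<integral>\<^sup>+x. w x \<partial>lborel)"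
    using Q by (simp add: mult.assoc flip: ennreal_mult)
  moreover have "ennreal ((a / S) powr (1 - \<theta>) * (b / T) powr \<theta>) * ennreal Q
      = ennreal (a powr (1 - \<theta>) * b powr \<theta>)"
  proof -
    have "(a / S) powr (1 - \<theta>) * (b / T) powr \<theta> * Q = a powr (1 - \<theta>) * b powr \<theta>"
      using ab S T by (simp add: powr_divide Q_def)
    then show ?thesis using Q by (metis ennreal_mult'' less_imp_le)
  qed
  ultimately show "ennreal (a powr (1 - \<theta>) * b powr \<theta>) \<le> (\<integral>\<^sup>+x. w x \<partial>lborel)" by simp
qed

section \<open>Geometric means: from the line to the positive orthant\<close>

text \<open>Substitution on compact intervals that exhaust both sides monotonically;
  \<open>Suc n\<close> keeps every interval nondegenerate.\<close>

lemma nn_integral_exp_substitution: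
  fixes f :: "real \<Rightarrow> ennreal"
  assumes [measurable]: "f \<in> borel_measurable borel"
  shows "(\<integral>\<^sup>+x. f x * indicator {0<..} x \<partial>lborel) = (\<integral>\<^sup>+t. f (exp t) * ennreal (exp t) \<partial>lborel)"
proof -
  have ex: "\<exists>n::nat. x \<in> {- real (Suc n)..real (Suc n)}" for x :: real
  proof -
    obtain n where "\<bar>x\<bar> \<le> real n" using real_arch_simple by blast
    then show ?thesis by (intro exI[of _ n]) auto
  qed
  have 1: "(SUP n. f x * indicator {exp (- real (Suc n))..exp (real (Suc n))} x) = f x * indicator {0<..} x" for x :: real
  proof (cases "0 < x")
    case True
    obtain n where n: "ln x \<in> {- real (Suc n)..real (Suc n)}" using ex by blast
    then have "x \<in> {exp (- real (Suc n))..exp (real (Suc n))}"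
      using True by (metis atLeastAtMost_iff exp_le_cancel_iff exp_ln)
    then show ?thesis using True
      by (intro antisym SUP_least SUP_upper2[of n]) (auto split: split_indicator)
  next
    case False
    then have "x \<notin> {exp (- real (Suc n))..exp (real (Suc n))}" for n
      by (metis atLeastAtMost_iff exp_gt_zero order_less_le_trans)
    then show ?thesis using False by simp
  qed
  have 2: "(SUP n. f (exp x) * ennreal (exp x) * indicator {- real (Suc n)..real (Suc n)} x) = f (exp x) * ennreal (exp x)" for x :: real
  proof -
    obtain n where "x \<in> {- real (Suc n)..real (Suc n)}" using ex by blast
    then show ?thesis
      by (intro antisym SUP_least SUP_upper2[of n]) (auto split: split_indicator)
  qed
  have "(\<integral>\<^sup>+x. f x * indicator {0<..} x \<partial>lborel)
      = (SUP n. \<integral>\<^sup>+x. f x * indicator {exp (- real (Suc n))..exp (real (Suc n))} x \<partial>lborel)"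
    unfolding 1[symmetric]
  proof (rule nn_integral_monotone_convergence_SUP)
    have sub: "{exp (- real (Suc n))..exp (real (Suc n))} \<subseteq> {exp (- real (Suc (Suc n)))..exp (real (Suc (Suc n)))}" for n
      unfolding atLeastatMost_subset_iff exp_le_cancel_iff by simp
    show "incseq (\<lambda>n x. f x * indicator {exp (- real (Suc n))..exp (real (Suc n))} x)"
      by (intro incseq_SucI le_funI mult_left_mono indicator_leI) (erule subsetD[OF sub], simp)
  qed measurable
  also have "\<dots> = (SUP n. \<integral>\<^sup>+x. f (exp x) * ennreal (exp x) * indicator {- real (Suc n)..real (Suc n)} x \<partial>lborel)"
    by (intro SUP_cong refl nn_integral_substitution_aux)
       (auto intro!: derivative_eq_intros continuous_intros)
  also have "\<dots> = (\<integral>\<^sup>+x. (SUP n. f (exp x) * ennreal (exp x) * indicator {- real (Suc n)..real (Suc n)} x) \<partial>lborel)"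
  proof (rule nn_integral_monotone_convergence_SUP[symmetric])
    show "incseq (\<lambda>n x. f (exp x) * ennreal (exp x) * indicator {- real (Suc n)..real (Suc n)} x)"
      by (intro incseq_SucI le_funI mult_left_mono) (auto split: split_indicator)
  qed measurable
  also have "\<dots> = (\<integral>\<^sup>+x. f (exp x) * ennreal (exp x) \<partial>lborel)"
    by (simp only: 2)
  finally show ?thesis .
qed

text \<open>Logarithms turn geometric means of positive numbers into arithmetic means, and the
  Jacobian \<open>exp\<close> sends arithmetic means to geometric means, so it does not disturb the
  domination.\<close>

lemma prekopa_leindler_mult_1:
  fixes u v w :: "real \<Rightarrow> ennreal"
  assumes [measurable]: "u \<in> borel_measurable borel" "v \<in> borel_measurable borel" "w \<in> borel_measurable borel"
    and \<theta>: "0 < \<theta>" "\<theta> < 1"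
    and dom: "\<And>x y. 0 < x \<Longrightarrow> 0 < y \<Longrightarrow> gm_dom \<theta> (u x) (v y) (w (x powr (1 - \<theta>) * y powr \<theta>))"
  shows "gm_dom \<theta> (\<integral>\<^sup>+x. u x * indicator {0<..} x \<partial>lborel) (\<integral>\<^sup>+x. v x * indicator {0<..} x \<partial>lborel)
           (\<integral>\<^sup>+x. w x * indicator {0<..} x \<partial>lborel)"
  unfolding nn_integral_exp_substitution[OF assms(1)] nn_integral_exp_substitution[OF assms(2)]
    nn_integral_exp_substitution[OF assms(3)]
proof (rule prekopa_leindler_1)
  fix x y :: real
  have "exp x powr (1 - \<theta>) * exp y powr \<theta> = exp ((1 - \<theta>) * x + \<theta> * y)"
    by (simp add: powr_def exp_add)
  then show "gm_dom \<theta> (u (exp x) * ennreal (exp x)) (v (exp y) * ennreal (exp y))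
        (w (exp ((1 - \<theta>) * x + \<theta> * y)) * ennreal (exp ((1 - \<theta>) * x + \<theta> * y)))"
    using gm_dom_scale[OF dom[of "exp x" "exp y"], of "exp x" "exp y"] by simp
qed (use \<theta> in measurable)

lemma measurable_pred_pos:
  assumes "finite I"
  shows "Measurable.pred (Pi\<^sub>M I (\<lambda>_. lborel :: real measure)) (\<lambda>x. \<forall>i\<in>I. 0 < x i)"
proof (rule pred_intros_finite(3)[OF assms])
  fix i assume [measurable]: "i \<in> I"
  have [measurable]: "(\<lambda>x. x i) \<in> measurable (Pi\<^sub>M I (\<lambda>_. lborel :: real measure)) borel"
    using measurable_component_singleton[of i I "\<lambda>_. lborel :: real measure"] \<open>i \<in> I\<close> by simp
  show "Measurable.pred (Pi\<^sub>M I (\<lambda>_. lborel :: real measure)) (\<lambda>x. 0 < x i)"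
    by measurable
qed

text \<open>Induction on the coordinates: with the new coordinate frozen at \<open>s\<close>,
  \<open>t\<close> and their geometric mean, the induction hypothesis gives domination between the
  inner integrals, which is exactly the hypothesis of the one-dimensional inequality for the outer
  one.\<close>

lemma prekopa_leindler_mult_PiM:
  fixes f g h :: "('i \<Rightarrow> real) \<Rightarrow> ennreal"
  assumes "finite I" and \<theta>: "0 < \<theta>" "\<theta> < 1"
    and "f \<in> borel_measurable (Pi\<^sub>M I (\<lambda>_. lborel))" "g \<in> borel_measurable (Pi\<^sub>M I (\<lambda>_. lborel))"
      "h \<in> borel_measurable (Pi\<^sub>M I (\<lambda>_. lborel))"
    and "\<And>x y. (\<And>i. i \<in> I \<Longrightarrow> 0 < x i) \<Longrightarrow> (\<And>i. i \<in> I \<Longrightarrow> 0 < y i) \<Longrightarrow> x \<in> extensional I \<Longrightarrow> y \<in> extensional I \<Longrightarrow>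
      gm_dom \<theta> (f x) (g y) (h (\<lambda>i\<in>I. x i powr (1 - \<theta>) * y i powr \<theta>))"
  shows "gm_dom \<theta> (\<integral>\<^sup>+x. f x * indicator {x. \<forall>i\<in>I. 0 < x i} x \<partial>Pi\<^sub>M I (\<lambda>_. lborel))
      (\<integral>\<^sup>+x. g x * indicator {x. \<forall>i\<in>I. 0 < x i} x \<partial>Pi\<^sub>M I (\<lambda>_. lborel))
      (\<integral>\<^sup>+x. h x * indicator {x. \<forall>i\<in>I. 0 < x i} x \<partial>Pi\<^sub>M I (\<lambda>_. lborel))"
  using assms(1,4-)
proof (induction I arbitrary: f g h)
  case empty
  \<comment> \<open>The empty product is a unit mass at its only point
    \<open>\<lambda>_. undefined\<close>, so each integral is a value there.\<close>
  have "gm_dom \<theta> (f (\<lambda>_. undefined)) (g (\<lambda>_. undefined)) (h (\<lambda>_. undefined))"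
    using empty(4)[of "\<lambda>_. undefined" "\<lambda>_. undefined"] by (simp add: restrict_def)
  then show ?case
    by (simp add: PiM_empty nn_integral_count_space_finite)
next
  case (insert i I)
  interpret product_sigma_finite "\<lambda>_ :: 'i. lborel :: real measure" ..
  note [measurable] = insert.prems(1-3)
  let ?P = "Pi\<^sub>M I (\<lambda>_. lborel :: real measure)" and ?P' = "Pi\<^sub>M (insert i I) (\<lambda>_. lborel :: real measure)"
  let ?F = "\<lambda>f t. \<integral>\<^sup>+x. f (x(i := t)) * indicator {x. \<forall>i\<in>I. 0 < x i} x \<partial>?P"
  have rw: "(\<integral>\<^sup>+x. f x * indicator {x. \<forall>i\<in>insert i I. 0 < x i} x \<partial>?P') = (\<integral>\<^sup>+t. ?F f t * indicator {0<..} t \<partial>lborel)"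
    if [measurable]: "f \<in> borel_measurable ?P'" for f :: "('i \<Rightarrow> real) \<Rightarrow> ennreal"
  proof -
    have "(\<integral>\<^sup>+x. f x * indicator {x. \<forall>i\<in>insert i I. 0 < x i} x \<partial>?P')
       = (\<integral>\<^sup>+t. \<integral>\<^sup>+x. f (x(i := t)) * indicator {x. \<forall>i\<in>insert i I. 0 < x i} (x(i := t)) \<partial>?P \<partial>lborel)"
    proof (rule product_nn_integral_insert_rev)
      have "Measurable.pred ?P' (\<lambda>x. \<forall>i\<in>insert i I. 0 < x i)"
        by (rule measurable_pred_pos) (use insert.hyps in auto)
      then show "(\<lambda>x. f x * indicator {x. \<forall>i\<in>insert i I. 0 < x i} x) \<in> borel_measurable ?P'"
        by (intro borel_measurable_times_ennreal borel_measurable_indicator') auto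
    qed (use insert.hyps in auto)
    also have "\<dots> = (\<integral>\<^sup>+t. \<integral>\<^sup>+x. (f (x(i := t)) * indicator {x. \<forall>i\<in>I. 0 < x i} x) * indicator {0<..} t \<partial>?P \<partial>lborel)"
      using insert.hyps by (intro nn_integral_cong) (auto split: split_indicator)
    also have "\<dots> = (\<integral>\<^sup>+t. ?F f t * indicator {0<..} t \<partial>lborel)"
    proof (intro nn_integral_cong nn_integral_multc)
      fix t :: real
      have [measurable]: "(\<lambda>x. x(i := t)) \<in> measurable ?P ?P'"
        by (rule measurable_fun_upd[where J = I]) auto
      have [measurable]: "Measurable.pred ?P (\<lambda>x. \<forall>i\<in>I. 0 < x i)"
        by (rule measurable_pred_pos) (use insert.hyps in auto)
      show "(\<lambda>x. f (x(i := t)) * indicator {x. \<forall>i\<in>I. 0 < x i} x) \<in> borel_measurable ?P"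
        by (intro borel_measurable_times_ennreal borel_measurable_indicator') auto
    qed
    finally show ?thesis .
  qed
  have meas: "?F f \<in> borel_measurable borel" if [measurable]: "f \<in> borel_measurable ?P'" for f :: "('i \<Rightarrow> real) \<Rightarrow> ennreal"
  proof -
    interpret P: sigma_finite_measure ?P
      using insert.hyps by (intro sigma_finite)
    have [measurable]: "Measurable.pred ?P (\<lambda>x. \<forall>i\<in>I. 0 < x i)"
      by (rule measurable_pred_pos) (use insert.hyps in auto)
    have 1: "(\<lambda>(t, x). x(i := t)) \<in> measurable (lborel \<Otimes>\<^sub>M ?P) ?P'"
      by measurable
    have [measurable]: "(\<lambda>x. indicator {x. \<forall>i\<in>I. 0 < x i} x :: ennreal) \<in> borel_measurable ?P"
      by (intro borel_measurable_indicator') auto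
    have 2: "(\<lambda>(t, x). f (x(i := t)) * indicator {x. \<forall>i\<in>I. 0 < x i} x) \<in> borel_measurable (lborel \<Otimes>\<^sub>M ?P)"
      unfolding case_prod_beta
      using measurable_compose[OF 1, of f borel]
      by (intro borel_measurable_times_ennreal) (auto simp: case_prod_beta)
    have "?F f \<in> borel_measurable lborel"
      by (rule P.borel_measurable_nn_integral[OF 2])
    then show ?thesis by simp
  qed
  show ?case
    unfolding rw[OF insert.prems(1)] rw[OF insert.prems(2)] rw[OF insert.prems(3)]
  proof (rule prekopa_leindler_mult_1)
    fix s t :: real assume st: "0 < s" "0 < t"
    show "gm_dom \<theta> (?F f s) (?F g t) (?F h (s powr (1 - \<theta>) * t powr \<theta>))"
    proof (rule insert.IH)
      have [measurable]: "(\<lambda>x. x(i := t)) \<in> measurable ?P ?P'" for t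
        by (rule measurable_fun_upd[where J = I]) auto
      show "(\<lambda>x. f (x(i := s))) \<in> borel_measurable ?P" "(\<lambda>x. g (x(i := t))) \<in> borel_measurable ?P"
        "(\<lambda>x. h (x(i := s powr (1 - \<theta>) * t powr \<theta>))) \<in> borel_measurable ?P" by measurable
      fix x y :: "'i \<Rightarrow> real"
      assume xy: "\<And>i. i \<in> I \<Longrightarrow> 0 < x i" "\<And>i. i \<in> I \<Longrightarrow> 0 < y i" "x \<in> extensional I" "y \<in> extensional I"
      have eq: "(\<lambda>j\<in>I. x j powr (1 - \<theta>) * y j powr \<theta>)(i := s powr (1 - \<theta>) * t powr \<theta>)
         = (\<lambda>j\<in>insert i I. (x(i := s)) j powr (1 - \<theta>) * (y(i := t)) j powr \<theta>)"
        using insert.hyps by (auto simp: fun_eq_iff restrict_def)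
      show "gm_dom \<theta> (f (x(i := s))) (g (y(i := t)))
         (h ((\<lambda>j\<in>I. x j powr (1 - \<theta>) * y j powr \<theta>)(i := s powr (1 - \<theta>) * t powr \<theta>)))"
        unfolding eq using xy st by (intro insert.prems(4)) (auto simp: extensional_def)
    qed
  qed (use \<theta> meas insert.prems in auto)
qed

section \<open>Gaussian measure in simplicial coordinates\<close>

lemma nn_integral_translation:
  fixes f :: "'a::euclidean_space \<Rightarrow> ennreal"
  assumes [measurable]: "f \<in> borel_measurable borel"
  shows "(\<integral>\<^sup>+x. f (c + x) \<partial>lborel) = (\<integral>\<^sup>+x. f x \<partial>lborel)"
  by (subst (2) lborel_distr_plus[of c, symmetric], subst nn_integral_distr) auto

text \<open>
  Both sides equal \<open>\<integral>\<integral> 1\<^sub>A(x) f(x + T y) dx dy\<close> for the unit ball \<open>A\<close>, by translation invariance in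
  \<open>y\<close> and in \<open>x\<close> respectively; the library formula with determinants requires a well-ordered
  index type.
\<close>

lemma nn_integral_linear_injective:
  fixes T :: "'a::euclidean_space \<Rightarrow> 'a" and f :: "'a \<Rightarrow> ennreal"
  assumes T: "linear T" "inj T" and [measurable]: "f \<in> borel_measurable borel"
  shows "emeasure lborel {y. norm (T y) \<le> 1} * (\<integral>\<^sup>+x. f x \<partial>lborel)
    = emeasure lborel (cball (0::'a) 1) * (\<integral>\<^sup>+y. f (T y) \<partial>lborel)"
proof -
  let ?A = "cball (0::'a) 1"
  have [measurable]: "T \<in> borel_measurable borel"
    using T by (intro borel_measurable_continuous_onI linear_continuous_on) (simp add: linear_conv_bounded_linear)
  have contT: "continuous_on UNIV T"
    using T(1) by (intro linear_continuous_on) (simp add: linear_conv_bounded_linear)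
  have 2: "(\<lambda>p. fst p + T (snd p)) \<in> measurable (lborel \<Otimes>\<^sub>M lborel) borel"
    "(\<lambda>p. fst p - T (snd p)) \<in> measurable (lborel \<Otimes>\<^sub>M lborel) borel"
    unfolding lborel_prod measurable_lborel1 measurable_lborel2
    by (intro borel_measurable_continuous_onI continuous_intros continuous_on_compose2[OF contT]; simp)+
  have [measurable]: "(\<lambda>p. f (fst p + T (snd p))) \<in> borel_measurable (lborel \<Otimes>\<^sub>M lborel)"
    by (rule measurable_compose[OF 2(1)]) measurable
  have [measurable]: "(\<lambda>p. indicator ?A (fst p - T (snd p)) :: ennreal) \<in> borel_measurable (lborel \<Otimes>\<^sub>M lborel)"
    by (rule measurable_compose[OF 2(2)], rule borel_measurable_indicator) simp
  have [measurable]: "(\<lambda>p. indicator ?A (fst p) :: ennreal) \<in> borel_measurable (lborel \<Otimes>\<^sub>M lborel)"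
    by (rule measurable_compose[OF measurable_fst], rule borel_measurable_indicator) simp
  have [measurable]: "?A \<in> sets borel" by simp
  have surj: "\<exists>y. T y = x" for x
    using linear_injective_imp_surjective[OF T] by (metis surjD)
  have "(\<integral>\<^sup>+x. \<integral>\<^sup>+y. indicator ?A x * f (x + T y) \<partial>lborel \<partial>lborel)
      = (\<integral>\<^sup>+x. indicator ?A x * (\<integral>\<^sup>+y. f (T y) \<partial>lborel) \<partial>lborel)"
  proof (intro nn_integral_cong)
    fix x :: 'a
    obtain y0 where y0: "T y0 = x" using surj by blast
    have "(\<integral>\<^sup>+y. f (x + T y) \<partial>lborel) = (\<integral>\<^sup>+y. f (T (y0 + y)) \<partial>lborel)"
      using T(1) y0 by (simp add: linear_add)
    also have "\<dots> = (\<integral>\<^sup>+y. f (T y) \<partial>lborel)"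
      by (rule nn_integral_translation[of "\<lambda>y. f (T y)"]) measurable
    finally show "(\<integral>\<^sup>+y. indicator ?A x * f (x + T y) \<partial>lborel) = indicator ?A x * (\<integral>\<^sup>+y. f (T y) \<partial>lborel)"
      by (simp add: nn_integral_cmult)
  qed
  also have "\<dots> = emeasure lborel ?A * (\<integral>\<^sup>+y. f (T y) \<partial>lborel)"
    by (subst nn_integral_multc) (auto intro: borel_measurable_indicator)
  finally have 1: "(\<integral>\<^sup>+x. \<integral>\<^sup>+y. indicator ?A x * f (x + T y) \<partial>lborel \<partial>lborel)
      = emeasure lborel ?A * (\<integral>\<^sup>+y. f (T y) \<partial>lborel)" .
  have "(\<integral>\<^sup>+x. \<integral>\<^sup>+y. indicator ?A x * f (x + T y) \<partial>lborel \<partial>lborel)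
      = (\<integral>\<^sup>+y. \<integral>\<^sup>+x. indicator ?A x * f (x + T y) \<partial>lborel \<partial>lborel)"
    by (rule lborel_pair.Fubini'[symmetric]) (unfold case_prod_beta, measurable)
  also have "\<dots> = (\<integral>\<^sup>+y. \<integral>\<^sup>+x. indicator ?A (x - T y) * f x \<partial>lborel \<partial>lborel)"
  proof (rule nn_integral_cong)
    fix y
    have "(\<integral>\<^sup>+x. indicator ?A (T y + x - T y) * f (T y + x) \<partial>lborel) = (\<integral>\<^sup>+x. indicator ?A (x - T y) * f x \<partial>lborel)"
      by (rule nn_integral_translation[of "\<lambda>x. indicator ?A (x - T y) * f x"]) measurable
    then show "(\<integral>\<^sup>+x. indicator ?A x * f (x + T y) \<partial>lborel) = (\<integral>\<^sup>+x. indicator ?A (x - T y) * f x \<partial>lborel)"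
      by (simp add: add.commute)
  qed
  also have "\<dots> = (\<integral>\<^sup>+x. \<integral>\<^sup>+y. indicator ?A (x - T y) * f x \<partial>lborel \<partial>lborel)"
    by (rule lborel_pair.Fubini'[symmetric]) (unfold case_prod_beta, measurable)
  also have "\<dots> = (\<integral>\<^sup>+x. emeasure lborel {y. norm (T y) \<le> 1} * f x \<partial>lborel)"
  proof (intro nn_integral_cong)
    fix x :: 'a
    obtain y0 where y0: "T y0 = x" using surj by blast
    have "indicator ?A (x - T y) = (indicator {y. norm (T y) \<le> 1} (- y0 + y) :: ennreal)" for y
    proof -
      have "T (- y0 + y) = - (x - T y)" using T(1) y0 by (simp add: linear_diff)
      then show ?thesis by (simp add: indicator_def del: minus_diff_eq)
    qed
    then have "(\<integral>\<^sup>+y. indicator ?A (x - T y) \<partial>lborel) = (\<integral>\<^sup>+y. indicator {y. norm (T y) \<le> 1} (- y0 + y) \<partial>lborel)"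
      by simp
    also have "\<dots> = (\<integral>\<^sup>+y. indicator {y. norm (T y) \<le> 1} y \<partial>lborel)"
      by (rule nn_integral_translation) measurable
    finally show "(\<integral>\<^sup>+y. indicator ?A (x - T y) * f x \<partial>lborel) = emeasure lborel {y. norm (T y) \<le> 1} * f x"
      by (simp add: nn_integral_multc)
  qed
  also have "\<dots> = emeasure lborel {y. norm (T y) \<le> 1} * (\<integral>\<^sup>+x. f x \<partial>lborel)"
    by (rule nn_integral_cmult) measurable
  finally show ?thesis using 1 by simp
qed

lemma emeasure_cball_pos_finite:
  obtains v where "emeasure lborel (cball (0::'a::euclidean_space) 1) = ennreal v" "0 < v"
proof -
  have "emeasure lborel (cball (0::'a) 1) = ennreal (unit_ball_vol (real DIM('a)))"
    by (simp add: emeasure_cball)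
  then show ?thesis using that by simp
qed

text \<open>The factor is the ratio of the volumes of the preimage of the unit ball and of the ball;
  bounds of \<open>T\<close> from both sides make it positive and finite. Its value is left open,
  because it cancels later.\<close>

lemma nn_integral_linear_scale:
  fixes T :: "'a::euclidean_space \<Rightarrow> 'a"
  assumes T: "linear T" "inj T"
  obtains d where "0 < d" "\<And>f. f \<in> borel_measurable borel \<Longrightarrow>
    (\<integral>\<^sup>+y. f (T y) \<partial>lborel) = ennreal d * (\<integral>\<^sup>+x. f x \<partial>lborel)"
proof -
  obtain v where v: "emeasure lborel (cball (0::'a) 1) = ennreal v" "0 < v"
    by (rule emeasure_cball_pos_finite)
  obtain B where B: "0 < B" "\<And>x. B * norm x \<le> norm (T x)"
    using linear_inj_bounded_below_pos[OF T] by blast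
  obtain C where C: "0 < C" "\<And>x. norm (T x) \<le> C * norm x"
    using linear_bounded_pos[OF T(1)] by blast
  let ?S = "{y. norm (T y) \<le> 1}"
  have [measurable]: "T \<in> borel_measurable borel"
    using T by (intro borel_measurable_continuous_onI linear_continuous_on) (simp add: linear_conv_bounded_linear)
  have "?S \<subseteq> cball 0 (1 / B)"
  proof
    fix y assume "y \<in> ?S"
    then have "B * norm y \<le> 1" using B(2)[of y] by simp
    then show "y \<in> cball 0 (1 / B)" using B(1) by (simp add: field_simps)
  qed
  then have "bounded ?S" using bounded_cball bounded_subset by blast
  then have fin: "emeasure lborel ?S < \<infinity>" by (rule emeasure_bounded_finite)
  have "ball 0 (1 / C) \<subseteq> ?S"
  proof
    fix y :: 'a assume "y \<in> ball 0 (1 / C)"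
    then have "C * norm y \<le> 1" using C(1) by (simp add: field_simps)
    then show "y \<in> ?S" using C(2)[of y] by simp
  qed
  then have "emeasure lborel (ball (0::'a) (1 / C)) \<le> emeasure lborel ?S"
    by (intro emeasure_mono) auto
  moreover have "0 < emeasure lborel (ball (0::'a) (1 / C))"
    using C(1) by (simp add: emeasure_ball)
  ultimately have "0 < emeasure lborel ?S" by simp
  then obtain s where s: "emeasure lborel ?S = ennreal s" "0 < s"
    using fin by (cases "emeasure lborel ?S") auto
  show ?thesis
  proof
    show "0 < s / v" using s v by simp
    fix f :: "'a \<Rightarrow> ennreal" assume [measurable]: "f \<in> borel_measurable borel"
    have "ennreal (1 / v) * (ennreal s * (\<integral>\<^sup>+x. f x \<partial>lborel)) = ennreal (1 / v) * (ennreal v * (\<integral>\<^sup>+y. f (T y) \<partial>lborel))"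
      using nn_integral_linear_injective[OF T, of f] s v by simp
    then show "(\<integral>\<^sup>+y. f (T y) \<partial>lborel) = ennreal (s / v) * (\<integral>\<^sup>+x. f x \<partial>lborel)"
      using s v by (simp flip: mult.assoc ennreal_mult)
  qed
qed

lemma nn_integral_orthogonal_transformation:
  fixes T :: "'a::euclidean_space \<Rightarrow> 'a" and f :: "'a \<Rightarrow> ennreal"
  assumes T: "orthogonal_transformation T" and f: "f \<in> borel_measurable borel"
  shows "(\<integral>\<^sup>+y. f (T y) \<partial>lborel) = (\<integral>\<^sup>+x. f x \<partial>lborel)"
proof -
  obtain v where v: "emeasure lborel (cball (0::'a) 1) = ennreal v" "0 < v"
    by (rule emeasure_cball_pos_finite)
  have "{y. norm (T y) \<le> 1} = cball 0 1"
    using T by (auto simp: orthogonal_transformation_norm)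
  then have "ennreal v * (\<integral>\<^sup>+x. f x \<partial>lborel) = ennreal v * (\<integral>\<^sup>+y. f (T y) \<partial>lborel)"
    using nn_integral_linear_injective[OF orthogonal_transformation_linear[OF T] orthogonal_transformation_inj[OF T] f] v
    by simp
  then show ?thesis using v by (simp add: ennreal_mult_cancel_left)
qed

text \<open>Here the constant must be explicit: \<open>\<kappa>^n\<close> is the factor that is
  optimised at the end.\<close>

lemma nn_integral_scaleR:
  fixes f :: "'a::euclidean_space \<Rightarrow> ennreal"
  assumes \<kappa>: "0 < \<kappa>" and f: "f \<in> borel_measurable borel"
  shows "(\<integral>\<^sup>+x. f x \<partial>lborel) = ennreal (\<kappa> ^ DIM('a)) * (\<integral>\<^sup>+y. f (\<kappa> *\<^sub>R y) \<partial>lborel)"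
proof -
  have S: "{y::'a. norm (\<kappa> *\<^sub>R y) \<le> 1} = cball 0 (1 / \<kappa>)"
    using \<kappa> by (auto simp: field_simps)
  have inj: "inj (\<lambda>y::'a. \<kappa> *\<^sub>R y)" using \<kappa> by (auto intro: injI)
  define v where "v = unit_ball_vol (real DIM('a))"
  have v: "0 < v" by (simp add: v_def)
  have "ennreal (v * (1 / \<kappa>) ^ DIM('a)) * (\<integral>\<^sup>+x. f x \<partial>lborel) = ennreal v * (\<integral>\<^sup>+y. f (\<kappa> *\<^sub>R y) \<partial>lborel)"
    using nn_integral_linear_injective[OF linear_scaleR inj f] S \<kappa> by (simp add: emeasure_cball v_def)
  then have "ennreal (\<kappa> ^ DIM('a) / v) * (ennreal (v * (1 / \<kappa>) ^ DIM('a)) * (\<integral>\<^sup>+x. f x \<partial>lborel))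
      = ennreal (\<kappa> ^ DIM('a) / v) * (ennreal v * (\<integral>\<^sup>+y. f (\<kappa> *\<^sub>R y) \<partial>lborel))" by simp
  moreover have "ennreal (\<kappa> ^ DIM('a) / v) * ennreal (v * (1 / \<kappa>) ^ DIM('a)) = 1"
    using v \<kappa> by (simp add: power_one_over flip: ennreal_mult)
  moreover have "ennreal (\<kappa> ^ DIM('a) / v) * ennreal v = ennreal (\<kappa> ^ DIM('a))"
    using v \<kappa> by (simp flip: ennreal_mult)
  ultimately show ?thesis by (metis mult.assoc mult_1)
qed

lemma prekopa_leindler_mult:
  fixes f g h :: "'a::euclidean_space \<Rightarrow> ennreal"
  assumes \<theta>: "0 < \<theta>" "\<theta> < 1"
    and [measurable]: "f \<in> borel_measurable borel" "g \<in> borel_measurable borel" "h \<in> borel_measurable borel"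
    and dom: "\<And>x y. (\<And>b. b \<in> Basis \<Longrightarrow> 0 < x \<bullet> b) \<Longrightarrow> (\<And>b. b \<in> Basis \<Longrightarrow> 0 < y \<bullet> b) \<Longrightarrow>
      gm_dom \<theta> (f x) (g y) (h (\<Sum>b\<in>Basis. ((x \<bullet> b) powr (1 - \<theta>) * (y \<bullet> b) powr \<theta>) *\<^sub>R b))"
  shows "gm_dom \<theta> (\<integral>\<^sup>+x. f x * indicator {x. \<forall>b\<in>Basis. 0 < x \<bullet> b} x \<partial>lborel)
      (\<integral>\<^sup>+x. g x * indicator {x. \<forall>b\<in>Basis. 0 < x \<bullet> b} x \<partial>lborel)
      (\<integral>\<^sup>+x. h x * indicator {x. \<forall>b\<in>Basis. 0 < x \<bullet> b} x \<partial>lborel)"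
proof -
  let ?P = "Pi\<^sub>M (Basis :: 'a set) (\<lambda>_. lborel :: real measure)"
  define e where "e u = (\<Sum>b\<in>Basis. u b *\<^sub>R b)" for u :: "'a \<Rightarrow> real"
  have e_inner: "e u \<bullet> b = u b" if "b \<in> Basis" for u b
    using that by (simp add: e_def)
  have [measurable]: "e \<in> measurable ?P borel"
    unfolding e_def by measurable
  have [measurable]: "{x::'a. \<forall>b\<in>Basis. 0 < x \<bullet> b} \<in> sets borel"
    by measurable
  have rw: "(\<integral>\<^sup>+x. F x * indicator {x. \<forall>b\<in>Basis. 0 < x \<bullet> b} x \<partial>lborel)
     = (\<integral>\<^sup>+u. F (e u) * indicator {u. \<forall>b\<in>Basis. 0 < u b} u \<partial>?P)"
    if [measurable]: "F \<in> borel_measurable borel" for F :: "'a \<Rightarrow> ennreal"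
  proof -
    have "(\<integral>\<^sup>+x. F x * indicator {x. \<forall>b\<in>Basis. 0 < x \<bullet> b} x \<partial>lborel)
      = (\<integral>\<^sup>+x. F x * indicator {x. \<forall>b\<in>Basis. 0 < x \<bullet> b} x \<partial>distr ?P borel e)"
      by (subst lborel_eq) (simp add: e_def[abs_def])
    also have "\<dots> = (\<integral>\<^sup>+u. F (e u) * indicator {x. \<forall>b\<in>Basis. 0 < x \<bullet> b} (e u) \<partial>?P)"
      by (rule nn_integral_distr) measurable
    also have "\<dots> = (\<integral>\<^sup>+u. F (e u) * indicator {u. \<forall>b\<in>Basis. 0 < u b} u \<partial>?P)"
      by (intro nn_integral_cong) (simp add: e_inner indicator_def)
    finally show ?thesis .
  qed
  show ?thesis
    unfolding rw[OF assms(3)] rw[OF assms(4)] rw[OF assms(5)]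
  proof (rule prekopa_leindler_mult_PiM[OF finite_Basis \<theta>])
    fix x y :: "'a \<Rightarrow> real"
    assume xy: "\<And>b. b \<in> Basis \<Longrightarrow> 0 < x b" "\<And>b. b \<in> Basis \<Longrightarrow> 0 < y b"
    have "e (\<lambda>b\<in>Basis. x b powr (1 - \<theta>) * y b powr \<theta>)
        = (\<Sum>b\<in>Basis. ((e x \<bullet> b) powr (1 - \<theta>) * (e y \<bullet> b) powr \<theta>) *\<^sub>R b)"
      unfolding e_def[of "restrict _ _"] by (intro sum.cong) (auto simp: e_inner)
    then show "gm_dom \<theta> (f (e x)) (g (e y)) (h (e (\<lambda>b\<in>Basis. x b powr (1 - \<theta>) * y b powr \<theta>)))"
      using dom[of "e x" "e y"] xy by (simp add: e_inner)
  qed measurable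
qed

section \<open>The Gaussian density under geometric means\<close>

definition gauss_density :: "'a::euclidean_space \<Rightarrow> real" where
  "gauss_density x = 1 / (2 * pi) powr (real DIM('a) / 2) * exp (- ((norm x)\<^sup>2 / 2))"

lemma measurable_gauss_density [measurable]: "gauss_density \<in> borel_measurable borel"
  unfolding gauss_density_def by measurable

lemma emeasure_gaussian:
  "A \<in> sets borel \<Longrightarrow> emeasure gaussian_measure A = (\<integral>\<^sup>+x. ennreal (gauss_density x) * indicator A x \<partial>lborel)"
  unfolding gaussian_measure_def gauss_density_def[symmetric] by (subst emeasure_density) auto

lemma sets_gaussian [simp]: "sets gaussian_measure = sets borel"
  by (simp add: gaussian_measure_def)

text \<open>The normalising constant \<open>c\<close> is reproduced by
  \<open>c powr (1 - \<theta>) * c powr \<theta>\<close>, so the estimate reduces to one between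
  squared norms. If \<open>x\<close> or \<open>y\<close> misses its set, a left factor is 0 and
  nothing lies strictly between.\<close>

lemma gm_dom_gauss:
  fixes x y z :: "'a::euclidean_space"
  assumes \<theta>: "0 < \<theta>" "\<theta> < 1" and le: "(norm z)\<^sup>2 \<le> (1 - \<theta>) * (norm x)\<^sup>2 + \<theta> * (norm y)\<^sup>2"
    and mem: "x \<in> X \<Longrightarrow> y \<in> Y \<Longrightarrow> z \<in> Z"
  shows "gm_dom \<theta> (ennreal (gauss_density x) * indicator X x) (ennreal (gauss_density y) * indicator Y y)
     (ennreal (gauss_density z) * indicator Z z)"
  unfolding gm_dom_def
proof (intro allI impI)
  fix a b :: real
  assume ab: "0 < a" "0 < b" "ennreal a < ennreal (gauss_density x) * indicator X x"
    "ennreal b < ennreal (gauss_density y) * indicator Y y"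
  then have xy: "x \<in> X" "y \<in> Y" by (auto simp: indicator_def of_bool_def split: if_splits)
  then have lt: "a \<le> gauss_density x" "b \<le> gauss_density y" using ab by (auto simp: ennreal_less_iff)
  define c where "c = 1 / (2 * pi) powr (real DIM('a) / 2)"
  have c: "0 < c" by (simp add: c_def)
  have gd: "gauss_density w = c * exp (- ((norm w)\<^sup>2 / 2))" for w :: 'a
    by (simp add: gauss_density_def c_def)
  have "a powr (1 - \<theta>) * b powr \<theta> \<le> gauss_density x powr (1 - \<theta>) * gauss_density y powr \<theta>"
    using ab(1,2) lt \<theta> by (intro mult_mono powr_mono2) auto
  also have "\<dots> = (c powr (1 - \<theta>) * c powr \<theta>) * exp (- ((1 - \<theta>) * (norm x)\<^sup>2 + \<theta> * (norm y)\<^sup>2) / 2)"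
  proof -
    have "exp (- ((norm x)\<^sup>2 / 2)) powr (1 - \<theta>) * exp (- ((norm y)\<^sup>2 / 2)) powr \<theta>
       = exp (- ((1 - \<theta>) * (norm x)\<^sup>2 + \<theta> * (norm y)\<^sup>2) / 2)"
      by (simp add: powr_def field_simps flip: exp_add)
    then show ?thesis using c by (simp add: gd powr_mult)
  qed
  also have "c powr (1 - \<theta>) * c powr \<theta> = c" using c by (simp flip: powr_add)
  also have "c * exp (- ((1 - \<theta>) * (norm x)\<^sup>2 + \<theta> * (norm y)\<^sup>2) / 2) \<le> gauss_density z"
    unfolding gd using le c by (intro mult_left_mono) auto
  finally show "ennreal (a powr (1 - \<theta>) * b powr \<theta>) \<le> ennreal (gauss_density z) * indicator Z z"
    using mem[OF xy] by (simp add: ennreal_leI)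
qed

text \<open>Expand the squared norm through the Gram matrix of \<open>T\<close>. A product of two
  coordinate geometric means is the geometric mean of the products, so Young's inequality bounds it,
  and the nonnegative Gram entries allow these bounds to be summed.\<close>

lemma norm_geometric_mean_le:
  fixes T :: "'a::euclidean_space \<Rightarrow> 'a"
  assumes T: "linear T" "\<And>b c. b \<in> Basis \<Longrightarrow> c \<in> Basis \<Longrightarrow> 0 \<le> T b \<bullet> T c"
    and \<theta>: "0 < \<theta>" "\<theta> < 1" and x: "\<And>b. b \<in> Basis \<Longrightarrow> 0 < x \<bullet> b" and y: "\<And>b. b \<in> Basis \<Longrightarrow> 0 < y \<bullet> b"
  shows "(norm (T (\<Sum>b\<in>Basis. ((x \<bullet> b) powr (1 - \<theta>) * (y \<bullet> b) powr \<theta>) *\<^sub>R b)))\<^sup>2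
    \<le> (1 - \<theta>) * (norm (T x))\<^sup>2 + \<theta> * (norm (T y))\<^sup>2"
proof -
  have T_sum: "(norm (T (\<Sum>b\<in>Basis. u b *\<^sub>R b)))\<^sup>2 = (\<Sum>b\<in>Basis. \<Sum>c\<in>Basis. (u b * u c) * (T b \<bullet> T c))" for u
  proof -
    have "T (\<Sum>b\<in>Basis. u b *\<^sub>R b) = (\<Sum>b\<in>Basis. u b *\<^sub>R T b)"
      using T(1) by (simp add: linear_sum linear_scale)
    then show ?thesis
      by (simp add: power2_norm_eq_inner inner_sum_left inner_sum_right mult_ac sum_distrib_left inner_commute)
  qed
  have T_x: "(norm (T w))\<^sup>2 = (\<Sum>b\<in>Basis. \<Sum>c\<in>Basis. ((w \<bullet> b) * (w \<bullet> c)) * (T b \<bullet> T c))" for w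
    using T_sum[of "\<lambda>b. w \<bullet> b"] by (simp add: euclidean_representation)
  have "(\<Sum>b\<in>Basis. \<Sum>c\<in>Basis. (((x \<bullet> b) powr (1 - \<theta>) * (y \<bullet> b) powr \<theta>) * ((x \<bullet> c) powr (1 - \<theta>) * (y \<bullet> c) powr \<theta>)) * (T b \<bullet> T c))
    \<le> (\<Sum>b\<in>Basis. \<Sum>c\<in>Basis. ((1 - \<theta>) * ((x \<bullet> b) * (x \<bullet> c)) + \<theta> * ((y \<bullet> b) * (y \<bullet> c))) * (T b \<bullet> T c))"
  proof (intro sum_mono mult_right_mono T(2))
    fix b c :: 'a assume bc: "b \<in> Basis" "c \<in> Basis"
    have "((x \<bullet> b) powr (1 - \<theta>) * (y \<bullet> b) powr \<theta>) * ((x \<bullet> c) powr (1 - \<theta>) * (y \<bullet> c) powr \<theta>)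
       = ((x \<bullet> b) * (x \<bullet> c)) powr (1 - \<theta>) * ((y \<bullet> b) * (y \<bullet> c)) powr \<theta>"
      using x[OF bc(1)] x[OF bc(2)] y[OF bc(1)] y[OF bc(2)] by (simp add: powr_mult)
    also have "\<dots> \<le> (1 - \<theta>) * ((x \<bullet> b) * (x \<bullet> c)) + \<theta> * ((y \<bullet> b) * (y \<bullet> c))"
      using \<theta> x[OF bc(1)] x[OF bc(2)] y[OF bc(1)] y[OF bc(2)] by (intro Youngs_inequality_0) auto
    finally show "((x \<bullet> b) powr (1 - \<theta>) * (y \<bullet> b) powr \<theta>) * ((x \<bullet> c) powr (1 - \<theta>) * (y \<bullet> c) powr \<theta>)
      \<le> (1 - \<theta>) * ((x \<bullet> b) * (x \<bullet> c)) + \<theta> * ((y \<bullet> b) * (y \<bullet> c))" .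
  qed
  also have "\<dots> = (1 - \<theta>) * (norm (T x))\<^sup>2 + \<theta> * (norm (T y))\<^sup>2"
    unfolding T_x by (simp add: sum.distrib sum_distrib_left distrib_right mult.assoc)
  finally show ?thesis unfolding T_sum .
qed

section \<open>Chambers\<close>

lemma emeasure_gaussian_orthogonal:
  fixes g :: "'a::euclidean_space \<Rightarrow> 'a"
  assumes g: "orthogonal_transformation g" and A: "A \<in> sets borel"
  shows "g ` A \<in> sets borel" "emeasure gaussian_measure (g ` A) = emeasure gaussian_measure A"
proof -
  have bij: "bij g" using g by (rule orthogonal_transformation_bij)
  have cont: "f \<in> borel_measurable borel" if "orthogonal_transformation f" for f :: "'a \<Rightarrow> 'a"
    using orthogonal_transformation_linear[OF that]
    by (intro borel_measurable_continuous_onI linear_continuous_on) (simp add: linear_conv_bounded_linear)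
  have "g ` A = inv g -` A"
    using bij_vimage_eq_inv_image[OF bij_imp_bij_inv[OF bij], of A] bij by (simp add: inv_inv_eq)
  moreover have "inv g -` A \<inter> space borel \<in> sets borel"
    using cont[OF orthogonal_transformation_inv[OF g]] A by (rule measurable_sets)
  ultimately show gA: "g ` A \<in> sets borel" by simp
  have "emeasure gaussian_measure (g ` A) = (\<integral>\<^sup>+x. ennreal (gauss_density x) * indicator (g ` A) x \<partial>lborel)"
    using gA by (rule emeasure_gaussian)
  also have "\<dots> = (\<integral>\<^sup>+x. ennreal (gauss_density (g x)) * indicator (g ` A) (g x) \<partial>lborel)"
    by (rule nn_integral_orthogonal_transformation[OF g, symmetric]) (use gA in measurable)
  also have "\<dots> = (\<integral>\<^sup>+x. ennreal (gauss_density x) * indicator A x \<partial>lborel)"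
    using bij_is_inj[OF bij] g
    by (intro nn_integral_cong)
       (simp add: gauss_density_def orthogonal_transformation_norm indicator_def inj_image_mem_iff)
  also have "\<dots> = emeasure gaussian_measure A"
    using A by (rule emeasure_gaussian[symmetric])
  finally show "emeasure gaussian_measure (g ` A) = emeasure gaussian_measure A" .
qed

lemma emeasure_gaussian_bounded:
  fixes A :: "'a::euclidean_space set"
  assumes "A \<in> sets borel" "bounded A"
  shows "emeasure gaussian_measure A < \<infinity>"
proof -
  define c where "c = 1 / (2 * pi) powr (real DIM('a) / 2)"
  have "gauss_density x \<le> c" for x :: 'a
    unfolding gauss_density_def c_def by (rule mult_left_le) simp_all
  then have "emeasure gaussian_measure A \<le> (\<integral>\<^sup>+x. ennreal c * indicator A x \<partial>lborel)"
    unfolding emeasure_gaussian[OF assms(1)]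
    by (intro nn_integral_mono mult_right_mono ennreal_leI) auto
  also have "\<dots> = ennreal c * emeasure lborel A"
    using assms by (simp add: nn_integral_cmult_indicator)
  also have "\<dots> < \<infinity>"
    using emeasure_bounded_finite[OF assms(2)] by (simp add: ennreal_mult_less_top)
  finally show ?thesis .
qed

lemma emeasure_gaussian_interior:
  fixes A :: "'a::euclidean_space set"
  assumes "A \<in> sets borel" "interior A \<noteq> {}"
  shows "0 < emeasure gaussian_measure A"
proof -
  obtain x0 r where r: "0 < r" "ball x0 r \<subseteq> A"
    using assms(2) by (metis all_not_in_conv mem_interior)
  define c where "c = 1 / (2 * pi) powr (real DIM('a) / 2) * exp (- ((norm x0 + r)\<^sup>2 / 2))"
  have c: "0 < c" by (simp add: c_def)
  have le: "c \<le> gauss_density x" if "x \<in> ball x0 r" for x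
  proof -
    have "norm x \<le> norm x0 + r"
      using that norm_triangle_ineq[of x0 "x - x0"] by (simp add: dist_norm norm_minus_commute)
    then have "(norm x)\<^sup>2 \<le> (norm x0 + r)\<^sup>2" by (intro power_mono) auto
    then show ?thesis unfolding c_def gauss_density_def by (intro mult_left_mono) auto
  qed
  have "0 < ennreal c * emeasure lborel (ball x0 r)"
    using c r by (simp add: emeasure_ball ennreal_zero_less_mult_iff)
  also have "\<dots> = (\<integral>\<^sup>+x. ennreal c * indicator (ball x0 r) x \<partial>lborel)"
    by (simp add: nn_integral_cmult_indicator)
  also have "\<dots> \<le> emeasure gaussian_measure A"
    unfolding emeasure_gaussian[OF assms(1)] using le r(2)
    by (intro nn_integral_mono) (auto split: split_indicator intro: ennreal_leI)
  finally show ?thesis .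
qed

lemma null_sets_gaussian_hyperplane:
  fixes a :: "'a::euclidean_space"
  assumes "a \<noteq> 0"
  shows "{x. x \<bullet> a = 0} \<in> null_sets gaussian_measure"
proof -
  have b: "{x. x \<bullet> a = 0} \<in> sets borel" by measurable
  have "negligible {x. a \<bullet> x = 0}" using assms by (intro negligible_hyperplane) simp
  then have "{x. x \<bullet> a = 0} \<in> null_sets lebesgue"
    by (simp add: negligible_iff_null_sets inner_commute)
  then have "{x. x \<bullet> a = 0} \<in> null_sets lborel"
    using b by (simp add: null_sets_def)
  then have "(\<integral>\<^sup>+x. ennreal (gauss_density x) * indicator {x. x \<bullet> a = 0} x \<partial>lborel) = 0"
    by (rule nn_integral_null_set)
  then show ?thesis
    using b by (simp add: null_sets_def emeasure_gaussian)
qed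

lemma exists_generic_vector:
  fixes \<Phi> :: "'a::euclidean_space set"
  assumes "finite \<Phi>" "0 \<notin> \<Phi>"
  shows "\<exists>\<rho>. \<forall>\<alpha>\<in>\<Phi>. \<rho> \<bullet> \<alpha> \<noteq> 0"
proof (rule ccontr)
  assume "\<not> ?thesis"
  then have "\<Union> ((\<lambda>\<alpha>. {x. \<alpha> \<bullet> x = 0}) ` \<Phi>) = UNIV"
    by (auto simp: inner_commute)
  moreover have "negligible (\<Union> ((\<lambda>\<alpha>. {x. \<alpha> \<bullet> x = 0}) ` \<Phi>))"
    using assms by (intro negligible_Union) (auto intro!: negligible_hyperplane)
  ultimately show False by simp
qed

text \<open>A linear map is determined by its values on a spanning set, so restriction embeds
  \<open>G\<close> into the self-maps of the finite set \<Phi>.\<close>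

lemma finite_linear_permuting:
  fixes \<Phi> :: "'a::euclidean_space set"
  assumes \<Phi>: "finite \<Phi>" "span \<Phi> = UNIV"
    and G: "\<And>g. g \<in> G \<Longrightarrow> linear g" "\<And>g. g \<in> G \<Longrightarrow> g ` \<Phi> = \<Phi>"
  shows "finite G"
proof (rule finite_imageD)
  have "g y \<in> \<Phi>" if "g \<in> G" "y \<in> \<Phi>" for g y
    using G(2)[OF that(1)] that(2) by blast
  then have "(\<lambda>g. restrict g \<Phi>) ` G \<subseteq> \<Phi> \<rightarrow>\<^sub>E \<Phi>"
    by auto
  then show "finite ((\<lambda>g. restrict g \<Phi>) ` G)"
    using \<Phi>(1) finite_PiE[of \<Phi> "\<lambda>_. \<Phi>"] finite_subset by blast
  show "inj_on (\<lambda>g. restrict g \<Phi>) G"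
  proof (rule inj_onI, rule ext)
    fix g h x assume gh: "g \<in> G" "h \<in> G" "restrict g \<Phi> = restrict h \<Phi>"
    then have "g y = h y" if "y \<in> \<Phi>" for y using that by (metis restrict_apply')
    then show "g x = h x"
      using linear_eq_on_span[OF G(1)[OF gh(1)] G(1)[OF gh(2)], of \<Phi> x] \<Phi>(2) by auto
  qed
qed

text \<open>The orbit point with the largest inner product with \<open>\<rho>\<close> lies in the chamber of \<open>\<rho>\<close>.\<close>

lemma chamber_transitive:
  fixes \<Phi> :: "'a::euclidean_space set"
  assumes G: "finite G" "id \<in> G" "\<And>g. g \<in> G \<Longrightarrow> orthogonal_transformation g"
      "\<And>g. g \<in> G \<Longrightarrow> g ` \<Phi> = \<Phi>" "\<And>g \<alpha>. g \<in> G \<Longrightarrow> \<alpha> \<in> \<Phi> \<Longrightarrow> reflect \<alpha> \<circ> g \<in> G"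
    and x: "\<And>\<alpha>. \<alpha> \<in> \<Phi> \<Longrightarrow> x \<bullet> \<alpha> \<noteq> 0"
  shows "\<exists>g\<in>G. \<forall>\<alpha>\<in>\<Phi>. 0 < \<rho> \<bullet> \<alpha> \<longrightarrow> 0 < g x \<bullet> \<alpha>"
proof -
  define m where "m = Max ((\<lambda>g. g x \<bullet> \<rho>) ` G)"
  have fin: "finite ((\<lambda>g. g x \<bullet> \<rho>) ` G)" "(\<lambda>g. g x \<bullet> \<rho>) ` G \<noteq> {}" using G by auto
  obtain g where g: "g \<in> G" "m = g x \<bullet> \<rho>" using Max_in[OF fin] by (auto simp: m_def)
  have max: "h x \<bullet> \<rho> \<le> g x \<bullet> \<rho>" if "h \<in> G" for h
    using Max_ge[OF fin(1)] that g(2) by (auto simp: m_def)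
  have "0 < g x \<bullet> \<alpha>" if \<alpha>: "\<alpha> \<in> \<Phi>" "0 < \<rho> \<bullet> \<alpha>" for \<alpha>
  proof -
    obtain \<beta> where \<beta>: "\<beta> \<in> \<Phi>" "\<alpha> = g \<beta>" using G(4)[OF g(1)] \<alpha>(1) by blast
    have "g x \<bullet> \<alpha> = x \<bullet> \<beta>" using G(3)[OF g(1)] \<beta> by (simp add: orthogonal_transformation_def)
    then have ne: "g x \<bullet> \<alpha> \<noteq> 0" using x[OF \<beta>(1)] by simp
    have "reflect \<alpha> (g x) \<bullet> \<rho> \<le> g x \<bullet> \<rho>" using max[OF G(5)[OF g(1) \<alpha>(1)]] by simp
    moreover have "reflect \<alpha> (g x) \<bullet> \<rho> = g x \<bullet> \<rho> - 2 * ((g x \<bullet> \<alpha>) * (\<rho> \<bullet> \<alpha>))"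
      by (simp add: reflect_def inner_diff_left inner_commute[of \<alpha> \<rho>])
    ultimately have "0 \<le> (g x \<bullet> \<alpha>) * (\<rho> \<bullet> \<alpha>)" by linarith
    then show ?thesis using \<alpha>(2) ne by (simp add: zero_le_mult_iff)
  qed
  then show ?thesis using g(1) by blast
qed

text \<open>Off the null set of walls, space splits into chambers indexed by the set of roots that
  are positive there, and the invariant set \<open>X\<close> has the same mass in each nonempty one.
  \<open>N\<close> counts these chambers; that it does not depend on \<open>X\<close> lets it cancel
  between the bodies.\<close>

lemma chamber_decomposition:
  fixes \<Phi> :: "'a::euclidean_space set"
  assumes \<Phi>: "finite \<Phi>" "0 \<notin> \<Phi>" and \<rho>: "\<And>\<alpha>. \<alpha> \<in> \<Phi> \<Longrightarrow> \<rho> \<bullet> \<alpha> \<noteq> 0" "\<And>\<alpha>. \<alpha> \<in> \<Phi> \<Longrightarrow> - \<alpha> \<in> \<Phi>"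
    and G: "finite G" "id \<in> G" "\<And>g. g \<in> G \<Longrightarrow> orthogonal_transformation g"
      "\<And>g. g \<in> G \<Longrightarrow> g ` \<Phi> = \<Phi>" "\<And>g \<alpha>. g \<in> G \<Longrightarrow> \<alpha> \<in> \<Phi> \<Longrightarrow> reflect \<alpha> \<circ> g \<in> G"
  shows "\<exists>N::nat. \<forall>X\<in>sets borel. (\<forall>g\<in>G. g ` X = X) \<longrightarrow>
    emeasure gaussian_measure X = of_nat N * emeasure gaussian_measure (X \<inter> {x. \<forall>\<alpha>\<in>\<Phi>. 0 < \<rho> \<bullet> \<alpha> \<longrightarrow> 0 < x \<bullet> \<alpha>})"
proof -
  define C where "C = {x. \<forall>\<alpha>\<in>\<Phi>. 0 < \<rho> \<bullet> \<alpha> \<longrightarrow> 0 < x \<bullet> \<alpha>}"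
  define ch where "ch P = {y. \<forall>\<alpha>\<in>\<Phi>. if \<alpha> \<in> P then 0 < y \<bullet> \<alpha> else y \<bullet> \<alpha> < 0}" for P
  define I where "I = {P \<in> Pow \<Phi>. ch P \<noteq> {}}"
  have finI: "finite (Pow \<Phi>)" using \<Phi>(1) by simp
  have sgnC: "0 < \<rho> \<bullet> \<alpha> \<longleftrightarrow> 0 < x \<bullet> \<alpha>" "x \<bullet> \<alpha> \<noteq> 0" if "x \<in> C" "\<alpha> \<in> \<Phi>" for x \<alpha>
  proof -
    have 1: "0 < x \<bullet> \<alpha>" if "0 < \<rho> \<bullet> \<alpha>"
      using \<open>x \<in> C\<close> \<open>\<alpha> \<in> \<Phi>\<close> that by (simp add: C_def)
    have 2: "x \<bullet> \<alpha> < 0" if "\<rho> \<bullet> \<alpha> < 0"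
    proof -
      have "0 < \<rho> \<bullet> (- \<alpha>)" using that by simp
      then have "0 < x \<bullet> (- \<alpha>)"
        using \<open>x \<in> C\<close> \<rho>(2)[OF \<open>\<alpha> \<in> \<Phi>\<close>] unfolding C_def by blast
      then show ?thesis by simp
    qed
    show "0 < \<rho> \<bullet> \<alpha> \<longleftrightarrow> 0 < x \<bullet> \<alpha>" "x \<bullet> \<alpha> \<noteq> 0"
      using 1 2 \<rho>(1)[OF \<open>\<alpha> \<in> \<Phi>\<close>] by (auto simp: neq_iff)
  qed
  have ch_meas: "ch P \<in> sets borel" for P
  proof -
    have "ch P = (\<Inter>\<alpha>\<in>\<Phi>. {y. if \<alpha> \<in> P then 0 < y \<bullet> \<alpha> else y \<bullet> \<alpha> < 0}) \<inter> UNIV"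
      by (auto simp: ch_def)
    moreover have "{y. if \<alpha> \<in> P then 0 < y \<bullet> \<alpha> else y \<bullet> \<alpha> < 0} \<in> sets borel" for \<alpha>
      by (cases "\<alpha> \<in> P") simp_all
    ultimately show ?thesis
      using \<Phi>(1) by (cases "\<Phi> = {}") (auto intro!: sets.finite_INT)
  qed
  \<comment> \<open>An element of \<open>G\<close> moving one point of a chamber into
    \<open>C\<close> moves the whole chamber onto \<open>C\<close>, since it permutes \<Phi> and the
    signs of the roots are constant on a chamber.\<close>
  have piece: "emeasure gaussian_measure (X \<inter> ch P) = emeasure gaussian_measure (X \<inter> C)"
    if P: "P \<in> I" and X: "X \<in> sets borel" "\<And>g. g \<in> G \<Longrightarrow> g ` X = X" for P X
  proof -
    obtain x0 where x0: "x0 \<in> ch P" using P by (auto simp: I_def)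
    then have "x0 \<bullet> \<alpha> \<noteq> 0" if "\<alpha> \<in> \<Phi>" for \<alpha> using that by (force simp: ch_def split: if_splits)
    then obtain g where g: "g \<in> G" "g x0 \<in> C"
      using chamber_transitive[OF G, of x0 \<rho>] by (auto simp: C_def)
    have inner: "g y \<bullet> g \<beta> = y \<bullet> \<beta>" for y \<beta>
      using G(3)[OF g(1)] by (simp add: orthogonal_transformation_def)
    have sgn: "0 < \<rho> \<bullet> g \<beta> \<longleftrightarrow> \<beta> \<in> P" if "\<beta> \<in> \<Phi>" for \<beta>
    proof -
      have "g \<beta> \<in> \<Phi>" using G(4)[OF g(1)] that by blast
      then have "0 < \<rho> \<bullet> g \<beta> \<longleftrightarrow> 0 < g x0 \<bullet> g \<beta>" using sgnC(1)[OF g(2)] by blast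
      also have "\<dots> \<longleftrightarrow> \<beta> \<in> P" using x0 that by (auto simp: inner ch_def split: if_splits)
      finally show ?thesis .
    qed
    have mem: "g y \<in> C \<longleftrightarrow> y \<in> ch P" for y
    proof
      assume y: "g y \<in> C"
      show "y \<in> ch P"
        unfolding ch_def
      proof (intro CollectI ballI)
        fix \<beta> assume \<beta>: "\<beta> \<in> \<Phi>"
        have "g \<beta> \<in> \<Phi>" using G(4)[OF g(1)] \<beta> by blast
        then have "0 < \<rho> \<bullet> g \<beta> \<longleftrightarrow> 0 < y \<bullet> \<beta>" "y \<bullet> \<beta> \<noteq> 0" using sgnC[OF y, of "g \<beta>"] by (simp_all add: inner)
        then show "if \<beta> \<in> P then 0 < y \<bullet> \<beta> else y \<bullet> \<beta> < 0" using sgn[OF \<beta>] by auto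
      qed
    next
      assume y: "y \<in> ch P"
      show "g y \<in> C"
        unfolding C_def
      proof (intro CollectI ballI impI)
        fix \<alpha> assume \<alpha>: "\<alpha> \<in> \<Phi>" "0 < \<rho> \<bullet> \<alpha>"
        obtain \<beta> where \<beta>: "\<beta> \<in> \<Phi>" "\<alpha> = g \<beta>" using G(4)[OF g(1)] \<alpha>(1) by blast
        then have "\<beta> \<in> P" using sgn \<alpha>(2) by simp
        then show "0 < g y \<bullet> \<alpha>" using y \<beta> by (auto simp: inner ch_def)
      qed
    qed
    have "g ` (X \<inter> ch P) = X \<inter> C"
    proof
      show "g ` (X \<inter> ch P) \<subseteq> X \<inter> C" using X(2)[OF g(1)] mem by blast
      show "X \<inter> C \<subseteq> g ` (X \<inter> ch P)"
      proof
        fix z assume z: "z \<in> X \<inter> C"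
        then obtain y where "y \<in> X" "z = g y" using X(2)[OF g(1)] by blast
        then show "z \<in> g ` (X \<inter> ch P)" using z mem by blast
      qed
    qed
    then show ?thesis
      using emeasure_gaussian_orthogonal(2)[OF G(3)[OF g(1)], of "X \<inter> ch P"] X(1) ch_meas[of P] by auto
  qed
  have "emeasure gaussian_measure X = of_nat (card I) * emeasure gaussian_measure (X \<inter> C)"
    if X: "X \<in> sets borel" "\<And>g. g \<in> G \<Longrightarrow> g ` X = X" for X
  proof -
    define N where "N = (\<Union>\<alpha>\<in>\<Phi>. {x. x \<bullet> \<alpha> = 0})"
    have N: "N \<in> null_sets gaussian_measure"
      unfolding N_def using \<Phi> by (intro null_sets_UN' countable_finite null_sets_gaussian_hyperplane) auto
    have cover: "X - N = (\<Union>P\<in>Pow \<Phi>. X \<inter> ch P)"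
    proof (intro equalityI subsetI)
      fix x assume x: "x \<in> X - N"
      then have "x \<in> ch {\<alpha> \<in> \<Phi>. 0 < x \<bullet> \<alpha>}" by (auto simp: ch_def N_def)
      then have "x \<in> X \<inter> ch {\<alpha> \<in> \<Phi>. 0 < x \<bullet> \<alpha>}" using x by simp
      moreover have "{\<alpha> \<in> \<Phi>. 0 < x \<bullet> \<alpha>} \<in> Pow \<Phi>" by auto
      ultimately show "x \<in> (\<Union>P\<in>Pow \<Phi>. X \<inter> ch P)" by (rule UN_I[rotated])
    next
      fix x assume "x \<in> (\<Union>P\<in>Pow \<Phi>. X \<inter> ch P)"
      then show "x \<in> X - N" by (force simp: ch_def N_def split: if_splits)
    qed
    have disj: "disjoint_family_on (\<lambda>P. X \<inter> ch P) (Pow \<Phi>)"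
      unfolding disjoint_family_on_def
    proof (intro ballI impI)
      fix P Q assume PQ: "P \<in> Pow \<Phi>" "Q \<in> Pow \<Phi>" "P \<noteq> Q"
      then obtain \<alpha> where "\<alpha> \<in> \<Phi>" "\<alpha> \<in> P \<longleftrightarrow> \<alpha> \<notin> Q" by blast
      then show "(X \<inter> ch P) \<inter> (X \<inter> ch Q) = {}" by (force simp: ch_def split: if_splits)
    qed
    have "emeasure gaussian_measure X = emeasure gaussian_measure (X - N)"
      using emeasure_Diff_null_set[OF N, of X] X(1) by simp
    also have "\<dots> = (\<Sum>P\<in>Pow \<Phi>. emeasure gaussian_measure (X \<inter> ch P))"
      unfolding cover using X(1) ch_meas disj finI by (intro sum_emeasure[symmetric]) auto
    also have "\<dots> = (\<Sum>P\<in>I. emeasure gaussian_measure (X \<inter> ch P))"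
      using finI by (intro sum.mono_neutral_right) (auto simp: I_def)
    also have "\<dots> = (\<Sum>P\<in>I. emeasure gaussian_measure (X \<inter> C))"
      using piece X by (intro sum.cong) auto
    finally show ?thesis by simp
  qed
  then show ?thesis unfolding C_def by (intro exI[of _ "card I"]) simp
qed

section \<open>Simplicial coordinates and the inequality inside one chamber\<close>

text \<open>\<open>S\<close> records the inner products with the simple roots; its inverse
  \<open>T\<close> sends the standard basis to the dual basis of \<open>D\<close>, that is, to the
  extreme rays of the chamber, and the positive orthant onto the chamber.\<close>

lemma dual_basis_map:
  fixes D :: "'a::euclidean_space set"
  assumes D: "independent D" "span D = UNIV"
  obtains T e :: "'a \<Rightarrow> 'a" where "linear T" "inj T" "bij_betw e Basis D"
    "\<And>c b. b \<in> Basis \<Longrightarrow> T c \<bullet> e b = c \<bullet> b"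
proof -
  have finD: "finite D" using D(1) by (rule independent_imp_finite)
  have "card D = dim (span D)" using D(1) by (simp add: dim_eq_card_independent)
  then have "card D = card (Basis :: 'a set)" using D(2) by simp
  then obtain e :: "'a \<Rightarrow> 'a" where e: "bij_betw e Basis D"
    using finite_same_card_bij[of "Basis :: 'a set" D] finD by auto
  define S where "S x = (\<Sum>b\<in>Basis. (x \<bullet> e b) *\<^sub>R b)" for x :: 'a
  have S: "S x \<bullet> b = x \<bullet> e b" if "b \<in> Basis" for x b
    using that by (simp add: S_def)
  have lin: "linear S"
    by (rule linearI) (auto simp: S_def inner_add_left scaleR_add_left sum.distrib scaleR_sum_right)
  have inj: "inj S"
  proof (rule linear_injective_0[OF lin, THEN iffD2], intro allI impI)
    fix x assume x: "S x = 0"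
    have "orthogonal x d" if "d \<in> D" for d
    proof -
      obtain b where "b \<in> Basis" "d = e b" using e \<open>d \<in> D\<close> by (auto simp: bij_betw_def)
      then show ?thesis using S[of b x] x by (simp add: orthogonal_def)
    qed
    then have "orthogonal x x" using orthogonal_to_span[of x D x] D(2) by auto
    then show "x = 0" by (simp add: orthogonal_def)
  qed
  have surj: "surj S" using linear_injective_imp_surjective[OF lin inj] by simp
  define T where "T = inv S"
  have ST: "S (T c) = c" for c using surj by (simp add: T_def surj_f_inv_f)
  show ?thesis
  proof
    show "inj T" using ST by (metis injI)
    show "linear T"
    proof (rule linearI)
      fix x y and r :: real
      show "T (x + y) = T x + T y" "T (r *\<^sub>R x) = r *\<^sub>R T x"
        by (rule injD[OF inj], simp add: linear_add[OF lin] linear_scale[OF lin] ST)+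
    qed
    show "bij_betw e Basis D" by (rule e)
    show "T c \<bullet> e b = c \<bullet> b" if "b \<in> Basis" for c b
      using S[OF that, of "T c"] ST by simp
  qed
qed

text \<open>Shrinking \<open>x\<close> and \<open>y\<close> by \<open>t < 1\<close> meets the strict
  inequalities in \<open>gm_dom\<close>; the geometric mean has degree one, so \<open>t\<close>
  factors out and tends to 1.\<close>

lemma gm_dom_real:
  assumes "0 < \<theta>" "\<theta> < 1" "0 \<le> x" "0 \<le> y" "0 \<le> z" and dom: "gm_dom \<theta> (ennreal x) (ennreal y) (ennreal z)"
  shows "x powr (1 - \<theta>) * y powr \<theta> \<le> z"
proof (cases "x = 0 \<or> y = 0")
  case True
  then show ?thesis using assms by auto
next
  case False
  then have xy: "0 < x" "0 < y" using assms by auto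
  show ?thesis
  proof (rule field_le_mult_one_interval)
    fix t :: real assume t: "0 < t" "t < 1"
    have "ennreal ((t * x) powr (1 - \<theta>) * (t * y) powr \<theta>) \<le> ennreal z"
      using dom t xy unfolding gm_dom_def by (auto simp: ennreal_less_iff)
    moreover have "(t * x) powr (1 - \<theta>) * (t * y) powr \<theta> = t * (x powr (1 - \<theta>) * y powr \<theta>)"
    proof -
      have "(t * x) powr (1 - \<theta>) * (t * y) powr \<theta> = (t powr (1 - \<theta>) * t powr \<theta>) * (x powr (1 - \<theta>) * y powr \<theta>)"
        using t xy by (simp add: powr_mult)
      also have "t powr (1 - \<theta>) * t powr \<theta> = t" using t by (simp flip: powr_add)
      finally show ?thesis .
    qed
    ultimately show "t * (x powr (1 - \<theta>) * y powr \<theta>) \<le> z"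
      using assms by (simp add: ennreal_le_iff)
  qed
qed

text \<open>In the coordinates of \<open>T\<close> the domination has two halves. For the density it
  is the norm estimate for geometric means together with \<open>\<kappa> \<le> 1\<close>; for
  membership, the shrunken geometric mean lies in the chamber below the Minkowski combination, so
  \<open>dominated_in_invariant_convex\<close> puts it into \<open>M\<close>.\<close>

lemma gaussian_chamber_inequality:
  fixes K L M D :: "'a::euclidean_space set"
  assumes D: "independent D" "span D = UNIV" "\<And>d. d \<in> D \<Longrightarrow> norm d = 1"
    and obt: "\<And>d e. d \<in> D \<Longrightarrow> e \<in> D \<Longrightarrow> d \<noteq> e \<Longrightarrow> d \<bullet> e \<le> 0"
    and KL: "compact K" "compact L" and M: "compact M" "convex M" "\<And>d. d \<in> D \<Longrightarrow> reflect d ` M \<subseteq> M"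
    and KLM: "\<And>x y. x \<in> K \<Longrightarrow> y \<in> L \<Longrightarrow> (1 - l) *\<^sub>R x + l *\<^sub>R y \<in> M"
    and l: "0 < l" "l < 1" and \<theta>: "0 < \<theta>" "\<theta> < 1"
  defines "C \<equiv> {x. \<forall>d\<in>D. 0 < x \<bullet> d}"
    and "\<kappa> \<equiv> ((1 - l) / (1 - \<theta>)) powr (1 - \<theta>) * (l / \<theta>) powr \<theta>"
  shows "\<kappa> ^ DIM('a) * (measure gaussian_measure (K \<inter> C) powr (1 - \<theta>) * measure gaussian_measure (L \<inter> C) powr \<theta>)
    \<le> measure gaussian_measure (M \<inter> C)"
proof -
  have finD: "finite D" using D(1) by (rule independent_imp_finite)
  obtain T e :: "'a \<Rightarrow> 'a" where T: "linear T" "inj T" and e: "bij_betw e Basis D"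
    and Te: "\<And>c b. b \<in> Basis \<Longrightarrow> T c \<bullet> e b = c \<bullet> b"
    using dual_basis_map[OF D(1,2)] by metis
  have De: "(\<forall>d\<in>D. Q d) \<longleftrightarrow> (\<forall>b\<in>Basis. Q (e b))" for Q
    using e by (auto simp: bij_betw_def)
  let ?P = "{c::'a. \<forall>b\<in>Basis. 0 < c \<bullet> b}"
  have TC: "T c \<in> C \<longleftrightarrow> c \<in> ?P" for c
    unfolding C_def mem_Collect_eq De by (simp add: Te)
  have Tnn: "nonneg_comb D (T c)" if "\<And>b. b \<in> Basis \<Longrightarrow> 0 \<le> c \<bullet> b" for c
  proof (rule obtuse_dual_cone[OF finD D(2) obt])
    show "0 \<le> T c \<bullet> d" if "d \<in> D" for d
      using that De[of "\<lambda>d. 0 \<le> T c \<bullet> d"] \<open>\<And>b. b \<in> Basis \<Longrightarrow> 0 \<le> c \<bullet> b\<close> by (simp add: Te)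
  qed
  have gram: "0 \<le> T b \<bullet> T c" if "b \<in> Basis" "c \<in> Basis" for b c
  proof (rule nonneg_comb_inner[OF Tnn])
    show "0 \<le> c \<bullet> b'" if "b' \<in> Basis" for b'
      using that \<open>c \<in> Basis\<close> by (simp add: inner_Basis)
    have "\<forall>d\<in>D. 0 \<le> T b \<bullet> d"
      unfolding De using \<open>b \<in> Basis\<close> by (auto simp: Te inner_Basis)
    then show "0 \<le> T b \<bullet> d" if "d \<in> D" for d using that by blast
  qed
  have \<kappa>0: "0 < \<kappa>" using l \<theta> by (simp add: \<kappa>_def)
  have \<kappa>1: "\<kappa> \<le> 1"
  proof -
    have "\<kappa> \<le> (1 - \<theta>) * ((1 - l) / (1 - \<theta>)) + \<theta> * (l / \<theta>)"
      unfolding \<kappa>_def using l \<theta> by (intro Youngs_inequality_0) auto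
    then show ?thesis using \<theta> by simp
  qed
  have [measurable]: "T \<in> borel_measurable borel"
    using T by (intro borel_measurable_continuous_onI linear_continuous_on) (simp add: linear_conv_bounded_linear)
  have Kb [measurable]: "K \<in> sets borel" "L \<in> sets borel" "M \<in> sets borel"
    using KL M by (auto intro: borel_compact)
  have Cb [measurable]: "C \<in> sets borel"
  proof -
    have "C = (\<Inter>d\<in>D. {x. 0 < x \<bullet> d})" by (auto simp: C_def)
    moreover have "open (\<Inter>d\<in>D. {x. 0 < x \<bullet> d})"
      using finD by (intro open_INT ballI open_Collect_less continuous_intros)
    ultimately show ?thesis by simp
  qed
  define F where "F X x = ennreal (gauss_density x) * indicator X x" for X and x :: 'a
  have F [measurable]: "F X \<in> borel_measurable borel" if [measurable]: "X \<in> sets borel" for X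
    unfolding F_def by measurable
  have dom: "gm_dom \<theta> (F K (T x)) (F L (T y)) (F M (\<kappa> *\<^sub>R T (\<Sum>b\<in>Basis. ((x \<bullet> b) powr (1 - \<theta>) * (y \<bullet> b) powr \<theta>) *\<^sub>R b)))"
    if x: "\<And>b. b \<in> Basis \<Longrightarrow> 0 < x \<bullet> b" and y: "\<And>b. b \<in> Basis \<Longrightarrow> 0 < y \<bullet> b" for x y
  proof -
    define z where "z = (\<Sum>b\<in>Basis. ((x \<bullet> b) powr (1 - \<theta>) * (y \<bullet> b) powr \<theta>) *\<^sub>R b)"
    have z: "z \<bullet> b = (x \<bullet> b) powr (1 - \<theta>) * (y \<bullet> b) powr \<theta>" if "b \<in> Basis" for b
      using that by (simp add: z_def)
    show ?thesis
      unfolding F_def z_def[symmetric]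
    proof (rule gm_dom_gauss[OF \<theta>])
      have "norm (\<kappa> *\<^sub>R T z) \<le> norm (T z)" using \<kappa>0 \<kappa>1 by (simp add: mult_left_le_one_le)
      then have "(norm (\<kappa> *\<^sub>R T z))\<^sup>2 \<le> (norm (T z))\<^sup>2" by (intro power_mono) auto
      also have "\<dots> \<le> (1 - \<theta>) * (norm (T x))\<^sup>2 + \<theta> * (norm (T y))\<^sup>2"
        unfolding z_def by (rule norm_geometric_mean_le[OF T(1) gram \<theta> x y])
      finally show "(norm (\<kappa> *\<^sub>R T z))\<^sup>2 \<le> (1 - \<theta>) * (norm (T x))\<^sup>2 + \<theta> * (norm (T y))\<^sup>2" .
    next
      assume K: "T x \<in> K" and L: "T y \<in> L"
      show "\<kappa> *\<^sub>R T z \<in> M"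
      proof (rule dominated_in_invariant_convex[OF M(2) compact_imp_closed[OF M(1)] M(3) D(3)])
        show "0 < \<kappa> *\<^sub>R T z \<bullet> d" if "d \<in> D" for d
        proof -
          obtain b where b: "b \<in> Basis" "d = e b" using e \<open>d \<in> D\<close> by (auto simp: bij_betw_def)
          then show ?thesis using x[OF b(1)] y[OF b(1)] z[OF b(1)] \<kappa>0 by (simp add: Te)
        qed
        show "(1 - l) *\<^sub>R T x + l *\<^sub>R T y \<in> M" by (rule KLM[OF K L])
        have "(1 - l) *\<^sub>R T x + l *\<^sub>R T y - \<kappa> *\<^sub>R T z = T ((1 - l) *\<^sub>R x + l *\<^sub>R y - \<kappa> *\<^sub>R z)"
          using T(1) by (simp add: linear_add linear_diff linear_scale)
        moreover have "0 \<le> ((1 - l) *\<^sub>R x + l *\<^sub>R y - \<kappa> *\<^sub>R z) \<bullet> b" if b: "b \<in> Basis" for b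
        proof -
          \<comment> \<open>The origin of \<kappa>: these factors satisfy
            \<open>(1 - \<theta>) * p = 1 - l\<close> and \<open>\<theta> * q = l\<close>, so
            Young's inequality with weights \<theta> ends in the combination with weights
            \<open>l\<close>.\<close>
          define p q where "p = (1 - l) / (1 - \<theta>)" and "q = l / \<theta>"
          have pq: "0 < p" "0 < q" using l \<theta> by (auto simp: p_def q_def)
          have "\<kappa> * (z \<bullet> b) = (p * (x \<bullet> b)) powr (1 - \<theta>) * (q * (y \<bullet> b)) powr \<theta>"
            unfolding z[OF b] \<kappa>_def p_def[symmetric] q_def[symmetric] using x[OF b] y[OF b] pq
            by (simp add: powr_mult)
          also have "\<dots> \<le> (1 - \<theta>) * (p * (x \<bullet> b)) + \<theta> * (q * (y \<bullet> b))"
            using x[OF b] y[OF b] pq \<theta> by (intro Youngs_inequality_0) auto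
          also have "\<dots> = (1 - l) * (x \<bullet> b) + l * (y \<bullet> b)"
            using \<theta> by (simp add: p_def q_def)
          finally show ?thesis by (simp add: inner_diff_left inner_add_left)
        qed
        ultimately show "nonneg_comb D ((1 - l) *\<^sub>R T x + l *\<^sub>R T y - \<kappa> *\<^sub>R T z)"
          using Tnn by simp
      qed
    qed
  qed
  have gm: "gm_dom \<theta> (\<integral>\<^sup>+x. F K (T x) * indicator ?P x \<partial>lborel) (\<integral>\<^sup>+x. F L (T x) * indicator ?P x \<partial>lborel)
      (\<integral>\<^sup>+x. F M (\<kappa> *\<^sub>R T x) * indicator ?P x \<partial>lborel)"
  proof (rule prekopa_leindler_mult[OF \<theta>, where f = "\<lambda>x. F K (T x)" and g = "\<lambda>x. F L (T x)"
        and h = "\<lambda>x. F M (\<kappa> *\<^sub>R T x)"])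
    fix x y :: 'a
    assume "\<And>b. b \<in> Basis \<Longrightarrow> 0 < x \<bullet> b" "\<And>b. b \<in> Basis \<Longrightarrow> 0 < y \<bullet> b"
    then show "gm_dom \<theta> (F K (T x)) (F L (T y))
      (F M (\<kappa> *\<^sub>R T (\<Sum>b\<in>Basis. ((x \<bullet> b) powr (1 - \<theta>) * (y \<bullet> b) powr \<theta>) *\<^sub>R b)))"
      by (rule dom)
  qed measurable
  obtain d where d: "0 < d" "\<And>f. f \<in> borel_measurable borel \<Longrightarrow>
    (\<integral>\<^sup>+y. f (T y) \<partial>lborel) = ennreal d * (\<integral>\<^sup>+x. f x \<partial>lborel)"
    using nn_integral_linear_scale[OF T] by blast
  have fin: "emeasure gaussian_measure (X \<inter> C) = ennreal (measure gaussian_measure (X \<inter> C))"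
    if "compact X" for X
  proof -
    have "bounded (X \<inter> C)" using compact_imp_bounded[OF that] by (rule bounded_subset) auto
    then have "emeasure gaussian_measure (X \<inter> C) < \<infinity>"
      using borel_compact[OF that] by (intro emeasure_gaussian_bounded) auto
    then show ?thesis by (intro emeasure_eq_ennreal_measure) auto
  qed
  have int: "(\<integral>\<^sup>+x. F X (T x) * indicator ?P x \<partial>lborel) = ennreal (d * measure gaussian_measure (X \<inter> C))"
    if "compact X" for X
  proof -
    have [measurable]: "X \<in> sets borel" using that by (rule borel_compact)
    have "(\<integral>\<^sup>+x. F X (T x) * indicator ?P x \<partial>lborel) = (\<integral>\<^sup>+x. F (X \<inter> C) (T x) \<partial>lborel)"
      using TC by (intro nn_integral_cong) (auto simp: F_def indicator_def)
    also have "\<dots> = ennreal d * (\<integral>\<^sup>+x. F (X \<inter> C) x \<partial>lborel)"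
      by (rule d(2)) measurable
    also have "(\<integral>\<^sup>+x. F (X \<inter> C) x \<partial>lborel) = emeasure gaussian_measure (X \<inter> C)"
      unfolding F_def by (rule emeasure_gaussian[symmetric]) measurable
    finally show ?thesis using d(1) fin[OF that] by (simp add: ennreal_mult)
  qed
  \<comment> \<open>The orthant is preserved by scaling, so replacing \<open>x\<close> by
    \<open>\<kappa> x\<close> changes the integral only by the Jacobian.\<close>
  have intM: "(\<integral>\<^sup>+x. F M (\<kappa> *\<^sub>R T x) * indicator ?P x \<partial>lborel)
      = ennreal (d * measure gaussian_measure (M \<inter> C) / \<kappa> ^ DIM('a))"
  proof -
    define J where "J = (\<integral>\<^sup>+x. F M (\<kappa> *\<^sub>R T x) * indicator ?P x \<partial>lborel)"
    have "(\<lambda>x. F M (T x) * indicator ?P x) \<in> borel_measurable borel" by measurable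
    from nn_integral_scaleR[OF \<kappa>0 this]
    have "(\<integral>\<^sup>+x. F M (T x) * indicator ?P x \<partial>lborel)
        = ennreal (\<kappa> ^ DIM('a)) * (\<integral>\<^sup>+x. F M (T (\<kappa> *\<^sub>R x)) * indicator ?P (\<kappa> *\<^sub>R x) \<partial>lborel)" .
    also have "(\<integral>\<^sup>+x. F M (T (\<kappa> *\<^sub>R x)) * indicator ?P (\<kappa> *\<^sub>R x) \<partial>lborel) = J"
      unfolding J_def using \<kappa>0 T(1)
      by (intro nn_integral_cong) (simp add: linear_scale indicator_def zero_less_mult_iff)
    finally have "ennreal (1 / \<kappa> ^ DIM('a)) * ennreal (d * measure gaussian_measure (M \<inter> C))
        = ennreal (1 / \<kappa> ^ DIM('a)) * (ennreal (\<kappa> ^ DIM('a)) * J)"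
      unfolding int[OF M(1)] by simp
    also have "\<dots> = J" using \<kappa>0 by (simp flip: mult.assoc ennreal_mult)
    finally show ?thesis unfolding J_def[symmetric] using d(1) \<kappa>0 by (simp flip: ennreal_mult)
  qed
  \<comment> \<open>Both sides are of degree one in the unknown Jacobian \<open>d\<close>, which
    therefore drops out.\<close>
  have "(d * measure gaussian_measure (K \<inter> C)) powr (1 - \<theta>) * (d * measure gaussian_measure (L \<inter> C)) powr \<theta>
    \<le> d * measure gaussian_measure (M \<inter> C) / \<kappa> ^ DIM('a)"
    using gm d(1) \<kappa>0 unfolding int[OF KL(1)] int[OF KL(2)] intM by (intro gm_dom_real[OF \<theta>]) auto
  also have "(d * measure gaussian_measure (K \<inter> C)) powr (1 - \<theta>) * (d * measure gaussian_measure (L \<inter> C)) powr \<theta>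
      = (d powr (1 - \<theta>) * d powr \<theta>) * (measure gaussian_measure (K \<inter> C) powr (1 - \<theta>) * measure gaussian_measure (L \<inter> C) powr \<theta>)"
    using d(1) by (simp add: powr_mult)
  also have "d powr (1 - \<theta>) * d powr \<theta> = d" using d(1) by (simp flip: powr_add)
  finally show ?thesis using d(1) \<kappa>0 by (simp add: field_simps)
qed

section \<open>Passage from one chamber to the whole space\<close>

lemma orth_reflection_linear_hyperplane:
  fixes H :: "'a::euclidean_space set"
  assumes "linear_hyperplane H"
  obtains u where "norm u = 1" "H = {x. u \<bullet> x = 0}" "orth_reflection H = reflect u"
proof -
  have H: "subspace H" "dim H + 1 = DIM('a)" using assms by (auto simp: linear_hyperplane_def)
  then have "dim H = DIM('a) - 1" by simp
  then obtain a where a: "a \<noteq> 0" "span H = {x. a \<bullet> x = 0}"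
    using lowdim_eq_hyperplane[of H] by metis
  moreover have "span H = H" using H(1) by (simp only: span_eq_iff)
  ultimately have Ha: "H = {x. a \<bullet> x = 0}" by simp
  define u where "u = a /\<^sub>R norm a"
  show ?thesis
  proof
    show "norm u = 1" using a by (simp add: u_def)
    show "H = {x. u \<bullet> x = 0}" using a Ha by (auto simp: u_def)
    show "orth_reflection H = reflect u"
    proof
      fix x
      have "orth_reflection H x = x - (2 * (a \<bullet> x) / (a \<bullet> a)) *\<^sub>R a"
        unfolding Ha by (rule orth_reflection_hyperplane[OF a(1)])
      also have "\<dots> = reflect u x"
        using a by (simp add: reflect_def u_def inner_commute dot_square_norm power2_eq_square divide_inverse mult_ac)
      finally show "orth_reflection H x = reflect u x" .
    qed
  qed
qed

text \<open>\<open>R\<close> is enlarged to the set \<open>S\<close> of all common symmetry normals,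
  which is closed and a root set and so contains a finite spanning system. That system need not lie
  in \<open>R\<close>; this is why invariance of \<open>M\<close> is assumed for every reflection
  shared by \<open>K\<close> and \<open>L\<close>.\<close>

lemma gaussian_geometric_inequality:
  fixes K L M R :: "'a::euclidean_space set"
  assumes R: "span R = UNIV" "\<And>u. u \<in> R \<Longrightarrow> norm u = 1" "\<And>u. u \<in> R \<Longrightarrow> reflect u ` K \<subseteq> K"
      "\<And>u. u \<in> R \<Longrightarrow> reflect u ` L \<subseteq> L"
    and KL: "compact K" "compact L" and M: "compact M" "convex M" "\<And>u. reflect u ` K \<subseteq> K \<Longrightarrow> reflect u ` L \<subseteq> L \<Longrightarrow> reflect u ` M \<subseteq> M"
    and KLM: "\<And>x y. x \<in> K \<Longrightarrow> y \<in> L \<Longrightarrow> (1 - l) *\<^sub>R x + l *\<^sub>R y \<in> M"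
    and l: "0 < l" "l < 1" and \<theta>: "0 < \<theta>" "\<theta> < 1"
  shows "(((1 - l) / (1 - \<theta>)) powr (1 - \<theta>) * (l / \<theta>) powr \<theta>) ^ DIM('a)
      * (measure gaussian_measure K powr (1 - \<theta>) * measure gaussian_measure L powr \<theta>)
    \<le> measure gaussian_measure M"
proof -
  define S where "S = {u. norm u = 1 \<and> reflect u ` K \<subseteq> K \<and> reflect u ` L \<subseteq> L}"
  have RS: "R \<subseteq> S"
    unfolding S_def using R(2-4) by blast
  have "closed S"
  proof -
    have "closed ((\<lambda>u. reflect u x) -` X)" if "closed X" for x :: 'a and X
      using that by (rule closed_vimage) (auto simp: reflect_def intro!: continuous_intros)
    then have "closed (sphere 0 1 \<inter> (\<Inter>x\<in>K. (\<lambda>u. reflect u x) -` K) \<inter> (\<Inter>x\<in>L. (\<lambda>u. reflect u x) -` L))"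
      using KL by (intro closed_Int closed_INT) (auto intro: compact_imp_closed)
    also have "sphere 0 1 \<inter> (\<Inter>x\<in>K. (\<lambda>u. reflect u x) -` K) \<inter> (\<Inter>x\<in>L. (\<lambda>u. reflect u x) -` L) = S"
      by (auto simp: S_def)
    finally show ?thesis .
  qed
  moreover have "root_set S"
    unfolding root_set_def
  proof (intro conjI ballI)
    fix u v assume uv: "u \<in> S" "v \<in> S"
    have n: "norm u = 1" "norm v = 1" using uv by (auto simp: S_def)
    have "reflect (reflect u v) ` X \<subseteq> X" if "reflect u ` X \<subseteq> X" "reflect v ` X \<subseteq> X" for X
      using that by (auto simp: reflect_reflect[OF n(1)] image_subset_iff)
    moreover have "norm (reflect u v) = 1"
      using orthogonal_transformation_norm[OF orthogonal_transformation_reflect[OF n(1)]] n by simp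
    ultimately show "reflect u v \<in> S" using uv by (auto simp: S_def)
  qed (simp add: S_def)
  ultimately obtain \<Phi> where \<Phi>: "\<Phi> \<subseteq> S" "finite \<Phi>" "root_set \<Phi>" "span \<Phi> = span S"
    using finite_root_subset by metis
  have span: "span \<Phi> = UNIV"
    using \<Phi>(4) R(1) span_mono[OF RS] by auto
  have norm1: "norm \<alpha> = 1" if "\<alpha> \<in> \<Phi>" for \<alpha> using \<Phi>(3) that by (simp add: root_set_def)
  then have "0 \<notin> \<Phi>" by force
  then obtain \<rho> where \<rho>: "\<And>\<alpha>. \<alpha> \<in> \<Phi> \<Longrightarrow> \<rho> \<bullet> \<alpha> \<noteq> 0"
    using exists_generic_vector[OF \<Phi>(2)] by blast
  obtain D where D: "D \<subseteq> \<Phi>" "\<And>d. d \<in> D \<Longrightarrow> 0 < \<rho> \<bullet> d" "span D = UNIV" "independent D"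
    "\<And>d e. d \<in> D \<Longrightarrow> e \<in> D \<Longrightarrow> d \<noteq> e \<Longrightarrow> d \<bullet> e \<le> 0"
    "\<And>\<alpha>. \<alpha> \<in> \<Phi> \<Longrightarrow> 0 < \<rho> \<bullet> \<alpha> \<Longrightarrow> nonneg_comb D \<alpha>"
    using simple_system_exists[OF \<Phi>(2,3) span \<rho>] by metis
  have inv: "reflect u ` X = X" if "norm u = 1" "reflect u ` X \<subseteq> X" for u :: 'a and X
    using that by (metis image_subset_iff reflect_involution subsetI subset_antisym image_eqI)
  have \<Phi>inv: "reflect \<alpha> ` \<Phi> = \<Phi>" "reflect \<alpha> ` K = K" "reflect \<alpha> ` L = L" "reflect \<alpha> ` M = M" if "\<alpha> \<in> \<Phi>" for \<alpha>
  proof -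
    have \<alpha>: "norm \<alpha> = 1" "reflect \<alpha> ` K \<subseteq> K" "reflect \<alpha> ` L \<subseteq> L"
      using that \<Phi>(1) unfolding S_def by blast+
    show "reflect \<alpha> ` \<Phi> = \<Phi>" using \<Phi>(3) that by (intro inv \<alpha>) (auto simp: root_set_def)
    show "reflect \<alpha> ` K = K" "reflect \<alpha> ` L = L" "reflect \<alpha> ` M = M"
      by (rule inv[OF \<alpha>(1)], rule \<alpha> M(3)[OF \<alpha>(2,3)])+
  qed
  \<comment> \<open>All common orthogonal symmetries of \<Phi> and the three sets are taken, instead
    of the group generated by reflections: closure under composing with reflections is then
    immediate, and permuting \<Phi> gives finiteness.\<close>
  define G where "G = {g. orthogonal_transformation g \<and> g ` \<Phi> = \<Phi> \<and> g ` K = K \<and> g ` L = L \<and> g ` M = M}"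
  have G: "orthogonal_transformation g" "g ` \<Phi> = \<Phi>" if "g \<in> G" for g
    using that by (auto simp: G_def)
  have finG: "finite G"
    by (rule finite_linear_permuting[OF \<Phi>(2) span]) (simp_all add: G orthogonal_transformation_linear)
  have idG: "id \<in> G" by (simp add: G_def id_def)
  have reflG: "reflect \<alpha> \<circ> g \<in> G" if "g \<in> G" "\<alpha> \<in> \<Phi>" for g \<alpha>
  proof -
    have "(reflect \<alpha> \<circ> g) ` X = X" if "g ` X = X" "reflect \<alpha> ` X = X" for X
      by (simp only: image_comp[symmetric] that)
    then show ?thesis
      using that \<Phi>inv[OF that(2)] orthogonal_transformation_reflect[OF norm1[OF that(2)]]
      unfolding G_def by (auto intro!: orthogonal_transformation_compose simp del: image_comp)
  qed
  obtain N :: nat where N: "\<forall>X\<in>sets borel. (\<forall>g\<in>G. g ` X = X) \<longrightarrow>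
    emeasure gaussian_measure X = of_nat N * emeasure gaussian_measure (X \<inter> {x. \<forall>\<alpha>\<in>\<Phi>. 0 < \<rho> \<bullet> \<alpha> \<longrightarrow> 0 < x \<bullet> \<alpha>})"
    using chamber_decomposition[OF \<Phi>(2) \<open>0 \<notin> \<Phi>\<close> \<rho> root_set_uminus[OF \<Phi>(3)] finG idG G reflG] by blast
  define C where "C = {x. \<forall>d\<in>D. 0 < x \<bullet> d}"
  \<comment> \<open>Positivity on the simple roots suffices, because a positive root is a
    nonnegative combination of them with some positive coefficient.\<close>
  have CC: "{x. \<forall>\<alpha>\<in>\<Phi>. 0 < \<rho> \<bullet> \<alpha> \<longrightarrow> 0 < x \<bullet> \<alpha>} = C"
  proof (intro equalityI subsetI)
    fix x assume "x \<in> {x. \<forall>\<alpha>\<in>\<Phi>. 0 < \<rho> \<bullet> \<alpha> \<longrightarrow> 0 < x \<bullet> \<alpha>}"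
    then show "x \<in> C" using D(1,2) by (auto simp: C_def)
  next
    fix x assume x: "x \<in> C"
    show "x \<in> {x. \<forall>\<alpha>\<in>\<Phi>. 0 < \<rho> \<bullet> \<alpha> \<longrightarrow> 0 < x \<bullet> \<alpha>}"
    proof (intro CollectI ballI impI)
      fix \<alpha> assume \<alpha>: "\<alpha> \<in> \<Phi>" "0 < \<rho> \<bullet> \<alpha>"
      obtain c where c: "\<And>d. d \<in> D \<Longrightarrow> 0 \<le> c d" "\<alpha> = (\<Sum>d\<in>D. c d *\<^sub>R d)"
        using D(6)[OF \<alpha>] by (auto simp: nonneg_comb_def)
      have finD: "finite D" using D(1) \<Phi>(2) finite_subset by blast
      have "\<exists>d\<in>D. c d \<noteq> 0"
      proof (rule ccontr)
        assume "\<not> ?thesis"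
        then have "\<alpha> = 0" unfolding c(2) by (intro sum.neutral) auto
        then show False using \<alpha>(2) by simp
      qed
      then obtain d where d: "d \<in> D" "0 < c d" using c(1) by force
      have "0 < (\<Sum>d\<in>D. c d * (x \<bullet> d))"
        using finD d c(1) x by (intro sum_pos2[of D d]) (auto simp: C_def less_imp_le)
      then show "0 < x \<bullet> \<alpha>" unfolding c(2) by (simp add: inner_sum_right)
    qed
  qed
  have meas: "measure gaussian_measure X = real N * measure gaussian_measure (X \<inter> C)"
    if X: "compact X" "\<forall>g\<in>G. g ` X = X" for X
  proof -
    have "emeasure gaussian_measure X = of_nat N * emeasure gaussian_measure (X \<inter> C)"
      using N X borel_compact[OF X(1)] unfolding CC by blast
    then show ?thesis by (simp add: measure_def enn2real_mult)
  qed
  define \<kappa> where "\<kappa> = ((1 - l) / (1 - \<theta>)) powr (1 - \<theta>) * (l / \<theta>) powr \<theta>"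
  have "\<kappa> ^ DIM('a) * (measure gaussian_measure (K \<inter> C) powr (1 - \<theta>) * measure gaussian_measure (L \<inter> C) powr \<theta>)
    \<le> measure gaussian_measure (M \<inter> C)"
    unfolding \<kappa>_def C_def
  proof (rule gaussian_chamber_inequality[OF D(4,3) _ D(5) KL M(1,2) _ KLM l \<theta>])
    show "norm d = 1" if "d \<in> D" for d using norm1 D(1) that by blast
    show "reflect d ` M \<subseteq> M" if "d \<in> D" for d using \<Phi>inv(4)[of d] D(1) that by blast
  qed
  then have "real N * (\<kappa> ^ DIM('a) * (measure gaussian_measure (K \<inter> C) powr (1 - \<theta>) * measure gaussian_measure (L \<inter> C) powr \<theta>))
    \<le> real N * measure gaussian_measure (M \<inter> C)"
    by (rule mult_left_mono) simp
  also have "\<dots> = measure gaussian_measure M"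
    using M(1) by (intro meas[symmetric]) (auto simp: G_def)
  \<comment> \<open>The exponents add up to 1, so the chamber count leaves the two powers as a
    single factor \<open>N\<close>.\<close>
  also have "real N * (\<kappa> ^ DIM('a) * (measure gaussian_measure (K \<inter> C) powr (1 - \<theta>) * measure gaussian_measure (L \<inter> C) powr \<theta>))
     = \<kappa> ^ DIM('a) * (measure gaussian_measure K powr (1 - \<theta>) * measure gaussian_measure L powr \<theta>)"
  proof -
    have "measure gaussian_measure K powr (1 - \<theta>) * measure gaussian_measure L powr \<theta>
      = (real N * measure gaussian_measure (K \<inter> C)) powr (1 - \<theta>) * (real N * measure gaussian_measure (L \<inter> C)) powr \<theta>"
      using KL meas[of K] meas[of L] by (simp add: G_def)
    also have "\<dots> = (real N powr (1 - \<theta>) * real N powr \<theta>) * (measure gaussian_measure (K \<inter> C) powr (1 - \<theta>) * measure gaussian_measure (L \<inter> C) powr \<theta>)"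
      by (simp add: powr_mult)
    also have "real N powr (1 - \<theta>) * real N powr \<theta> = real N"
      by (cases "N = 0") (simp_all flip: powr_add)
    finally show ?thesis by simp
  qed
  finally show ?thesis unfolding \<kappa>_def .
qed

theorem theorem5:
  fixes l :: real
    and H :: "'n::finite \<Rightarrow> (real ^ 'n) set"
    and K L :: "(real ^ 'n) set"
  assumes "0 < l" "l < 1"
    and "\<And>i. linear_hyperplane (H i)"
    and "(\<Inter>i. H i) = {0}"
    and "convex_body K" "convex_body L"
    and "\<And>i. invariant_under (orth_reflection (H i)) K"
    and "\<And>i. invariant_under (orth_reflection (H i)) L"
  shows "measure gaussian_measure (minkowski_combination l K L) powr (1 / real CARD('n))
    \<ge> (1 - l) * measure gaussian_measure K powr (1 / real CARD('n))
      + l * measure gaussian_measure L powr (1 / real CARD('n))"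
proof -
  note l = assms(1,2)
  have K: "compact K" "convex K" "interior K \<noteq> {}" and L: "compact L" "convex L" "interior L \<noteq> {}"
    using assms(5,6) by (auto simp: convex_body_def)
  define M where "M = minkowski_combination l K L"
  let ?f = "\<lambda>(x, y). (1 - l) *\<^sub>R x + l *\<^sub>R y :: real ^ 'n"
  have Mf: "M = ?f ` (K \<times> L)" by (auto simp: M_def minkowski_combination_def)
  have "linear ?f"
    by (rule linearI) (auto simp: algebra_simps)
  then have "convex M" unfolding Mf using K(2) L(2) by (intro convex_linear_image convex_Times)
  have "compact M"
    unfolding Mf case_prod_beta using K(1) L(1)
    by (intro compact_continuous_image compact_Times continuous_intros)
  have "\<exists>u. norm u = 1 \<and> H i = {x. u \<bullet> x = 0} \<and> orth_reflection (H i) = reflect u" for i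
    using orth_reflection_linear_hyperplane[OF assms(3)[of i]] by metis
  then obtain u where u: "\<And>i. norm (u i) = 1" "\<And>i. H i = {x. u i \<bullet> x = 0}" "\<And>i. orth_reflection (H i) = reflect (u i)"
    by metis
  \<comment> \<open>A vector orthogonal to all normals lies in every \<open>H i\<close>, hence in
    their trivial intersection.\<close>
  have span: "span (range u) = UNIV"
  proof (rule ccontr)
    assume "span (range u) \<noteq> UNIV"
    then obtain a where a: "a \<noteq> 0" "\<forall>x\<in>span (range u). a \<bullet> x = 0"
      using span_not_UNIV_orthogonal by metis
    have "a \<in> H i" for i using a(2) span_base[of "u i" "range u"] by (metis (mono_tags) inner_commute mem_Collect_eq rangeI u(2))
    then have "a \<in> (\<Inter>i. H i)" by blast
    then show False using assms(4) a(1) by simp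
  qed
  have inv: "reflect (u i) ` K \<subseteq> K" "reflect (u i) ` L \<subseteq> L" for i
    using assms(7)[of i] assms(8)[of i] by (auto simp: invariant_under_def u(3))
  have invM: "reflect v ` M \<subseteq> M" if "reflect v ` K \<subseteq> K" "reflect v ` L \<subseteq> L" for v
  proof
    fix z assume "z \<in> reflect v ` M"
    then obtain x y where xy: "x \<in> K" "y \<in> L" "z = reflect v ((1 - l) *\<^sub>R x + l *\<^sub>R y)"
      unfolding M_def minkowski_combination_def by blast
    then have "z = (1 - l) *\<^sub>R reflect v x + l *\<^sub>R reflect v y"
      by (simp add: linear_add[OF linear_reflect] linear_scale[OF linear_reflect])
    moreover have "reflect v x \<in> K" "reflect v y \<in> L" using that xy by blast+
    ultimately show "z \<in> M" unfolding M_def minkowski_combination_def by blast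
  qed
  \<comment> \<open>Nonempty interior gives positive measure, which places the exponent \<theta>
    chosen below strictly between 0 and 1.\<close>
  have pos: "0 < measure gaussian_measure X" if X: "compact X" "interior X \<noteq> {}" for X :: "(real ^ 'n) set"
  proof -
    have b: "X \<in> sets borel" using X(1) by (rule borel_compact)
    show ?thesis
      using emeasure_gaussian_interior[OF b X(2)] emeasure_gaussian_bounded[OF b compact_imp_bounded[OF X(1)]]
      by (simp add: measure_def enn2real_positive_iff)
  qed
  define n where "n = CARD('n)"
  have n: "0 < n" by (simp add: n_def)
  define A where "A = measure gaussian_measure K powr (1 / real n)"
  define B where "B = measure gaussian_measure L powr (1 / real n)"
  have AB: "0 < A" "0 < B" using pos[OF K(1,3)] pos[OF L(1,3)] by (auto simp: A_def B_def)
  have pow: "(x powr (1 / real n)) ^ n = x" if "0 < x" for x :: real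
    using that n by (simp add: powr_power)
  have swap: "(x ^ n) powr r = (x powr r) ^ n" if "0 < x" for x r :: real
    using that by (simp add: powr_powr mult.commute flip: powr_realpow)
  have An: "A ^ n = measure gaussian_measure K" "B ^ n = measure gaussian_measure L"
    using pos[OF K(1,3)] pos[OF L(1,3)] by (auto simp: A_def B_def pow)
  define E where "E = (1 - l) * A + l * B"
  \<comment> \<open>The maximiser of the bound: it makes
    \<open>(1 - l) / (1 - \<theta>) = E / A\<close> and \<open>l / \<theta> = E / B\<close>, so the
    powers of \<open>A\<close> and \<open>B\<close> cancel and exactly \<open>E ^ n\<close>
    remains.\<close>
  define \<theta> where "\<theta> = l * B / E"
  have E: "0 < E" using l AB by (simp add: E_def add_pos_pos)
  have \<theta>1: "1 - \<theta> = (1 - l) * A / E" using E by (simp add: \<theta>_def E_def field_simps)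
  have \<theta>: "0 < \<theta>" "\<theta> < 1"
  proof -
    show "0 < \<theta>" using l AB E by (simp add: \<theta>_def)
    have "0 < 1 - \<theta>" unfolding \<theta>1 using l AB E by simp
    then show "\<theta> < 1" by simp
  qed
  have "(((1 - l) / (1 - \<theta>)) powr (1 - \<theta>) * (l / \<theta>) powr \<theta>) ^ n
      * (measure gaussian_measure K powr (1 - \<theta>) * measure gaussian_measure L powr \<theta>)
    \<le> measure gaussian_measure M"
  proof -
    have "(1 - l) *\<^sub>R x + l *\<^sub>R y \<in> M" if "x \<in> K" "y \<in> L" for x y
      unfolding M_def minkowski_combination_def using that by blast
    then have "(((1 - l) / (1 - \<theta>)) powr (1 - \<theta>) * (l / \<theta>) powr \<theta>) ^ DIM(real ^ 'n)
        * (measure gaussian_measure K powr (1 - \<theta>) * measure gaussian_measure L powr \<theta>)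
      \<le> measure gaussian_measure M"
      using u(1) inv
      by (intro gaussian_geometric_inequality[OF span _ _ _ K(1) L(1) \<open>compact M\<close> \<open>convex M\<close> invM _ l \<theta>]) blast+
    then show ?thesis by (simp add: n_def)
  qed
  also have "(((1 - l) / (1 - \<theta>)) powr (1 - \<theta>) * (l / \<theta>) powr \<theta>) ^ n
      * (measure gaussian_measure K powr (1 - \<theta>) * measure gaussian_measure L powr \<theta>) = E ^ n"
  proof -
    have 1: "(1 - l) / (1 - \<theta>) = E / A" unfolding \<theta>1 using l AB E by (simp add: field_simps)
    have 2: "l / \<theta> = E / B" unfolding \<theta>_def using l AB E by (simp add: field_simps)
    have "(E / A) powr (1 - \<theta>) * (E / B) powr \<theta> * (A powr (1 - \<theta>) * B powr \<theta>) = E powr (1 - \<theta>) * E powr \<theta>"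
      using AB E by (simp add: powr_divide)
    also have "\<dots> = E" using E by (simp flip: powr_add)
    finally have 3: "(E / A) powr (1 - \<theta>) * (E / B) powr \<theta> * (A powr (1 - \<theta>) * B powr \<theta>) = E" .
    show ?thesis
      unfolding 1 2 An[symmetric] swap[OF AB(1)] swap[OF AB(2)] power_mult_distrib[symmetric] 3 ..
  qed
  finally have "E ^ n \<le> measure gaussian_measure M" .
  then have "(E ^ n) powr (1 / real n) \<le> measure gaussian_measure M powr (1 / real n)"
    using E by (intro powr_mono2) auto
  moreover have "(E ^ n) powr (1 / real n) = E"
    using E n by (simp add: swap pow)
  ultimately show ?thesis
    by (simp add: E_def A_def B_def M_def n_def)
qed

end
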